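(* Let $K$ be a field and let $\mathcal{FK}_3$ be the Fomin--Kirillov algebra on three vertices over $K$. Then $$\#\Gamma_{2,2}(\mathcal{FK}_3)=\begin{cases}4 & \text{if } \mathrm{char}(K)=3,\ \text{or } \mathrm{char}(K)\neq 3 \text{ and } \zeta_3\notin K,\\ 6 & \text{if } \mathrm{char}(K)\neq 3 \text{ and } \zeta_3\in K,\end{cases}$$ where $\zeta_3$ denotes a primitive cubic root of unity. For every $d>2$, $\Gamma_{2,d}(\mathcal{FK}_3)=\emptyset$.
   Context: The Fomin--Kirillov algebra on three vertices is $$\mathcal{FK}_3=K\langle a,b,c\rangle/\langle a^2,\ b^2,\ c^2,\ ca-ab-bc,\ cb-ac+ba\rangle,$$ graded with $a,b,c$ in degree $1$. For a connected graded algebra $A$ generated in degree one, $\Gamma_{c,d}(A)$ denotes the set of graded (left) $A$-modules $M=M_0\oplus\cdots\oplus M_d$ generated in degree zero with Hilbert polynomial $c+ct+\cdots+ct^d$ (truncated thick point modules of width $c$ and degree $d$), up to graded isomorphism. *)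

theory Defs
  imports "HOL.Hull" "HOL.Vector_Spaces" "HOL-Library.Poly_Mapping" "HOL-Library.Function_Algebras"
begin

section \<open>Free algebras and two-sided ideals\<close>

text \<open>
  Words are written additively, because the convolution product of \<open>\<Rightarrow>\<^sub>0\<close> is indexed
  by an additive monoid.  Hence the finitely supported functions on words with values in
  \<open>'k\<close> are the free associative unital algebra over \<open>'k\<close>.
\<close>

datatype 'x free_monoid = Word (letters: "'x list")

instantiation free_monoid :: (type) monoid_add
begin

definition zero_free_monoid :: "'a free_monoid" where
  "0 = Word []"

definition plus_free_monoid :: "'a free_monoid \<Rightarrow> 'a free_monoid \<Rightarrow> 'a free_monoid" where
  "u + v = Word (letters u @ letters v)"

instance
  by standard (simp_all add: zero_free_monoid_def plus_free_monoid_def)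

end

definition word_length :: "'x free_monoid \<Rightarrow> nat" where
  "word_length w = length (letters w)"

lemma word_length_zero [simp]: "word_length 0 = 0"
  by (simp add: word_length_def zero_free_monoid_def)

lemma word_length_plus [simp]: "word_length (u + v) = word_length u + word_length v"
  by (simp add: word_length_def plus_free_monoid_def)

lemma word_length_eq_0 [simp]: "word_length w = 0 \<longleftrightarrow> w = 0"
  by (cases w) (simp add: word_length_def zero_free_monoid_def)

type_synonym ('x, 'k) free_algebra = "'x free_monoid \<Rightarrow>\<^sub>0 'k"

definition letter :: "'x \<Rightarrow> ('x, 'k::field) free_algebra" where
  "letter x = Poly_Mapping.single (Word [x]) 1"

definition free_scale :: "'k::field \<Rightarrow> ('x, 'k) free_algebra \<Rightarrow> ('x, 'k) free_algebra" where
  "free_scale k p = Poly_Mapping.single 0 k * p"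

definition free_degree :: "nat \<Rightarrow> ('x, 'k::field) free_algebra set" where
  "free_degree n = {p. \<forall>w \<in> Poly_Mapping.keys p. word_length w = n}"

definition two_sided_ideal :: "'r::ring_1 set \<Rightarrow> bool" where
  "two_sided_ideal I \<longleftrightarrow>
     0 \<in> I \<and> (\<forall>x\<in>I. \<forall>y\<in>I. x + y \<in> I) \<and> (\<forall>r. \<forall>x\<in>I. r * x \<in> I \<and> x * r \<in> I)"

lemma two_sided_ideal_hull: "two_sided_ideal (two_sided_ideal hull S)"
  by (rule hull_in) (auto simp: two_sided_ideal_def)

lemma two_sided_ideal_uminus:
  assumes "two_sided_ideal I" "x \<in> I"
  shows "- x \<in> I"
proof -
  have "(-1) * x \<in> I"
    using assms unfolding two_sided_ideal_def by blast
  then show ?thesis by simp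
qed

lemma two_sided_ideal_diff:
  assumes "two_sided_ideal I" "x \<in> I" "y \<in> I"
  shows "x - y \<in> I"
  using assms two_sided_ideal_uminus[OF assms(1,3)]
  unfolding two_sided_ideal_def by (metis diff_conv_add_uminus)


section \<open>The Fomin--Kirillov algebra on three vertices\<close>

datatype fk_gen = Gen_a | Gen_b | Gen_c

definition fk3_relations :: "(fk_gen, 'k::field) free_algebra set" where
  "fk3_relations =
     (let a = letter Gen_a; b = letter Gen_b; c = letter Gen_c
      in {a * a, b * b, c * c, c * a - a * b - b * c, c * b - a * c + b * a})"

definition fk3_ideal :: "(fk_gen, 'k::field) free_algebra set" where
  "fk3_ideal = two_sided_ideal hull fk3_relations"

lemma two_sided_ideal_fk3: "two_sided_ideal fk3_ideal"
  unfolding fk3_ideal_def by (rule two_sided_ideal_hull)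

definition fk3_rel :: "(fk_gen, 'k::field) free_algebra \<Rightarrow> (fk_gen, 'k) free_algebra \<Rightarrow> bool" where
  "fk3_rel p q \<longleftrightarrow> p - q \<in> fk3_ideal"

lemma fk3_rel_equivp: "equivp fk3_rel"
proof (rule equivpI)
  note I = two_sided_ideal_fk3
  show "reflp fk3_rel"
    using I by (auto intro!: reflpI simp: fk3_rel_def two_sided_ideal_def)
  show "symp fk3_rel"
    by (rule sympI) (metis I fk3_rel_def minus_diff_eq two_sided_ideal_uminus)
  show "transp fk3_rel"
  proof (rule transpI)
    fix x y z :: "(fk_gen, 'k::field) free_algebra"
    assume "fk3_rel x y" "fk3_rel y z"
    then have "(x - y) + (y - z) \<in> fk3_ideal"
      using I unfolding fk3_rel_def two_sided_ideal_def by blast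
    then show "fk3_rel x z" by (simp add: fk3_rel_def)
  qed
qed

quotient_type (overloaded) 'k fk3 = "(fk_gen, 'k::field) free_algebra" / fk3_rel
  by (rule fk3_rel_equivp)

lemma lookup_mult_0:
  fixes p q :: "('x, 'k::field) free_algebra"
  shows "Poly_Mapping.lookup (p * q) 0 = Poly_Mapping.lookup p 0 * Poly_Mapping.lookup q 0"
proof -
  have split0: "(0 = u + v) \<longleftrightarrow> (v = 0 \<and> u = 0)" for u v :: "'x free_monoid"
    by (auto simp: zero_free_monoid_def plus_free_monoid_def free_monoid.expand)
  have "(\<Sum>v. Poly_Mapping.lookup q v when (0 = u + v)) = (Poly_Mapping.lookup q 0 when u = 0)" for u
    unfolding split0 when_when[symmetric] by (subst when_commute) simp
  then have "Poly_Mapping.lookup (p * q) 0 = (\<Sum>u. Poly_Mapping.lookup p u * (Poly_Mapping.lookup q 0 when u = 0))"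
    by (simp add: lookup_mult)
  also have "\<dots> = (\<Sum>u. (Poly_Mapping.lookup p u * Poly_Mapping.lookup q 0) when u = 0)"
    by (rule arg_cong[where f = Sum_any]) (auto simp: when_def)
  finally show ?thesis by simp
qed

lemma lookup_letter_0: "Poly_Mapping.lookup (letter x) 0 = 0"
  by (simp add: letter_def lookup_single zero_free_monoid_def)

lemma lookup_fk3_ideal_0:
  assumes "x \<in> fk3_ideal"
  shows "Poly_Mapping.lookup x 0 = 0"
proof -
  have "fk3_ideal \<subseteq> {x. Poly_Mapping.lookup x 0 = 0}"
    unfolding fk3_ideal_def
  proof (rule hull_minimal)
    show "fk3_relations \<subseteq> {x. Poly_Mapping.lookup x 0 = 0}"
      by (auto simp: fk3_relations_def Let_def lookup_mult_0 lookup_minus lookup_add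
          lookup_letter_0)
    show "two_sided_ideal {x :: (fk_gen, 'k::field) free_algebra. Poly_Mapping.lookup x 0 = 0}"
      by (auto simp: two_sided_ideal_def lookup_add lookup_mult_0)
  qed
  with assms show ?thesis by auto
qed

instantiation fk3 :: (field) ring_1
begin

lift_definition zero_fk3 :: "'a fk3" is 0 .
lift_definition one_fk3 :: "'a fk3" is 1 .

lift_definition plus_fk3 :: "'a fk3 \<Rightarrow> 'a fk3 \<Rightarrow> 'a fk3" is "(+)"
proof -
  fix p q r s :: "(fk_gen, 'a) free_algebra"
  assume "fk3_rel p q" "fk3_rel r s"
  then have "(p - q) + (r - s) \<in> fk3_ideal"
    using two_sided_ideal_fk3 unfolding fk3_rel_def two_sided_ideal_def by blast
  then show "fk3_rel (p + r) (q + s)" by (simp add: fk3_rel_def algebra_simps)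
qed

lift_definition uminus_fk3 :: "'a fk3 \<Rightarrow> 'a fk3" is uminus
proof -
  fix p q :: "(fk_gen, 'a) free_algebra"
  assume "fk3_rel p q"
  then have "- (p - q) \<in> fk3_ideal"
    unfolding fk3_rel_def by (rule two_sided_ideal_uminus[OF two_sided_ideal_fk3])
  then show "fk3_rel (- p) (- q)" by (simp add: fk3_rel_def)
qed

lift_definition minus_fk3 :: "'a fk3 \<Rightarrow> 'a fk3 \<Rightarrow> 'a fk3" is "(-)"
proof -
  fix p q r s :: "(fk_gen, 'a) free_algebra"
  assume "fk3_rel p q" "fk3_rel r s"
  then have "(p - q) - (r - s) \<in> fk3_ideal"
    unfolding fk3_rel_def by (rule two_sided_ideal_diff[OF two_sided_ideal_fk3])
  then show "fk3_rel (p - r) (q - s)" by (simp add: fk3_rel_def algebra_simps)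
qed

lift_definition times_fk3 :: "'a fk3 \<Rightarrow> 'a fk3 \<Rightarrow> 'a fk3" is "(*)"
proof -
  fix p q r s :: "(fk_gen, 'a) free_algebra"
  assume "fk3_rel p q" "fk3_rel r s"
  then have "(p - q) * r + q * (r - s) \<in> fk3_ideal"
    using two_sided_ideal_fk3 unfolding fk3_rel_def two_sided_ideal_def by blast
  then show "fk3_rel (p * r) (q * s)" by (simp add: fk3_rel_def algebra_simps)
qed

instance
proof
  note refl = equivp_reflp[OF fk3_rel_equivp]
  fix x y z :: "'a fk3"
  show "x + y + z = x + (y + z)" by transfer (simp add: add.assoc refl)
  show "x + y = y + x" by transfer (simp add: add.commute refl)
  show "0 + x = x" by transfer (simp add: refl)
  show "- x + x = 0" by transfer (simp add: refl)
  show "x - y = x + - y" by transfer (simp add: refl)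
  show "x * y * z = x * (y * z)" by transfer (simp add: mult.assoc refl)
  show "1 * x = x" by transfer (simp add: refl)
  show "x * 1 = x" by transfer (simp add: refl)
  show "(x + y) * z = x * z + y * z" by transfer (simp add: distrib_right refl)
  show "x * (y + z) = x * y + x * z" by transfer (simp add: distrib_left refl)
  show "0 \<noteq> (1 :: 'a fk3)"
  proof (transfer, rule notI)
    assume "fk3_rel 0 (1 :: (fk_gen, 'a) free_algebra)"
    then have "Poly_Mapping.lookup (- 1 :: (fk_gen, 'a) free_algebra) 0 = 0"
      by (auto simp: fk3_rel_def dest: lookup_fk3_ideal_0)
    then show False by (simp add: lookup_one)
  qed
qed

end

lift_definition fk3_scale :: "'k::field \<Rightarrow> 'k fk3 \<Rightarrow> 'k fk3" is free_scale
proof -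
  fix k and p q :: "(fk_gen, 'k) free_algebra"
  assume "fk3_rel p q"
  then have "free_scale k (p - q) \<in> fk3_ideal"
    using two_sided_ideal_fk3 unfolding fk3_rel_def two_sided_ideal_def free_scale_def by blast
  then show "fk3_rel (free_scale k p) (free_scale k q)"
    by (simp add: fk3_rel_def free_scale_def algebra_simps)
qed

definition fk3_degree :: "nat \<Rightarrow> 'k::field fk3 set" where
  "fk3_degree n = abs_fk3 ` free_degree n"


section \<open>Graded algebras and graded modules\<close>

definition internal_direct_sum ::
  "('k::field \<Rightarrow> 'v::ab_group_add \<Rightarrow> 'v) \<Rightarrow> 'v set \<Rightarrow> (nat \<Rightarrow> 'v set) \<Rightarrow> bool" where
  "internal_direct_sum s V W \<longleftrightarrow>
     (\<forall>i. module.subspace s (W i)) \<and>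
     V = module.span s (\<Union>i. W i) \<and>
     (\<forall>I f. finite I \<and> (\<forall>i\<in>I. f i \<in> W i) \<and> sum f I = 0 \<longrightarrow> (\<forall>i\<in>I. f i = 0))"

text \<open>Unlike \<open>dim\<close>, this distinguishes dimension zero from infinite dimension.\<close>

definition has_dimension ::
  "('k::field \<Rightarrow> 'v::ab_group_add \<Rightarrow> 'v) \<Rightarrow> 'v set \<Rightarrow> nat \<Rightarrow> bool" where
  "has_dimension s V n \<longleftrightarrow>
     (\<exists>B. B \<subseteq> V \<and> finite B \<and> \<not> module.dependent s B \<and> module.span s B = V \<and> card B = n)"

definition connected_graded_algebra ::
  "('k::field \<Rightarrow> 'a::ring_1 \<Rightarrow> 'a) \<Rightarrow> (nat \<Rightarrow> 'a set) \<Rightarrow> bool" where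
  "connected_graded_algebra sA A \<longleftrightarrow>
     vector_space sA \<and>
     (\<forall>k x y. sA k (x * y) = sA k x * y \<and> sA k (x * y) = x * sA k y) \<and>
     internal_direct_sum sA UNIV A \<and>
     (\<forall>i j. \<forall>x\<in>A i. \<forall>y\<in>A j. x * y \<in> A (i + j)) \<and>
     A 0 = range (\<lambda>k. sA k 1)"

definition generated_in_degree_one ::
  "('k::field \<Rightarrow> 'a::ring_1 \<Rightarrow> 'a) \<Rightarrow> (nat \<Rightarrow> 'a set) \<Rightarrow> bool" where
  "generated_in_degree_one sA A \<longleftrightarrow>
     (\<forall>n. A (Suc n) = module.span sA {x * y |x y. x \<in> A 1 \<and> y \<in> A n})"

text \<open>
  The underlying vector space of a module is a subspace \<open>carrier M\<close> of an ambient vector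
  space \<open>'v\<close>; the values of \<open>act M x\<close> outside of the carrier are irrelevant.
\<close>

record ('a, 'v) graded_module =
  carrier :: "'v set"
  act :: "'a \<Rightarrow> 'v \<Rightarrow> 'v"
  component :: "nat \<Rightarrow> 'v set"

definition is_graded_module ::
  "('k::field \<Rightarrow> 'a::ring_1 \<Rightarrow> 'a) \<Rightarrow> (nat \<Rightarrow> 'a set) \<Rightarrow> ('k \<Rightarrow> 'v::ab_group_add \<Rightarrow> 'v) \<Rightarrow>
   ('a, 'v) graded_module \<Rightarrow> bool" where
  "is_graded_module sA A sV M \<longleftrightarrow>
     module.subspace sV (carrier M) \<and>
     (\<forall>x. \<forall>u\<in>carrier M. act M x u \<in> carrier M) \<and>
     (\<forall>x. \<forall>u\<in>carrier M. \<forall>v\<in>carrier M. act M x (u + v) = act M x u + act M x v) \<and>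
     (\<forall>x y. \<forall>u\<in>carrier M. act M (x + y) u = act M x u + act M y u) \<and>
     (\<forall>x y. \<forall>u\<in>carrier M. act M (x * y) u = act M x (act M y u)) \<and>
     (\<forall>u\<in>carrier M. act M 1 u = u) \<and>
     (\<forall>k x. \<forall>u\<in>carrier M. act M (sA k x) u = sV k (act M x u)) \<and>
     internal_direct_sum sV (carrier M) (component M) \<and>
     (\<forall>i j. \<forall>x\<in>A i. \<forall>u\<in>component M j. act M x u \<in> component M (i + j))"

definition generated_in_degree_zero ::
  "('k::field \<Rightarrow> 'v::ab_group_add \<Rightarrow> 'v) \<Rightarrow> ('a, 'v) graded_module \<Rightarrow> bool" where
  "generated_in_degree_zero sV M \<longleftrightarrow>
     carrier M = module.span sV {act M x u |x u. u \<in> component M 0}"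

definition graded_isomorphic ::
  "('a, 'v::ab_group_add) graded_module \<Rightarrow> ('a, 'w::ab_group_add) graded_module \<Rightarrow> bool" where
  "graded_isomorphic M N \<longleftrightarrow>
     (\<exists>f. bij_betw f (carrier M) (carrier N) \<and>
          (\<forall>u\<in>carrier M. \<forall>v\<in>carrier M. f (u + v) = f u + f v) \<and>
          (\<forall>x. \<forall>u\<in>carrier M. f (act M x u) = act N x (f u)) \<and>
          (\<forall>i. f ` component M i = component N i))"

text \<open>The Hilbert polynomial is \<open>c + c t + \<dots> + c t\<^sup>d\<close>.\<close>

definition truncated_thick_point_module ::
  "('k::field \<Rightarrow> 'a::ring_1 \<Rightarrow> 'a) \<Rightarrow> (nat \<Rightarrow> 'a set) \<Rightarrow> ('k \<Rightarrow> 'v::ab_group_add \<Rightarrow> 'v) \<Rightarrow>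
   nat \<Rightarrow> nat \<Rightarrow> ('a, 'v) graded_module \<Rightarrow> bool" where
  "truncated_thick_point_module sA A sV c d M \<longleftrightarrow>
     is_graded_module sA A sV M \<and>
     generated_in_degree_zero sV M \<and>
     (\<forall>i. has_dimension sV (component M i) (if i \<le> d then c else 0))"

definition coord_scale :: "'k::field \<Rightarrow> (nat \<Rightarrow> 'k) \<Rightarrow> (nat \<Rightarrow> 'k)" where
  "coord_scale k v = (\<lambda>i. k * v i)"

text \<open>
  Truncated thick point modules are finite-dimensional, so it suffices to consider those inside
  the fixed ambient space \<open>nat \<Rightarrow> 'k\<close>; see \<open>thick_point_module_coordinates\<close> below.
\<close>

definition Gamma ::
  "('k::field \<Rightarrow> 'a::ring_1 \<Rightarrow> 'a) \<Rightarrow> (nat \<Rightarrow> 'a set) \<Rightarrow> nat \<Rightarrow> nat \<Rightarrow>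
   ('a, nat \<Rightarrow> 'k) graded_module set set" where
  "Gamma sA A c d =
     {M. truncated_thick_point_module sA A coord_scale c d M} //
     {(M, N). truncated_thick_point_module sA A coord_scale c d M \<and>
              truncated_thick_point_module sA A coord_scale c d N \<and> graded_isomorphic M N}"

definition primitive_root :: "nat \<Rightarrow> 'k::field \<Rightarrow> bool" where
  "primitive_root n z \<longleftrightarrow> n > 0 \<and> z ^ n = 1 \<and> (\<forall>m\<in>{0<..<n}. z ^ m \<noteq> 1)"


section \<open>Isomorphism classes do not depend on the ambient space\<close>

lemma vector_space_coord_scale: "vector_space coord_scale"
  by unfold_locales (auto simp: coord_scale_def algebra_simps fun_eq_iff)

lemma component_subset_carrier:
  assumes "vector_space sV" "is_graded_module sA A sV M"
  shows "component M i \<subseteq> carrier M"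
proof -
  interpret V: vector_space sV by fact
  show ?thesis
    using assms(2) V.span_superset[of "\<Union>i. component M i"]
    unfolding is_graded_module_def internal_direct_sum_def by auto
qed

lemma graded_isomorphic_refl: "graded_isomorphic M M"
  unfolding graded_isomorphic_def by (rule exI[of _ id]) auto

lemma graded_isomorphic_sym:
  assumes V: "vector_space sV" and M: "is_graded_module sA A sV M" and iso: "graded_isomorphic M N"
  shows "graded_isomorphic N M"
proof -
  interpret V: vector_space sV by fact
  obtain f where bij: "bij_betw f (carrier M) (carrier N)"
    and add: "\<forall>u\<in>carrier M. \<forall>v\<in>carrier M. f (u + v) = f u + f v"
    and lin: "\<forall>x. \<forall>u\<in>carrier M. f (act M x u) = act N x (f u)"
    and deg: "\<forall>i. f ` component M i = component N i"
    using iso unfolding graded_isomorphic_def by blast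
  define g where "g = inv_into (carrier M) f"
  have bij': "bij_betw g (carrier N) (carrier M)"
    unfolding g_def using bij by (rule bij_betw_inv_into)
  have gf: "g (f u) = u" if "u \<in> carrier M" for u
    using bij that unfolding g_def by (rule bij_betw_inv_into_left)
  have fg: "f (g u) = u" "g u \<in> carrier M" if "u \<in> carrier N" for u
    using bij_betw_inv_into_right[OF bij that] bij_betw_apply[OF bij' that]
    by (simp_all add: g_def)
  have sub: "V.subspace (carrier M)"
    and cl: "\<And>x u. u \<in> carrier M \<Longrightarrow> act M x u \<in> carrier M"
    using M unfolding is_graded_module_def by blast+
  show ?thesis
    unfolding graded_isomorphic_def
  proof (intro exI[of _ g] conjI ballI allI)
    show "bij_betw g (carrier N) (carrier M)" by fact
    show "g (u + v) = g u + g v" if "u \<in> carrier N" "v \<in> carrier N" for u v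
    proof -
      have "u + v = f (g u + g v)" using add that by (simp add: fg)
      then show ?thesis using that by (simp add: gf fg V.subspace_add[OF sub])
    qed
    show "g (act N x u) = act M x (g u)" if "u \<in> carrier N" for x u
    proof -
      have "act N x u = f (act M x (g u))" using lin that by (simp add: fg)
      then show ?thesis using that by (simp add: gf fg cl)
    qed
    show "g ` component N i = component M i" for i
    proof -
      have "g ` f ` component M i = (\<lambda>u. u) ` component M i"
        unfolding image_image
        by (rule image_cong) (use gf component_subset_carrier[OF V M] in auto)
      then show ?thesis by (simp add: deg)
    qed
  qed
qed

lemma graded_isomorphic_trans:
  assumes "graded_isomorphic M N" "graded_isomorphic N P"
  shows "graded_isomorphic M P"
proof -
  obtain f where f: "bij_betw f (carrier M) (carrier N)"
    "\<forall>u\<in>carrier M. \<forall>v\<in>carrier M. f (u + v) = f u + f v"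
    "\<forall>x. \<forall>u\<in>carrier M. f (act M x u) = act N x (f u)" "\<forall>i. f ` component M i = component N i"
    using assms(1) unfolding graded_isomorphic_def by blast
  obtain g where g: "bij_betw g (carrier N) (carrier P)"
    "\<forall>u\<in>carrier N. \<forall>v\<in>carrier N. g (u + v) = g u + g v"
    "\<forall>x. \<forall>u\<in>carrier N. g (act N x u) = act P x (g u)" "\<forall>i. g ` component N i = component P i"
    using assms(2) unfolding graded_isomorphic_def by blast
  have m: "f u \<in> carrier N" if "u \<in> carrier M" for u
    using f(1) that by (rule bij_betw_apply)
  show ?thesis
    unfolding graded_isomorphic_def
  proof (intro exI[of _ "g \<circ> f"] conjI allI)
    show "(g \<circ> f) ` component M i = component P i" for i
      using f(4) g(4) by (metis image_comp)
    show "bij_betw (g \<circ> f) (carrier M) (carrier P)"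
      by (rule bij_betw_trans[OF f(1) g(1)])
  qed (use f(2,3) g(2,3) m in auto)
qed

lemma equiv_graded_isomorphic:
  fixes sA :: "'k::field \<Rightarrow> 'a::ring_1 \<Rightarrow> 'a"
  shows "equiv {M. truncated_thick_point_module sA A coord_scale c d M}
     {(M, N). truncated_thick_point_module sA A coord_scale c d M \<and>
              truncated_thick_point_module sA A coord_scale c d N \<and> graded_isomorphic M N}"
    (is "equiv ?S ?R")
proof (rule equivI)
  have sym: "graded_isomorphic N M" if "M \<in> ?S" "graded_isomorphic M N"
    for M N :: "('a, nat \<Rightarrow> 'k) graded_module"
    using graded_isomorphic_sym[OF vector_space_coord_scale _ that(2)] that(1)
    unfolding truncated_thick_point_module_def by blast
  show "?R \<subseteq> ?S \<times> ?S" by blast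
  show "refl_on ?S ?R" by (rule refl_onI) (simp add: graded_isomorphic_refl)
  show "sym ?R" by (rule symI) (simp add: sym)
  show "trans ?R"
  proof (rule transI)
    fix M N P assume "(M, N) \<in> ?R" "(N, P) \<in> ?R"
    then show "(M, P) \<in> ?R" using graded_isomorphic_trans[of M N P] by simp
  qed
qed

lemma independent_unit_vectors:
  "\<not> module.dependent coord_scale (range (\<lambda>j::nat. (\<lambda>i. if i = j then 1 else 0 :: 'k::field)))"
proof -
  interpret C: vector_space coord_scale by (rule vector_space_coord_scale)
  let ?e = "\<lambda>j::nat. (\<lambda>i. if i = j then 1 else 0 :: 'k)"
  have "u v = 0"
    if T: "finite T" "T \<subseteq> range ?e" "(\<Sum>w\<in>T. coord_scale (u w) w) = 0" "v \<in> T" for T u v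
  proof -
    obtain j where j: "v = ?e j" using T(2,4) by auto
    have app: "(\<Sum>w\<in>T. F w) j = (\<Sum>w\<in>T. F w j)" for F :: "_ \<Rightarrow> nat \<Rightarrow> 'k"
      by (induction T rule: infinite_finite_induct) auto
    have "0 = (\<Sum>w\<in>T. coord_scale (u w) w j)"
      using fun_cong[OF T(3), of j] by (simp add: app)
    also have "\<dots> = (\<Sum>w\<in>T. if w = v then u w else 0)"
    proof (rule sum.cong[OF refl])
      fix w assume "w \<in> T"
      then obtain l where l: "w = ?e l" using T(2) by auto
      have "w j = (if w = v then 1 else 0)"
        by (auto simp: l j fun_eq_iff)
      then show "coord_scale (u w) w j = (if w = v then u w else 0)"
        by (simp add: coord_scale_def)
    qed
    also have "\<dots> = u v" using T by simp
    finally show ?thesis by simp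
  qed
  then show ?thesis
    unfolding C.independent_explicit_module by simp
qed

lemma thick_point_module_coordinates:
  fixes sV :: "'k::field \<Rightarrow> 'v::ab_group_add \<Rightarrow> 'v"
  assumes vs: "vector_space sV" and M: "truncated_thick_point_module sA A sV c d M"
  obtains N where "truncated_thick_point_module sA A coord_scale c d N" "graded_isomorphic M N"
proof -
  interpret V: vector_space sV by fact
  interpret C: vector_space coord_scale by (rule vector_space_coord_scale)
  interpret VC: vector_space_pair sV coord_scale ..
  have gm: "is_graded_module sA A sV M" and gen: "generated_in_degree_zero sV M"
    and dim: "\<And>i. has_dimension sV (component M i) (if i \<le> d then c else 0)"
    using M unfolding truncated_thick_point_module_def by auto
  have ds: "internal_direct_sum sV (carrier M) (component M)" and sub: "V.subspace (carrier M)"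
    using gm unfolding is_graded_module_def by auto
  have comp: "component M i \<subseteq> carrier M" for i
    using component_subset_carrier[OF vs gm] .

  obtain B where B: "\<And>i. B i \<subseteq> component M i" "\<And>i. finite (B i)" "\<And>i. \<not> V.dependent (B i)"
      "\<And>i. V.span (B i) = component M i" "\<And>i. card (B i) = (if i \<le> d then c else 0)"
    using dim unfolding has_dimension_def by metis
  have B0: "B i = {}" if "i > d" for i
    using B(2,5)[of i] that by simp
  have fin: "finite (\<Union>i. B i)"
  proof -
    have "(\<Union>i. B i) \<subseteq> (\<Union>i\<in>{..d}. B i)"
    proof
      fix b assume "b \<in> (\<Union>i. B i)"
      then obtain i where "b \<in> B i" by blast
      with B0[of i] show "b \<in> (\<Union>i\<in>{..d}. B i)" by (cases "i \<le> d") auto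
    qed
    then show ?thesis
      by (rule finite_subset) (use B(2) in auto)
  qed
  have span1: "carrier M = V.span (\<Union>i. B i)"
  proof
    have "component M i \<subseteq> V.span (\<Union>i. B i)" for i
      using V.span_mono[of "B i" "\<Union>i. B i"] B(4) by blast
    then have "V.span (\<Union>i. component M i) \<subseteq> V.span (\<Union>i. B i)"
      by (intro V.span_minimal V.subspace_span) blast
    then show "carrier M \<subseteq> V.span (\<Union>i. B i)"
      using ds unfolding internal_direct_sum_def by simp
    show "V.span (\<Union>i. B i) \<subseteq> carrier M"
      using B(1) comp by (intro V.span_minimal sub) blast
  qed
  obtain E where E: "E \<subseteq> (\<Union>i. B i)" "V.independent E" "(\<Union>i. B i) \<subseteq> V.span E"
    using V.maximal_independent_subset by blast
  have finE: "finite E" by (rule finite_subset[OF E(1) fin])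
  have span2: "carrier M = V.span E"
    unfolding span1
    by (intro subset_antisym V.span_mono E(1) V.span_minimal E(3) V.subspace_span)
  obtain h :: "'v \<Rightarrow> nat" where h: "inj_on h E"
    using finE finite_imp_inj_to_nat_seg by blast
  obtain f where f: "Vector_Spaces.linear sV coord_scale f" and fE: "\<forall>b\<in>E. f b = (\<lambda>i. if i = h b then 1 else 0)"
    using VC.linear_independent_extend[OF E(2), of "\<lambda>b i. if i = h b then 1 else 0"] by blast
  have injE: "inj_on f E"
  proof (rule inj_onI)
    fix b b' assume b: "b \<in> E" "b' \<in> E" "f b = f b'"
    have "(if h b = h b then 1 else 0 :: 'k) = (if h b = h b' then 1 else 0)"
      using b fE by metis
    with b h show "b = b'" by (auto split: if_splits dest: inj_onD)
  qed
  have "C.independent (f ` E)"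
    by (rule C.independent_mono[OF independent_unit_vectors]) (use fE in auto)
  then have inj: "inj_on f (carrier M)"
    unfolding span2 using VC.linear_inj_on_span_iff_independent_image[OF f] injE by blast

  define g where "g = inv_into (carrier M) f"
  have gf [simp]: "g (f u) = u" if "u \<in> carrier M" for u
    unfolding g_def using inj that by simp
  define N :: "('a, nat \<Rightarrow> 'k) graded_module" where
    "N = \<lparr>carrier = f ` carrier M, act = (\<lambda>x w. f (act M x (g w))),
          component = (\<lambda>i. f ` component M i)\<rparr>"
  have N [simp]: "carrier N = f ` carrier M" "act N x w = f (act M x (g w))"
      "component N i = f ` component M i" for x w i
    by (simp_all add: N_def)
  have fadd: "f (u + v) = f u + f v" for u v using VC.linear_add[OF f] .
  have fsc: "f (sV k u) = coord_scale k (f u)" for k u using VC.linear_scale[OF f] .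
  have f0: "f 0 = 0" using VC.linear_0[OF f] .
  have clA: "act M x u \<in> carrier M" if "u \<in> carrier M" for x u
    using gm that unfolding is_graded_module_def by blast
  have clP: "u + v \<in> carrier M" if "u \<in> carrier M" "v \<in> carrier M" for u v
    using V.subspace_add[OF sub] that .

  have dsN: "internal_direct_sum coord_scale (carrier N) (component N)"
    unfolding internal_direct_sum_def
  proof (intro conjI allI impI ballI)
    show "C.subspace (component N i)" for i
      using ds VC.linear_subspace_image[OF f] unfolding internal_direct_sum_def by simp
    have "f ` carrier M = f ` V.span (\<Union>i. component M i)"
      using ds unfolding internal_direct_sum_def by simp
    also have "\<dots> = C.span (\<Union>i. component N i)"
      by (simp add: VC.linear_span_image[OF f, symmetric] image_UN)
    finally show "carrier N = C.span (\<Union>i. component N i)" by simp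
    fix I w i
    assume A: "finite I \<and> (\<forall>i\<in>I. w i \<in> component N i) \<and> sum w I = 0" and i: "i \<in> I"
    have gw: "g (w j) \<in> component M j" "f (g (w j)) = w j" if j: "j \<in> I" for j
    proof -
      obtain u where u: "u \<in> component M j" "w j = f u" using A j by auto
      then have "g (w j) = u" using comp by (auto simp: subset_iff)
      with u show "g (w j) \<in> component M j" "f (g (w j)) = w j" by auto
    qed
    have "f (\<Sum>j\<in>I. g (w j)) = (\<Sum>j\<in>I. f (g (w j)))"
      using VC.linear_sum[OF f] .
    also have "\<dots> = f 0" using A gw(2) f0 by simp
    finally have "f (\<Sum>j\<in>I. g (w j)) = f 0" .
    moreover have "(\<Sum>j\<in>I. g (w j)) \<in> carrier M"
      using gw(1) comp by (intro V.subspace_sum[OF sub]) auto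
    ultimately have "(\<Sum>j\<in>I. g (w j)) = 0"
      using inj V.subspace_0[OF sub] by (auto dest: inj_onD)
    then have "g (w i) = 0"
      using A gw(1) i ds[unfolded internal_direct_sum_def, THEN conjunct2, THEN conjunct2,
        rule_format, of I "\<lambda>j. g (w j)" i] by simp
    then show "w i = 0" using gw(2)[OF i] f0 by metis
  qed
  have gmN: "is_graded_module sA A coord_scale N"
    unfolding is_graded_module_def
  proof (intro conjI)
    show "C.subspace (carrier N)"
      using VC.linear_subspace_image[OF f sub] by simp
    show "\<forall>i j. \<forall>x\<in>A i. \<forall>u\<in>component N j. act N x u \<in> component N (i + j)"
    proof (intro allI ballI)
      fix i j x w assume x: "x \<in> A i" and "w \<in> component N j"
      then obtain u where u: "u \<in> component M j" "w = f u" by auto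
      then have "g w = u" using comp by (auto simp: subset_iff)
      moreover have "act M x u \<in> component M (i + j)"
        using gm x u unfolding is_graded_module_def by blast
      ultimately show "act N x w \<in> component N (i + j)" by simp
    qed
    show "internal_direct_sum coord_scale (carrier N) (component N)" by (rule dsN)
    have u: "\<forall>u\<in>carrier M. act M 1 u = u"
      and a: "\<forall>x. \<forall>u\<in>carrier M. \<forall>v\<in>carrier M. act M x (u + v) = act M x u + act M x v"
      and b: "\<forall>x y. \<forall>u\<in>carrier M. act M (x + y) u = act M x u + act M y u"
      and m: "\<forall>x y. \<forall>u\<in>carrier M. act M (x * y) u = act M x (act M y u)"
      and k: "\<forall>k x. \<forall>u\<in>carrier M. act M (sA k x) u = sV k (act M x u)"
      using gm unfolding is_graded_module_def by blast+
    show "\<forall>x. \<forall>u\<in>carrier N. act N x u \<in> carrier N"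
      by (simp add: clA)
    show "\<forall>x. \<forall>u\<in>carrier N. \<forall>v\<in>carrier N. act N x (u + v) = act N x u + act N x v"
      by (simp add: clP a flip: fadd)
    show "\<forall>x y. \<forall>u\<in>carrier N. act N (x + y) u = act N x u + act N y u"
      by (simp add: b fadd)
    show "\<forall>x y. \<forall>u\<in>carrier N. act N (x * y) u = act N x (act N y u)"
      by (simp add: m clA)
    show "\<forall>u\<in>carrier N. act N 1 u = u"
      by (simp add: u)
    show "\<forall>k x. \<forall>u\<in>carrier N. act N (sA k x) u = coord_scale k (act N x u)"
      by (simp add: k fsc)
  qed
  have "generated_in_degree_zero coord_scale N"
  proof -
    have "{act N x w |x w. w \<in> component N 0} = f ` {act M x u |x u. u \<in> component M 0}"
    proof (intro subset_antisym subsetI)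
      fix y assume "y \<in> {act N x w |x w. w \<in> component N 0}"
      then obtain x u where "y = act N x (f u)" and u: "u \<in> component M 0" by auto
      moreover from u have "g (f u) = u" using comp by (intro gf) blast
      ultimately have "y = f (act M x u)" by simp
      with u show "y \<in> f ` {act M x u |x u. u \<in> component M 0}" by blast
    next
      fix y assume "y \<in> f ` {act M x u |x u. u \<in> component M 0}"
      then obtain x u where y: "y = f (act M x u)" and u: "u \<in> component M 0" by blast
      from u have "g (f u) = u" using comp by (intro gf) blast
      with y have "y = act N x (f u)" by simp
      moreover have "f u \<in> component N 0" using u by simp
      ultimately show "y \<in> {act N x w |x w. w \<in> component N 0}" by blast
    qed
    then show ?thesis
      using gen VC.linear_span_image[OF f] unfolding generated_in_degree_zero_def by simp
  qed
  moreover have "has_dimension coord_scale (component N i) (if i \<le> d then c else 0)" for i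
    unfolding has_dimension_def
  proof (intro exI[of _ "f ` B i"] conjI)
    have injB: "inj_on f (V.span (B i))"
      using inj comp B(4) inj_on_subset by metis
    then show "C.independent (f ` B i)"
      using VC.linear_independent_injective_image[OF f] B(3) by blast
    show "C.span (f ` B i) = component N i"
      using VC.linear_span_image[OF f] B(4) by simp
    show "card (f ` B i) = (if i \<le> d then c else 0)"
      using B(5)[of i] card_image[OF inj_on_subset[OF injB V.span_superset]] by simp
  qed (use B in auto)
  ultimately have "truncated_thick_point_module sA A coord_scale c d N"
    using gmN unfolding truncated_thick_point_module_def by blast
  moreover have "graded_isomorphic M N"
    unfolding graded_isomorphic_def
    by (rule exI[of _ f]) (use inj in \<open>auto simp: bij_betw_def fadd\<close>)
  ultimately show thesis by (rule that)
qed


section \<open>The Fomin--Kirillov algebra is connected graded and generated in degree one\<close>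

lift_definition degree_part :: "nat \<Rightarrow> ('x, 'k::field) free_algebra \<Rightarrow> ('x, 'k) free_algebra"
  is "\<lambda>n p w. if word_length w = n then p w else 0"
  by (erule finite_subset[rotated]) auto

lemma lookup_degree_part:
  "Poly_Mapping.lookup (degree_part n p) w = (if word_length w = n then Poly_Mapping.lookup p w else 0)"
  by transfer simp

lemma degree_part_add: "degree_part n (p + q) = degree_part n p + degree_part n q"
  by (rule poly_mapping_eqI) (simp add: lookup_degree_part lookup_add)

lemma degree_part_0 [simp]: "degree_part n 0 = 0"
  by (rule poly_mapping_eqI) (simp add: lookup_degree_part)

lemma degree_part_sum: "degree_part n (sum f I) = (\<Sum>i\<in>I. degree_part n (f i))"
  by (induction I rule: infinite_finite_induct) (auto simp: degree_part_add)

lemma degree_part_homogeneous: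
  "p \<in> free_degree m \<Longrightarrow> degree_part n p = (if n = m then p else 0)"
  by (rule poly_mapping_eqI) (auto simp: lookup_degree_part free_degree_def in_keys_iff)

lemma sum_singles:
  "p = (\<Sum>w\<in>Poly_Mapping.keys p. Poly_Mapping.single w (Poly_Mapping.lookup p w))"
  by (rule poly_mapping_eqI)
    (auto simp: lookup_sum lookup_single when_def in_keys_iff sum.delta)

lemma free_algebra_induct [case_names zero add single]:
  fixes p :: "('x, 'k::field) free_algebra"
  assumes "P 0" "\<And>p q. P p \<Longrightarrow> P q \<Longrightarrow> P (p + q)" "\<And>w k. P (Poly_Mapping.single w k)"
  shows "P p"
proof -
  have "P (\<Sum>w\<in>S. Poly_Mapping.single w (Poly_Mapping.lookup p w))" if "finite S" for S
    using that by induction (simp_all add: assms)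
  from this[OF finite_keys[of p]] show ?thesis
    unfolding sum_singles[symmetric] .
qed

lemma single_homogeneous: "Poly_Mapping.single w k \<in> free_degree (word_length w)"
  by (simp add: free_degree_def)

lemma free_degree_mult:
  assumes "p \<in> free_degree m" "q \<in> free_degree n"
  shows "p * q \<in> free_degree (m + n)"
  using assms keys_mult[of p q] unfolding free_degree_def by fastforce

lemma degree_part_single_mult:
  "degree_part n (Poly_Mapping.single w k * q) =
     (if word_length w \<le> n then Poly_Mapping.single w k * degree_part (n - word_length w) q else 0)"
proof (induction q rule: free_algebra_induct)
  case (single v l)
  show ?case
    by (auto simp: mult_single degree_part_homogeneous[OF single_homogeneous])
qed (auto simp: distrib_left degree_part_add)

lemma degree_part_mult_single:
  "degree_part n (q * Poly_Mapping.single w k) =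
     (if word_length w \<le> n then degree_part (n - word_length w) q * Poly_Mapping.single w k else 0)"
proof (induction q rule: free_algebra_induct)
  case (single v l)
  show ?case
    by (auto simp: mult_single degree_part_homogeneous[OF single_homogeneous])
qed (auto simp: distrib_right degree_part_add)

lemma free_degree_zero: "0 \<in> free_degree n"
  by (simp add: free_degree_def)

lemma free_degree_add: "p \<in> free_degree n \<Longrightarrow> q \<in> free_degree n \<Longrightarrow> p + q \<in> free_degree n"
  using keys_add[of p q] by (auto simp: free_degree_def)

lemma free_degree_diff: "p \<in> free_degree n \<Longrightarrow> q \<in> free_degree n \<Longrightarrow> p - q \<in> free_degree n"
  using keys_diff[of p q] by (auto simp: free_degree_def)

lemma free_degree_scale: "p \<in> free_degree n \<Longrightarrow> free_scale k p \<in> free_degree n"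
  using free_degree_mult[OF single_homogeneous[of 0 k], of p n] by (simp add: free_scale_def)

lemma letter_homogeneous: "letter x \<in> free_degree 1"
  using single_homogeneous[of "Word [x]" 1] by (simp add: letter_def word_length_def)

lemma fk3_relations_homogeneous:
  assumes "p \<in> fk3_relations"
  shows "p \<in> free_degree 2"
proof -
  have l: "letter x * letter y \<in> free_degree 2" for x y :: fk_gen
    using free_degree_mult[OF letter_homogeneous letter_homogeneous] by (simp only: one_add_one)
  show ?thesis
    using assms unfolding fk3_relations_def Let_def
    by (auto intro!: l free_degree_add free_degree_diff)
qed

lemma degree_part_fk3_ideal:
  fixes p :: "(fk_gen, 'k::field) free_algebra"
  assumes "p \<in> fk3_ideal"
  shows "degree_part n p \<in> fk3_ideal"
proof -
  have I: "(0 :: (fk_gen, 'k) free_algebra) \<in> fk3_ideal"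
    "\<And>x y :: (fk_gen, 'k) free_algebra. x \<in> fk3_ideal \<Longrightarrow> y \<in> fk3_ideal \<Longrightarrow> x + y \<in> fk3_ideal"
    "\<And>r x :: (fk_gen, 'k) free_algebra. x \<in> fk3_ideal \<Longrightarrow> r * x \<in> fk3_ideal"
    "\<And>r x :: (fk_gen, 'k) free_algebra. x \<in> fk3_ideal \<Longrightarrow> x * r \<in> fk3_ideal"
    using two_sided_ideal_fk3[where 'a = 'k] unfolding two_sided_ideal_def by auto
  define J :: "(fk_gen, 'k) free_algebra set" where "J = {p. \<forall>n. degree_part n p \<in> fk3_ideal}"
  have J0: "0 \<in> J" by (simp add: J_def I)
  have Jadd: "x + y \<in> J" if "x \<in> J" "y \<in> J" for x y
    using that by (simp add: J_def degree_part_add I)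
  have "fk3_ideal \<subseteq> J"
    unfolding fk3_ideal_def
  proof (rule hull_minimal)
    show "fk3_relations \<subseteq> J"
    proof
      fix p :: "(fk_gen, 'k) free_algebra" assume p: "p \<in> fk3_relations"
      then have "p \<in> fk3_ideal" unfolding fk3_ideal_def by (rule hull_inc)
      then show "p \<in> J"
        by (simp add: J_def I degree_part_homogeneous[OF fk3_relations_homogeneous[OF p]])
    qed
    show "two_sided_ideal J"
      unfolding two_sided_ideal_def
    proof (intro conjI ballI allI)
      show "0 \<in> J" by (rule J0)
      show "x + y \<in> J" if "x \<in> J" "y \<in> J" for x y by (rule Jadd[OF that])
      show "r * x \<in> J" if "x \<in> J" for r x
      proof (induction r rule: free_algebra_induct)
        case (single w k)
        show ?case using that by (simp add: J_def degree_part_single_mult I)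
      qed (simp_all add: J0 Jadd distrib_right)
      show "x * r \<in> J" if "x \<in> J" for r x
      proof (induction r rule: free_algebra_induct)
        case (single w k)
        show ?case using that by (simp add: J_def degree_part_mult_single I)
      qed (simp_all add: J0 Jadd distrib_left)
    qed
  qed
  with assms show ?thesis by (auto simp: J_def)
qed

lemma single_0_commute:
  "Poly_Mapping.single 0 k * p = p * Poly_Mapping.single (0 :: 'x free_monoid) (k :: 'k::field)"
  by (induction p rule: free_algebra_induct)
    (simp_all add: distrib_left distrib_right mult_single mult.commute)

lemma abs_fk3_eq_iff: "abs_fk3 p = abs_fk3 q \<longleftrightarrow> p - q \<in> fk3_ideal"
  by (simp add: fk3.abs_eq_iff fk3_rel_def)

lemma vector_space_fk3_scale: "vector_space fk3_scale"
proof
  note refl = equivp_reflp[OF fk3_rel_equivp]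
  fix k l :: 'a and x y :: "'a fk3"
  show "fk3_scale k (x + y) = fk3_scale k x + fk3_scale k y"
    by transfer (simp add: free_scale_def distrib_left refl)
  show "fk3_scale (k + l) x = fk3_scale k x + fk3_scale l x"
    by transfer (simp add: free_scale_def distrib_right single_add refl)
  show "fk3_scale k (fk3_scale l x) = fk3_scale (k * l) x"
    by transfer (simp add: free_scale_def mult.assoc[symmetric] mult_single refl)
  show "fk3_scale 1 x = x"
    by transfer (simp add: free_scale_def single_one refl)
qed

lemma fk3_scale_mult:
  fixes x y :: "'k::field fk3"
  shows "fk3_scale k (x * y) = fk3_scale k x * y" "fk3_scale k (x * y) = x * fk3_scale k y"
proof -
  note refl = equivp_reflp[OF fk3_rel_equivp]
  show "fk3_scale k (x * y) = fk3_scale k x * y"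
    by transfer (simp add: free_scale_def mult.assoc refl)
  have "free_scale k (p * q) = p * free_scale k q" for p q :: "(fk_gen, 'k) free_algebra"
  proof -
    have "free_scale k (p * q) = (Poly_Mapping.single 0 k * p) * q"
      by (simp add: free_scale_def mult.assoc)
    also have "\<dots> = p * free_scale k q"
      unfolding single_0_commute[of k p] by (simp add: free_scale_def mult.assoc)
    finally show ?thesis .
  qed
  then show "fk3_scale k (x * y) = x * fk3_scale k y"
    by transfer (simp add: refl)
qed

lemma abs_fk3_sum: "abs_fk3 (sum f I) = (\<Sum>i\<in>I. abs_fk3 (f i))"
  by (induction I rule: infinite_finite_induct)
    (simp_all add: zero_fk3.abs_eq[symmetric] plus_fk3.abs_eq[symmetric])

lemma fk3_degree_mult:
  assumes "x \<in> fk3_degree i" "y \<in> fk3_degree j"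
  shows "x * y \<in> fk3_degree (i + j)"
proof -
  obtain p q where "p \<in> free_degree i" "x = abs_fk3 p" "q \<in> free_degree j" "y = abs_fk3 q"
    using assms unfolding fk3_degree_def by auto
  then show ?thesis
    unfolding fk3_degree_def by (auto simp: times_fk3.abs_eq intro!: imageI free_degree_mult)
qed

lemma fk3_subspace_degree: "module.subspace fk3_scale (fk3_degree n)"
proof -
  interpret vector_space fk3_scale by (rule vector_space_fk3_scale)
  show ?thesis
    unfolding subspace_def fk3_degree_def
    by (auto simp: zero_fk3.abs_eq plus_fk3.abs_eq fk3_scale.abs_eq
        intro!: imageI free_degree_zero free_degree_add free_degree_scale)
qed

lemma connected_graded_algebra_fk3:
  "connected_graded_algebra (fk3_scale :: 'k::field \<Rightarrow> 'k fk3 \<Rightarrow> 'k fk3) fk3_degree"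
proof -
  interpret vector_space "fk3_scale :: 'k \<Rightarrow> 'k fk3 \<Rightarrow> 'k fk3" by (rule vector_space_fk3_scale)
  have "abs_fk3 p \<in> span (\<Union>n. fk3_degree n)" for p :: "(fk_gen, 'k) free_algebra"
  proof (induction p rule: free_algebra_induct)
    case (single w k)
    have "abs_fk3 (Poly_Mapping.single w k) \<in> fk3_degree (word_length w)"
      unfolding fk3_degree_def by (rule imageI) (rule single_homogeneous)
    then show ?case by (intro span_base) auto
  qed (simp_all add: zero_fk3.abs_eq[symmetric] span_zero plus_fk3.abs_eq[symmetric] span_add)
  then have "x \<in> span (\<Union>n. fk3_degree n)" for x :: "'k fk3"
    by (induction x) simp
  then have "UNIV = span (\<Union>n. fk3_degree n :: 'k fk3 set)" by auto
  moreover have "f i = 0"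
    if I: "finite I" "\<forall>i\<in>I. f i \<in> fk3_degree i" "sum f I = 0" "i \<in> I"
    for I and f :: "nat \<Rightarrow> 'k fk3" and i
  proof -
    have "\<forall>j\<in>I. \<exists>p. p \<in> free_degree j \<and> f j = abs_fk3 p"
      using I(2) unfolding fk3_degree_def by auto
    then obtain F where F: "\<forall>j\<in>I. F j \<in> free_degree j \<and> f j = abs_fk3 (F j)"
      by (rule bchoice[THEN exE])
    have "abs_fk3 (sum F I) = (\<Sum>j\<in>I. f j)"
      unfolding abs_fk3_sum by (rule sum.cong) (use F in auto)
    then have "sum F I \<in> fk3_ideal"
      using I(3) abs_fk3_eq_iff[of "sum F I" 0] by (simp add: zero_fk3.abs_eq)
    then have "degree_part i (sum F I) \<in> fk3_ideal" by (rule degree_part_fk3_ideal)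
    also have "degree_part i (sum F I) = (\<Sum>j\<in>I. if i = j then F j else 0)"
      unfolding degree_part_sum
    proof (rule sum.cong[OF refl])
      fix j assume "j \<in> I"
      then have "F j \<in> free_degree j" using F by auto
      then show "degree_part i (F j) = (if i = j then F j else 0)"
        by (rule degree_part_homogeneous)
    qed
    also have "\<dots> = F i" using I by simp
    finally have "abs_fk3 (F i) = abs_fk3 0" by (simp add: abs_fk3_eq_iff)
    with F I(4) show ?thesis by (simp add: zero_fk3.abs_eq)
  qed
  ultimately have "internal_direct_sum fk3_scale UNIV (fk3_degree :: nat \<Rightarrow> 'k fk3 set)"
    unfolding internal_direct_sum_def by (intro conjI allI fk3_subspace_degree) auto
  moreover have "fk3_degree 0 = range (\<lambda>k::'k. fk3_scale k 1)"
  proof -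
    have "free_degree 0 = range (\<lambda>k::'k. Poly_Mapping.single (0 :: fk_gen free_monoid) k)"
    proof (intro subset_antisym subsetI)
      fix p :: "(fk_gen, 'k) free_algebra" assume "p \<in> free_degree 0"
      then have "p = Poly_Mapping.single 0 (Poly_Mapping.lookup p 0)"
        by (intro poly_mapping_eqI)
          (auto simp: free_degree_def lookup_single when_def in_keys_iff)
      then show "p \<in> range (\<lambda>k::'k. Poly_Mapping.single 0 k)" by (rule range_eqI)
    qed (use single_homogeneous[of 0] in auto)
    then show ?thesis
      unfolding fk3_degree_def one_fk3.abs_eq fk3_scale.abs_eq
      by (simp add: image_image free_scale_def)
  qed
  ultimately show ?thesis
    unfolding connected_graded_algebra_def
    by (simp add: vector_space_fk3_scale fk3_degree_mult fk3_scale_mult(1)[symmetric]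
        fk3_scale_mult(2)[symmetric])
qed

lemma generated_in_degree_one_fk3:
  "generated_in_degree_one (fk3_scale :: 'k::field \<Rightarrow> 'k fk3 \<Rightarrow> 'k fk3) fk3_degree"
  unfolding generated_in_degree_one_def
proof
  fix n
  interpret vector_space "fk3_scale :: 'k \<Rightarrow> 'k fk3 \<Rightarrow> 'k fk3" by (rule vector_space_fk3_scale)
  let ?S = "{x * y |x y :: 'k fk3. x \<in> fk3_degree 1 \<and> y \<in> fk3_degree n}"
  have single: "abs_fk3 (Poly_Mapping.single w k) \<in> span ?S"
    if "word_length w = Suc n" for w and k :: 'k
  proof -
    obtain x ws where w: "w = Word (x # ws)" "length ws = n"
    proof (cases w)
      case (Word us)
      with \<open>word_length w = Suc n\<close> have "length us = Suc n" by (simp add: word_length_def)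
      then obtain x ws where "us = x # ws" "length ws = n" by (auto simp: length_Suc_conv)
      with Word show thesis by (intro that) simp_all
    qed
    have "Poly_Mapping.single w k = letter x * Poly_Mapping.single (Word ws) k"
      by (simp add: w letter_def mult_single plus_free_monoid_def)
    then have "abs_fk3 (Poly_Mapping.single w k) =
        abs_fk3 (letter x) * abs_fk3 (Poly_Mapping.single (Word ws) k)"
      by (simp add: times_fk3.abs_eq)
    moreover have "abs_fk3 (letter x :: (fk_gen, 'k) free_algebra) \<in> fk3_degree 1"
      unfolding fk3_degree_def by (intro imageI letter_homogeneous)
    moreover have "abs_fk3 (Poly_Mapping.single (Word ws) k) \<in> fk3_degree n"
      using single_homogeneous[of "Word ws" k] w(2)
      unfolding fk3_degree_def by (intro imageI) (simp add: word_length_def)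
    ultimately show ?thesis by (intro span_base) blast
  qed
  have "fk3_degree (Suc n) \<subseteq> span ?S"
  proof
    fix x :: "'k fk3" assume "x \<in> fk3_degree (Suc n)"
    then obtain p where p: "p \<in> free_degree (Suc n)" "x = abs_fk3 p"
      unfolding fk3_degree_def by auto
    have "x = (\<Sum>w\<in>Poly_Mapping.keys p. abs_fk3 (Poly_Mapping.single w (Poly_Mapping.lookup p w)))"
      unfolding p(2) abs_fk3_sum[symmetric] sum_singles[symmetric] ..
    also have "\<dots> \<in> span ?S"
      using p(1) by (intro span_sum single) (auto simp: free_degree_def)
    finally show "x \<in> span ?S" .
  qed
  moreover have "span ?S \<subseteq> fk3_degree (Suc n)"
    using fk3_degree_mult[of _ 1 _ n] by (intro span_minimal fk3_subspace_degree) auto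
  ultimately show "fk3_degree (Suc n) = span ?S" by (rule subset_antisym)
qed

end

theory Submission
  imports Defs
begin

text \<open>
  Replacing \<open>b\<close> by \<open>-b\<close> makes the relations symmetric under cyclic permutation of the generators.
  For three consecutive two-dimensional layers, each generated by the previous one, rank
  considerations on the six \<open>2 \<times> 2\<close> matrices show that some nonzero vector \<open>y\<close> of the first layer is
  killed by all generators.  If \<open>x\<close> completes \<open>y\<close> to a basis, the second layer is spanned by
  \<open>a x, b x, c x\<close>, so there is exactly one linear relation \<open>\<lambda> a x + \<mu> b x + \<nu> c x = 0\<close> up to scalars,
  and the third layer is two-dimensional only for \<open>(\<lambda>, \<mu>, \<nu>)\<close> equal to \<open>(1, 0, 0)\<close>,
  \<open>(0, 1, 0)\<close> or \<open>(t, -t\<^sup>2, 1)\<close> with \<open>t\<^sup>4 = t\<close>.  This triple determines the module, which yields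
  \<open>3\<close> plus the number of cube roots of unity many classes.  In each case the second layer
  contains no nonzero vector killed by all generators, so a fourth layer cannot exist.
\<close>

section \<open>Pairs of triples of two-by-two matrices\<close>

text \<open>The hard point is the killed vector y, since nothing in the relations singles out a line
  in the first layer. An invertible generator on the first layer would have to vanish on the second
  one, and the two mixed relations would then contradict surjectivity; so the lower matrices are u
  a^T, v b^T and w c^T. A common kernel exists once a, b and c are parallel. The mixed relations are
  dependencies between a, b and c whose coefficients come from brackets of u, v, w and from the
  upper matrices, and surjectivity onto both layers keeps these coefficients from degenerating. The
  argument works for any three consecutive layers: a fourth layer would supply a killed vector in
  the second one, which the normal form excludes. The equation t^4 = t is c^2 x = 0: if c x = -t a x
  + r b x, then it reads r = t^2 and t = r^2. Its root 0 and the first two triples are the lines of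
  the three generators; the other roots are the cube roots of unity.\<close>

definition mult2 :: "(nat \<Rightarrow> nat \<Rightarrow> 'k::field) \<Rightarrow> (nat \<Rightarrow> nat \<Rightarrow> 'k) \<Rightarrow> nat \<Rightarrow> nat \<Rightarrow> 'k" where
  "mult2 A B i j = A i 0 * B 0 j + A i 1 * B 1 j"

definition nonzero2 :: "(nat \<Rightarrow> 'k::field) \<Rightarrow> bool" where
  "nonzero2 u \<longleftrightarrow> u 0 \<noteq> 0 \<or> u 1 \<noteq> 0"

text \<open>The determinant of the matrix with columns u and v; it vanishes exactly when u and v are
  linearly dependent (parallel).\<close>

definition bracket :: "(nat \<Rightarrow> 'k::field) \<Rightarrow> (nat \<Rightarrow> 'k) \<Rightarrow> 'k" where
  "bracket u v = u 0 * v 1 - u 1 * v 0"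

text \<open>The index 1 marks maps from the first layer to the second, the index 2 those from the
  second to the third; X, Y, Z stand for a, -b, c. Only entries with indices below 2 are meaningful,
  hence bounded quantifiers instead of equations between functions.\<close>

definition fk3_pair :: "(nat \<Rightarrow> nat \<Rightarrow> 'k::field) \<Rightarrow> (nat \<Rightarrow> nat \<Rightarrow> 'k) \<Rightarrow> (nat \<Rightarrow> nat \<Rightarrow> 'k) \<Rightarrow>
    (nat \<Rightarrow> nat \<Rightarrow> 'k) \<Rightarrow> (nat \<Rightarrow> nat \<Rightarrow> 'k) \<Rightarrow> (nat \<Rightarrow> nat \<Rightarrow> 'k) \<Rightarrow> bool" where
  "fk3_pair X1 Y1 Z1 X2 Y2 Z2 \<longleftrightarrow>
     (\<forall>i<2. \<forall>j<2. mult2 X2 X1 i j = 0 \<and> mult2 Y2 Y1 i j = 0 \<and> mult2 Z2 Z1 i j = 0 \<and>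
        mult2 X2 Y1 i j + mult2 Y2 Z1 i j + mult2 Z2 X1 i j = 0 \<and>
        mult2 Y2 X1 i j + mult2 X2 Z1 i j + mult2 Z2 Y1 i j = 0)"

text \<open>Surjectivity in dual form: no nonzero linear form (f, g) on the target vanishes on all
  three images. It is contradicted by exhibiting such a form.\<close>

definition jointly_onto :: "(nat \<Rightarrow> nat \<Rightarrow> 'k::field) \<Rightarrow> (nat \<Rightarrow> nat \<Rightarrow> 'k) \<Rightarrow> (nat \<Rightarrow> nat \<Rightarrow> 'k) \<Rightarrow> bool" where
  "jointly_onto X Y Z \<longleftrightarrow>
     (\<forall>f g. (\<forall>j<2. f * X 0 j + g * X 1 j = 0 \<and> f * Y 0 j + g * Y 1 j = 0 \<and>
        f * Z 0 j + g * Z 1 j = 0) \<longrightarrow> f = 0 \<and> g = 0)"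

definition common_kernel :: "(nat \<Rightarrow> nat \<Rightarrow> 'k::field) \<Rightarrow> (nat \<Rightarrow> nat \<Rightarrow> 'k) \<Rightarrow> (nat \<Rightarrow> nat \<Rightarrow> 'k) \<Rightarrow> bool" where
  "common_kernel X Y Z \<longleftrightarrow>
     (\<exists>v. nonzero2 v \<and> (\<forall>i<2. X i 0 * v 0 + X i 1 * v (1::nat) = 0 \<and>
        Y i 0 * v 0 + Y i 1 * v 1 = 0 \<and> Z i 0 * v 0 + Z i (1::nat) * v 1 = 0))"

lemma all_less_2: "(\<forall>i<2. P i) \<longleftrightarrow> P 0 \<and> P (1::nat)"
  by (auto simp: less_2_cases_iff)

lemma fk3_pair_rotate: "fk3_pair X1 Y1 Z1 X2 Y2 Z2 \<Longrightarrow> fk3_pair Y1 Z1 X1 Y2 Z2 X2"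
  unfolding fk3_pair_def by (simp add: add.commute add.left_commute)

lemma jointly_onto_rotate: "jointly_onto X Y Z \<Longrightarrow> jointly_onto Y Z X"
  unfolding jointly_onto_def by blast

lemma common_kernel_rotate: "common_kernel X Y Z \<Longrightarrow> common_kernel Y Z X"
  unfolding common_kernel_def by blast

lemma jointly_ontoD:
  assumes "jointly_onto X Y Z" "\<And>j. j < 2 \<Longrightarrow> f * X 0 j + g * X 1 j = 0"
    "\<And>j. j < 2 \<Longrightarrow> f * Y 0 j + g * Y 1 j = 0" "\<And>j. j < 2 \<Longrightarrow> f * Z 0 j + g * Z 1 j = 0"
  shows "f = 0 \<and> g = 0"
  using assms unfolding jointly_onto_def by blast

section \<open>Vanishing of determinants\<close>

lemma row_zero:
  fixes a b c d x y :: "'k::field"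
  assumes "a * d - b * c \<noteq> 0" "x * a + y * c = 0" "x * b + y * d = 0"
  shows "x = 0" "y = 0"
proof -
  have "x * (a * d - b * c) = (x * a + y * c) * d - (x * b + y * d) * c"
       "y * (a * d - b * c) = (x * b + y * d) * a - (x * a + y * c) * b"
    by (simp_all add: algebra_simps)
  then have "x * (a * d - b * c) = 0" "y * (a * d - b * c) = 0"
    unfolding assms(2,3) by simp_all
  then show "x = 0" "y = 0"
    using assms(1) unfolding mult_eq_0_iff by blast+
qed

lemma mult2_eq_0_imp_eq_0:
  assumes "A 0 0 * A 1 1 - A 0 1 * A 1 0 \<noteq> 0" "\<And>j. j < 2 \<Longrightarrow> mult2 B A i j = 0" "j < 2"
  shows "B i j = 0"
proof -
  have "B i 0 * A 0 0 + B i 1 * A 1 0 = 0" "B i 0 * A 0 1 + B i 1 * A 1 1 = 0"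
    using assms(2)[of 0] assms(2)[of 1] unfolding mult2_def by simp_all
  from row_zero[OF assms(1) this] show ?thesis
    using assms(3) by (auto simp: less_2_cases_iff)
qed

text \<open>Suppose \<open>X1\<close> is invertible. Then \<open>X2 X1 = 0\<close> gives
  \<open>X2 = 0\<close>, and by the first mixed relation every linear form that kills
  \<open>Y2\<close> also kills \<open>Z2\<close>. By surjectivity \<open>Y2\<close> is invertible,
  so \<open>Y1 = 0\<close>, and the second mixed relation becomes \<open>Y2 X1 = 0\<close>, forcing
  \<open>Y2 = 0\<close>.\<close>

lemma fk3_pair_det_eq_0:
  fixes X1 :: "nat \<Rightarrow> nat \<Rightarrow> 'k::field"
  assumes P: "fk3_pair X1 Y1 Z1 X2 Y2 Z2" and o: "jointly_onto X2 Y2 Z2"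
  shows "X1 0 0 * X1 1 1 - X1 0 1 * X1 1 0 = 0"
proof (rule ccontr)
  assume d: "X1 0 0 * X1 1 1 - X1 0 1 * X1 1 0 \<noteq> 0"
  have X2: "X2 i j = 0" if "i < 2" "j < 2" for i j
    using mult2_eq_0_imp_eq_0[OF d, of X2] P that unfolding fk3_pair_def by blast
  have r1: "mult2 Y2 Z1 i j + mult2 Z2 X1 i j = 0" "mult2 Y2 X1 i j + mult2 Z2 Y1 i j = 0"
      "mult2 Y2 Y1 i j = 0" if "i < 2" "j < 2" for i j
    using P that X2 unfolding fk3_pair_def by (auto simp: mult2_def[of X2])
  have inj: "f = 0 \<and> g = 0" if Y: "\<forall>j<2. f * Y2 0 j + g * Y2 1 j = 0" for f g
  proof -
    \<comment> \<open>The row (f, g) \<open>Z2\<close>, repeated for every i so that it can be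
      treated as a matrix.\<close>
    define C where "C = (\<lambda>(i::nat) j. f * Z2 0 j + g * Z2 1 j)"
    have "mult2 C X1 0 j = 0" if "j < 2" for j
    proof -
      have "f * (mult2 Y2 Z1 0 j + mult2 Z2 X1 0 j) + g * (mult2 Y2 Z1 1 j + mult2 Z2 X1 1 j) = 0"
        using r1(1)[of _ j] that by simp
      moreover have "f * (mult2 Y2 Z1 0 j + mult2 Z2 X1 0 j) + g * (mult2 Y2 Z1 1 j + mult2 Z2 X1 1 j) =
         mult2 C X1 0 j + (f * Y2 0 0 + g * Y2 1 0) * Z1 0 j + (f * Y2 0 1 + g * Y2 1 1) * Z1 1 j"
        by (simp add: C_def mult2_def algebra_simps)
      ultimately show ?thesis using Y by simp
    qed
    then have "C 0 j = 0" if "j < 2" for j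
      using mult2_eq_0_imp_eq_0[OF d, of C 0] that by blast
    then have "f * X2 0 j + g * X2 1 j = 0 \<and> f * Y2 0 j + g * Y2 1 j = 0 \<and> f * Z2 0 j + g * Z2 1 j = 0"
      if "j < 2" for j
      using that X2 Y by (simp add: C_def)
    then show ?thesis
      using o unfolding jointly_onto_def by blast
  qed
  have dY: "Y2 0 0 * Y2 1 1 - Y2 0 1 * Y2 1 0 \<noteq> 0"
  proof
    assume z: "Y2 0 0 * Y2 1 1 - Y2 0 1 * Y2 1 0 = 0"
    \<comment> \<open>For a singular \<open>Y2\<close> the linear forms (\<open>Y2 1 0\<close>,
      \<open>- Y2 0 0\<close>) and (\<open>Y2 1 1\<close>, \<open>- Y2 0 1\<close>) annihilate
      \<open>Y2\<close>, so \<open>inj\<close> makes both zero.\<close>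
    have e: "Y2 1 0 * Y2 0 0 + - Y2 0 0 * Y2 1 0 = 0" "Y2 1 1 * Y2 0 1 + - Y2 0 1 * Y2 1 1 = 0"
      by simp_all
    have e': "Y2 1 0 * Y2 0 1 + - Y2 0 0 * Y2 1 1 = 0" "Y2 1 1 * Y2 0 0 + - Y2 0 1 * Y2 1 0 = 0"
      using z by algebra+
    have "Y2 1 0 = 0 \<and> - Y2 0 0 = 0" "Y2 1 1 = 0 \<and> - Y2 0 1 = 0"
      using inj[unfolded all_less_2, OF conjI, OF e(1) e'(1)] inj[unfolded all_less_2, OF conjI, OF e'(2) e(2)]
      by blast+
    then have "Y2 1 0 = 0" "Y2 0 0 = 0" "Y2 1 1 = 0" "Y2 0 1 = 0" by simp_all
    with inj[of 1 0] show False by (simp add: all_less_2)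
  qed
  have Y1: "Y1 k j = 0" if "k < 2" "j < 2" for k j
  proof -
    have dY': "Y2 0 0 * Y2 1 1 - Y2 1 0 * Y2 0 1 \<noteq> 0"
      using dY by (simp add: mult.commute)
    have "Y1 0 j * Y2 0 0 + Y1 1 j * Y2 0 1 = 0" "Y1 0 j * Y2 1 0 + Y1 1 j * Y2 1 1 = 0"
      using r1(3)[of 0 j] r1(3)[of 1 j] that by (simp_all add: mult2_def mult.commute)
    from row_zero[OF dY' this] show ?thesis
      using that by (auto simp: less_2_cases_iff)
  qed
  have "mult2 Y2 X1 i j = 0" if "i < 2" "j < 2" for i j
    using r1(2)[of i j] that Y1 by (simp add: mult2_def)
  then have "Y2 i j = 0" if "i < 2" "j < 2" for i j
    using mult2_eq_0_imp_eq_0[OF d, of Y2] that by blast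
  with dY show False by simp
qed

text \<open>The column factor u is kept nonzero even for the zero matrix, so that a = 0 records the
  vanishing of A.\<close>

lemma rank_one:
  fixes A :: "nat \<Rightarrow> nat \<Rightarrow> 'k::field"
  assumes "A 0 0 * A 1 1 - A 0 1 * A 1 0 = 0"
  obtains u a where "nonzero2 u" "\<And>i j. i < 2 \<Longrightarrow> j < 2 \<Longrightarrow> A i j = u i * a j"
proof -
  consider "A 0 0 \<noteq> 0" | "A 0 0 = 0" "A 1 0 \<noteq> 0" | "A 0 0 = 0" "A 1 0 = 0"
    by blast
  then show thesis
  proof cases
    case 1
    have "A 1 1 = A 1 0 / A 0 0 * A 0 1"
    proof -
      have "A 0 0 * (A 1 1 - A 1 0 / A 0 0 * A 0 1) = A 0 0 * A 1 1 - A 0 1 * A 1 0"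
        using 1 by (simp add: right_diff_distrib)
      with assms 1 show ?thesis by simp
    qed
    with 1 show ?thesis
      by (intro that[of "\<lambda>i. A i 0 / A 0 0" "\<lambda>j. A 0 j"])
        (auto simp: nonzero2_def less_2_cases_iff)
  next
    case 2
    then have "A 0 1 = 0" using assms by simp
    with 2 show ?thesis
      by (intro that[of "\<lambda>i. A i 0 / A 1 0" "\<lambda>j. A 1 j"])
        (auto simp: nonzero2_def less_2_cases_iff)
  next
    case 3
    show ?thesis
    proof (cases "A 0 1 = 0 \<and> A 1 1 = 0")
      case True
      show ?thesis
        by (rule that[of "\<lambda>i. 1" "\<lambda>j. 0"]) (use True 3 in \<open>auto simp: nonzero2_def less_2_cases_iff\<close>)
    next
      case False
      \<comment> \<open>The first column is zero, so the row factor is (0, 1), written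
        \<open>of_nat j\<close>.\<close>
      show ?thesis
        by (rule that[of "\<lambda>i. A i 1" "\<lambda>j. of_nat j"])
          (use False 3 in \<open>auto simp: nonzero2_def less_2_cases_iff\<close>)
    qed
  qed
qed

section \<open>Parallel and orthogonal vectors in the plane\<close>

lemma orthogonal_eq_multiple:
  fixes u r :: "nat \<Rightarrow> 'k::field"
  assumes "nonzero2 u" "r 0 * u 0 + r 1 * u 1 = 0"
  obtains k where "r 0 = - k * u 1" "r 1 = k * u 0"
proof (cases "u 0 = 0")
  case True
  then show ?thesis using assms that[of "- r 0 / u 1"] by (auto simp: nonzero2_def)
next
  case False
  have "r 0 = - (r 1 * u 1) / u 0"
    using assms(2) False by (simp add: field_simps eq_neg_iff_add_eq_0)
  then show ?thesis using False that[of "r 1 / u 0"] by simp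
qed

lemma bracket_self [simp]: "bracket u u = 0"
  by (simp add: bracket_def)

text \<open>The identity v [u, w] = u [v, w] + w [u, v] holds in each coordinate; a nonzero
  coordinate of v is then cancelled.\<close>

lemma bracket_eq_0_trans:
  assumes "nonzero2 v" "bracket u v = 0" "bracket v w = 0"
  shows "bracket u w = 0"
proof -
  have "v i * bracket u w = u i * bracket v w + w i * bracket u v" if "i < 2" for i
    using that by (auto simp: bracket_def less_2_cases_iff algebra_simps)
  from this[of 0] this[of 1] show ?thesis
    using assms by (auto simp: nonzero2_def)
qed

lemma bracket_commute_0: "bracket u v = 0 \<longleftrightarrow> bracket v u = 0"
  by (auto simp: bracket_def algebra_simps)

text \<open>The kernel of u a^T contains (-n 1, n 0) whenever n is parallel to a. Choose n as a
  nonzero vector among a, b, c, or arbitrarily if all of them vanish.\<close>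

lemma common_kernel_rank_oneI:
  assumes "\<And>i j. i < 2 \<Longrightarrow> j < 2 \<Longrightarrow> X i j = u i * a j"
    "\<And>i j. i < 2 \<Longrightarrow> j < 2 \<Longrightarrow> Y i j = v i * b j"
    "\<And>i j. i < 2 \<Longrightarrow> j < 2 \<Longrightarrow> Z i j = w i * c j"
    "bracket a b = 0" "bracket b c = 0" "bracket c a = 0"
  shows "common_kernel X Y Z"
proof -
  have kernel: "common_kernel X Y Z" if "nonzero2 n" "bracket a n = 0" "bracket b n = 0" "bracket c n = 0" for n
    unfolding common_kernel_def
  proof (intro exI[of _ "\<lambda>i. if i = 0 then - n 1 else n 0"] conjI allI impI)
    fix i :: nat assume i: "i < 2"
    have "u i * bracket a n = 0" "v i * bracket b n = 0" "w i * bracket c n = 0"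
      using that by simp_all
    then have "u i * a 0 * - n 1 + u i * a 1 * n 0 = 0" "v i * b 0 * - n 1 + v i * b 1 * n 0 = 0"
      "w i * c 0 * - n 1 + w i * c 1 * n 0 = 0"
      unfolding bracket_def by algebra+
    then show
      "X i 0 * (if (0::nat) = 0 then - n 1 else n 0) + X i 1 * (if (1::nat) = 0 then - n 1 else n 0) = 0"
      "Y i 0 * (if (0::nat) = 0 then - n 1 else n 0) + Y i 1 * (if (1::nat) = 0 then - n 1 else n 0) = 0"
      "Z i 0 * (if (0::nat) = 0 then - n 1 else n 0) + Z i 1 * (if (1::nat) = 0 then - n 1 else n 0) = 0"
      using i by (simp_all add: assms(1-3))
  qed (use that in \<open>auto simp: nonzero2_def\<close>)
  consider "nonzero2 a" | "nonzero2 b" | "nonzero2 c" | "\<not> nonzero2 a" "\<not> nonzero2 b" "\<not> nonzero2 c"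
    by blast
  then show ?thesis
  proof cases
    case 4
    then show ?thesis
      by (intro kernel[of "\<lambda>_. 1"]) (auto simp: nonzero2_def bracket_def)
  qed (use kernel assms bracket_commute_0 bracket_self in blast)+
qed

text \<open>With \<open>X1 = 0\<close>, surjectivity makes v and w independent and b and c nonzero.
  If b and c were not parallel, the mixed relations would give X2 v = Y2 w = Z2 v = X2 w = 0 and the
  squares Y2 v = Z2 w = 0, so all upper matrices would vanish on the basis v, w.\<close>

lemma common_kernel_if_zero:
  fixes X1 :: "nat \<Rightarrow> nat \<Rightarrow> 'k::field"
  assumes P: "fk3_pair X1 Y1 Z1 X2 Y2 Z2"
    and o1: "jointly_onto X1 Y1 Z1" and o2: "jointly_onto X2 Y2 Z2"
    and X1: "\<And>i j. i < 2 \<Longrightarrow> j < 2 \<Longrightarrow> X1 i j = 0"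
  shows "common_kernel X1 Y1 Z1"
proof -
  obtain v b where v: "nonzero2 v" and Y1: "\<And>i j. i < 2 \<Longrightarrow> j < 2 \<Longrightarrow> Y1 i j = v i * b j"
    using rank_one[OF fk3_pair_det_eq_0[OF fk3_pair_rotate[OF P] jointly_onto_rotate[OF o2]]] by blast
  obtain w c where w: "nonzero2 w" and Z1: "\<And>i j. i < 2 \<Longrightarrow> j < 2 \<Longrightarrow> Z1 i j = w i * c j"
    using rank_one[OF fk3_pair_det_eq_0[OF fk3_pair_rotate[OF fk3_pair_rotate[OF P]]
        jointly_onto_rotate[OF jointly_onto_rotate[OF o2]]]] by blast
  have vw: "bracket v w \<noteq> 0"
  proof
    assume "bracket v w = 0"
    then have z: "v 0 * w 1 - v 1 * w 0 = 0" unfolding bracket_def .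
    have "- w 1 * (v 0 * d) + w 0 * (v 1 * d) = 0" for d
      using z by algebra
    then have "- w 1 = 0 \<and> w 0 = 0"
      by (intro jointly_ontoD[OF o1]) (simp_all add: X1 Y1 Z1)
    with w show False by (simp add: nonzero2_def)
  qed
  have nb: "nonzero2 b"
  proof (rule ccontr)
    assume "\<not> nonzero2 b"
    then have "b j = 0" if "j < 2" for j using that by (auto simp: nonzero2_def less_2_cases_iff)
    then have "- w 1 = 0 \<and> w 0 = 0"
      by (intro jointly_ontoD[OF o1]) (simp_all add: X1 Y1 Z1)
    with w show False by (simp add: nonzero2_def)
  qed
  have nc: "nonzero2 c"
  proof (rule ccontr)
    assume "\<not> nonzero2 c"
    then have "c j = 0" if "j < 2" for j using that by (auto simp: nonzero2_def less_2_cases_iff)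
    then have "- v 1 = 0 \<and> v 0 = 0"
      by (intro jointly_ontoD[OF o1]) (simp_all add: X1 Y1 Z1)
    with v show False by (simp add: nonzero2_def)
  qed
  have "bracket b c = 0"
  proof (rule ccontr)
    assume bc: "bracket b c \<noteq> 0"
    have zero: "X2 i k = 0 \<and> Y2 i k = 0 \<and> Z2 i k = 0" if i: "i < 2" and k: "k < 2" for i k
    proof -
      let ?xv = "X2 i 0 * v 0 + X2 i 1 * v 1" and ?xw = "X2 i 0 * w 0 + X2 i 1 * w 1"
      let ?yv = "Y2 i 0 * v 0 + Y2 i 1 * v 1" and ?yw = "Y2 i 0 * w 0 + Y2 i 1 * w 1"
      let ?zv = "Z2 i 0 * v 0 + Z2 i 1 * v 1" and ?zw = "Z2 i 0 * w 0 + Z2 i 1 * w 1"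
      have bc': "b 0 * c 1 - b 1 * c 0 \<noteq> 0" using bc by (simp add: bracket_def)
      have i01: "(0::nat) < 2" "(1::nat) < 2" by simp_all
      have e: "?yv * b j = 0" "?zw * c j = 0" "?xv * b j + ?yw * c j = 0" "?zv * b j + ?xw * c j = 0"
        if j: "j < 2" for j
      proof -
        have r: "mult2 X2 X1 i j = 0" "mult2 Y2 Y1 i j = 0" "mult2 Z2 Z1 i j = 0"
          "mult2 X2 Y1 i j + mult2 Y2 Z1 i j + mult2 Z2 X1 i j = 0"
          "mult2 Y2 X1 i j + mult2 X2 Z1 i j + mult2 Z2 Y1 i j = 0"
          using P i j unfolding fk3_pair_def by blast+
        show "?yv * b j = 0" "?zw * c j = 0" "?xv * b j + ?yw * c j = 0" "?zv * b j + ?xw * c j = 0"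
          using r[unfolded mult2_def] unfolding X1[OF i01(1) j] X1[OF i01(2) j] Y1[OF i01(1) j]
            Y1[OF i01(2) j] Z1[OF i01(1) j] Z1[OF i01(2) j] by algebra+
      qed
      have xy: "?xv = 0" "?yw = 0" "?zv = 0" "?xw = 0"
        by (fact row_zero[OF bc' e(3)[OF i01(1)] e(3)[OF i01(2)]] row_zero[OF bc' e(4)[OF i01(1)] e(4)[OF i01(2)]])+
      have yv: "?yv = 0" using e(1)[OF i01(1)] e(1)[OF i01(2)] nb unfolding nonzero2_def mult_eq_0_iff by blast
      have zw: "?zw = 0" using e(2)[OF i01(1)] e(2)[OF i01(2)] nc unfolding nonzero2_def mult_eq_0_iff by blast
      have vw': "v 0 * w 1 - w 0 * v 1 \<noteq> 0" using vw unfolding bracket_def by (simp only: mult.commute not_False_eq_True)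
      note rz = row_zero[OF vw']
      have "X2 i 0 = 0" "X2 i 1 = 0" "Y2 i 0 = 0" "Y2 i 1 = 0" "Z2 i 0 = 0" "Z2 i 1 = 0"
        using rz[OF xy(1) xy(4)] rz[OF yv xy(2)] rz[OF xy(3) zw] by simp_all
      with k show ?thesis by (auto simp: less_2_cases_iff)
    qed
    have "(1::'k) = 0 \<and> (1::'k) = 0"
      by (intro jointly_ontoD[OF o2]) (simp_all add: zero)
    then show False by simp
  qed
  then show ?thesis
    by (intro common_kernel_rank_oneI[where u = "\<lambda>_. 0" and a = "\<lambda>_. 0", OF _ Y1 Z1])
      (simp_all add: X1 bracket_def)
qed

text \<open>The brackets of the dependency with a, b and c are proportionalities between \<xi> x,
  \<eta> y and \<zeta> z with factors [a, b], [b, c] and [c, a]. Were one factor nonzero, the three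
  coefficient vectors would be pairwise parallel.\<close>

lemma parallel_if_dependency:
  fixes a b c \<xi> \<eta> \<zeta> :: "nat \<Rightarrow> 'k::field"
  assumes R: "\<And>i j. i < 2 \<Longrightarrow> j < 2 \<Longrightarrow> \<xi> i * x * b j + \<eta> i * y * c j + \<zeta> i * z * a j = 0"
    and nz: "x \<noteq> 0" "y \<noteq> 0" "z \<noteq> 0"
    and indep: "bracket \<xi> \<eta> \<noteq> 0 \<or> bracket \<eta> \<zeta> \<noteq> 0 \<or> bracket \<zeta> \<xi> \<noteq> 0"
  shows "bracket a b = 0" "bracket b c = 0" "bracket c a = 0"
proof -
  define P Q R where "P = bracket a b" and "Q = bracket b c" and "R = bracket c a"
  have E: "\<xi> i * x * P = \<eta> i * y * R" "\<eta> i * y * Q = \<zeta> i * z * P" "\<zeta> i * z * R = \<xi> i * x * Q"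
    if i: "i < 2" for i
  proof -
    have "\<xi> i * x * b 0 + \<eta> i * y * c 0 + \<zeta> i * z * a 0 = 0"
      "\<xi> i * x * b 1 + \<eta> i * y * c 1 + \<zeta> i * z * a 1 = 0"
      using R i by simp_all
    then show "\<xi> i * x * P = \<eta> i * y * R" "\<eta> i * y * Q = \<zeta> i * z * P" "\<zeta> i * z * R = \<xi> i * x * Q"
      unfolding P_def Q_def R_def bracket_def by algebra+
  qed
  have i01: "(0::nat) < 2" "(1::nat) < 2" by simp_all
  note E0 = E[OF i01(1)] and E1 = E[OF i01(2)]
  have zero: "bracket \<xi> \<eta> * x * y * t = 0" "bracket \<eta> \<zeta> * y * z * t = 0" "bracket \<zeta> \<xi> * z * x * t = 0"
    if "t \<in> {P, Q, R}" for t
  proof -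
    show "bracket \<xi> \<eta> * x * y * t = 0"
      using that E0 E1 unfolding bracket_def by (elim insertE emptyE; simp only:; algebra)
    show "bracket \<eta> \<zeta> * y * z * t = 0"
      using that E0 E1 unfolding bracket_def by (elim insertE emptyE; simp only:; algebra)
    show "bracket \<zeta> \<xi> * z * x * t = 0"
      using that E0 E1 unfolding bracket_def by (elim insertE emptyE; simp only:; algebra)
  qed
  have "t = 0" if "t \<in> {P, Q, R}" for t
    using zero[OF that] indep nz by auto
  then show "bracket a b = 0" "bracket b c = 0" "bracket c a = 0"
    by (simp_all add: P_def Q_def R_def)
qed

text \<open>Serves the case x = 0 of \<open>fk3_pair_common_kernel\<close>, where each mixed
  relation keeps two terms; y = 0 and z = 0 are cyclic renamings. If [c, a] or [b, c] were nonzero,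
  then \<zeta> and one of \<xi>, \<eta> would vanish, contradicting \<open>indep\<close>.\<close>

lemma parallel_if_two_dependencies:
  fixes a b c \<xi> \<eta> \<zeta> :: "nat \<Rightarrow> 'k::field"
  assumes R: "\<And>i j. i < 2 \<Longrightarrow> j < 2 \<Longrightarrow> \<eta> i * y * c j + \<zeta> i * z * a j = 0"
      "\<And>i j. i < 2 \<Longrightarrow> j < 2 \<Longrightarrow> \<xi> i * z * c j + \<zeta> i * y * b j = 0"
    and nz: "y \<noteq> 0" "z \<noteq> 0" "nonzero2 c"
    and indep: "bracket \<xi> \<eta> \<noteq> 0 \<or> bracket \<eta> \<zeta> \<noteq> 0 \<or> bracket \<zeta> \<xi> \<noteq> 0"
  shows "bracket a b = 0" "bracket b c = 0" "bracket c a = 0"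
proof -
  have E: "\<eta> i * bracket c a * y = 0" "\<zeta> i * bracket c a * z = 0"
      "\<xi> i * bracket b c * z = 0" "\<zeta> i * bracket b c * y = 0" if i: "i < 2" for i
  proof -
    have "\<eta> i * y * c 0 + \<zeta> i * z * a 0 = 0" "\<eta> i * y * c 1 + \<zeta> i * z * a 1 = 0"
      using R(1) i by simp_all
    then show "\<eta> i * bracket c a * y = 0" "\<zeta> i * bracket c a * z = 0"
      unfolding bracket_def by algebra+
    have "\<xi> i * z * c 0 + \<zeta> i * y * b 0 = 0" "\<xi> i * z * c 1 + \<zeta> i * y * b 1 = 0"
      using R(2) i by simp_all
    then show "\<xi> i * bracket b c * z = 0" "\<zeta> i * bracket b c * y = 0"
      unfolding bracket_def by algebra+
  qed
  show ca: "bracket c a = 0"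
  proof (rule ccontr)
    assume "bracket c a \<noteq> 0"
    then have "\<eta> i = 0 \<and> \<zeta> i = 0" if "i < 2" for i using E[OF that] nz by simp
    then show False using indep by (simp add: bracket_def)
  qed
  show bc: "bracket b c = 0"
  proof (rule ccontr)
    assume "bracket b c \<noteq> 0"
    then have "\<xi> i = 0 \<and> \<zeta> i = 0" if "i < 2" for i using E[OF that] nz by simp
    then show False using indep by (simp add: bracket_def)
  qed
  show "bracket a b = 0"
    using bracket_eq_0_trans[OF nz(3) bc ca] bracket_commute_0 by blast
qed

text \<open>A nonzero vector n among three parallel ones gives the linear form (-n 1, n 0) that
  kills them all. It serves to contradict \<open>jointly_onto\<close>.\<close>

lemma common_kernel_pairing:
  fixes \<xi> \<eta> \<zeta> :: "nat \<Rightarrow> 'k::field"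
  assumes "bracket \<xi> \<eta> = 0" "bracket \<eta> \<zeta> = 0" "bracket \<zeta> \<xi> = 0"
  obtains f g where "f \<noteq> 0 \<or> g \<noteq> 0" "f * \<xi> 0 + g * \<xi> 1 = 0" "f * \<eta> 0 + g * \<eta> 1 = 0" "f * \<zeta> 0 + g * \<zeta> 1 = 0"
proof -
  note witness = that
  have *: thesis if n: "nonzero2 n" "bracket n \<xi> = 0" "bracket n \<eta> = 0" "bracket n \<zeta> = 0" for n
  proof (rule witness[of "- n 1" "n 0"])
    show "- n 1 \<noteq> 0 \<or> n 0 \<noteq> 0" using n(1) by (auto simp: nonzero2_def)
    show "- n 1 * \<xi> 0 + n 0 * \<xi> 1 = 0" "- n 1 * \<eta> 0 + n 0 * \<eta> 1 = 0" "- n 1 * \<zeta> 0 + n 0 * \<zeta> 1 = 0"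
      using n(2-4) unfolding bracket_def by algebra+
  qed
  consider "nonzero2 \<xi>" | "nonzero2 \<eta>" | "nonzero2 \<zeta>" | "\<not> nonzero2 \<xi>" "\<not> nonzero2 \<eta>" "\<not> nonzero2 \<zeta>"
    by blast
  then show thesis
  proof cases
    case 4
    then show ?thesis by (intro *[of "\<lambda>_. 1"]) (auto simp: nonzero2_def bracket_def)
  qed (use * assms bracket_commute_0 bracket_self in blast)+
qed

text \<open>As a is nonzero, B u a^T = 0 means B u = 0: every row of B is orthogonal to u.\<close>

lemma orthogonal_rows:
  assumes "nonzero2 a" "nonzero2 u" "\<And>i j. i < 2 \<Longrightarrow> j < 2 \<Longrightarrow> A i j = u i * a j"
    "\<And>i j. i < 2 \<Longrightarrow> j < 2 \<Longrightarrow> mult2 B A i j = 0"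
  obtains k where "\<And>i. i < 2 \<Longrightarrow> B i 0 = - k i * u 1" "\<And>i. i < 2 \<Longrightarrow> B i 1 = k i * u 0"
proof -
  have "\<exists>k. i < 2 \<longrightarrow> B i 0 = - k * u 1 \<and> B i 1 = k * u 0" for i
  proof (cases "i < 2")
    case True
    have "(B i 0 * u 0 + B i 1 * u 1) * a j = 0" if "j < 2" for j
      using assms(4)[OF True that] that by (simp add: mult2_def assms(3) algebra_simps)
    from this[of 0] this[of 1] have "B i 0 * u 0 + B i 1 * u 1 = 0"
      using assms(1) by (auto simp: nonzero2_def)
    then show ?thesis using orthogonal_eq_multiple[OF assms(2), of "B i"] by blast
  qed simp
  then show thesis using that by metis
qed

text \<open>When no generator vanishes on the bottom layer, all six matrices have rank one; writing
  \<open>X\<^sub>1 = u a\<^sup>T\<close> and \<open>X\<^sub>2 = \<xi> u\<^sup>\<bottom>\<close>, and similarly for \<open>Y\<close> and \<open>Z\<close>, the two relations become linear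
  dependencies between \<open>a\<close>, \<open>b\<close> and \<open>c\<close>.\<close>

lemma fk3_pair_common_kernel:
  fixes X1 :: "nat \<Rightarrow> nat \<Rightarrow> 'k::field"
  assumes P: "fk3_pair X1 Y1 Z1 X2 Y2 Z2"
    and o1: "jointly_onto X1 Y1 Z1" and o2: "jointly_onto X2 Y2 Z2"
  shows "common_kernel X1 Y1 Z1"
proof -
  note P' = fk3_pair_rotate[OF P] and o1' = jointly_onto_rotate[OF o1] and o2' = jointly_onto_rotate[OF o2]
  note P'' = fk3_pair_rotate[OF P'] and o1'' = jointly_onto_rotate[OF o1'] and o2'' = jointly_onto_rotate[OF o2']
  obtain u a where u: "nonzero2 u" and X1: "\<And>i j. i < 2 \<Longrightarrow> j < 2 \<Longrightarrow> X1 i j = u i * a j"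
    using rank_one[OF fk3_pair_det_eq_0[OF P o2]] by blast
  obtain v b where v: "nonzero2 v" and Y1: "\<And>i j. i < 2 \<Longrightarrow> j < 2 \<Longrightarrow> Y1 i j = v i * b j"
    using rank_one[OF fk3_pair_det_eq_0[OF P' o2']] by blast
  obtain w c where w: "nonzero2 w" and Z1: "\<And>i j. i < 2 \<Longrightarrow> j < 2 \<Longrightarrow> Z1 i j = w i * c j"
    using rank_one[OF fk3_pair_det_eq_0[OF P'' o2'']] by blast
  have zero: "m j = 0" if "\<not> nonzero2 m" "j < 2" for m :: "nat \<Rightarrow> 'k" and j
    using that by (auto simp: nonzero2_def less_2_cases_iff)
  consider "\<not> nonzero2 a" | "\<not> nonzero2 b" | "\<not> nonzero2 c" | "nonzero2 a" "nonzero2 b" "nonzero2 c"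
    by blast
  then show ?thesis
  proof cases
    case 1
    then show ?thesis using common_kernel_if_zero[OF P o1 o2] X1 zero by simp
  next
    case 2
    then have "common_kernel Y1 Z1 X1" using common_kernel_if_zero[OF P' o1' o2'] Y1 zero by simp
    then show ?thesis by (rule common_kernel_rotate[OF common_kernel_rotate])
  next
    case 3
    then have "common_kernel Z1 X1 Y1" using common_kernel_if_zero[OF P'' o1'' o2''] Z1 zero by simp
    then show ?thesis by (rule common_kernel_rotate)
  next
    case 4
    have PD: "mult2 X2 X1 i j = 0" "mult2 Y2 Y1 i j = 0" "mult2 Z2 Z1 i j = 0"
      "mult2 X2 Y1 i j + mult2 Y2 Z1 i j + mult2 Z2 X1 i j = 0" "mult2 Y2 X1 i j + mult2 X2 Z1 i j + mult2 Z2 Y1 i j = 0"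
      if "i < 2" "j < 2" for i j
      using P that unfolding fk3_pair_def by blast+
    obtain \<xi> where \<xi>: "\<And>i. i < 2 \<Longrightarrow> X2 i 0 = - \<xi> i * u 1" "\<And>i. i < 2 \<Longrightarrow> X2 i 1 = \<xi> i * u 0"
      using orthogonal_rows[OF 4(1) u X1 PD(1)] by metis
    obtain \<eta> where \<eta>: "\<And>i. i < 2 \<Longrightarrow> Y2 i 0 = - \<eta> i * v 1" "\<And>i. i < 2 \<Longrightarrow> Y2 i 1 = \<eta> i * v 0"
      using orthogonal_rows[OF 4(2) v Y1 PD(2)] by metis
    obtain \<zeta> where \<zeta>: "\<And>i. i < 2 \<Longrightarrow> Z2 i 0 = - \<zeta> i * w 1" "\<And>i. i < 2 \<Longrightarrow> Z2 i 1 = \<zeta> i * w 0"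
      using orthogonal_rows[OF 4(3) w Z1 PD(3)] by metis
    \<comment> \<open>The row (- u 1, u 0) applied to v is [u, v], so \<open>X2 Y1\<close> becomes x
      \<xi> b^T, and likewise for the other mixed products; in the second relation all brackets
      change sign at once.\<close>
    define x y z where "x = bracket u v" and "y = bracket v w" and "z = bracket w u"
    have R: "\<xi> i * x * b j + \<eta> i * y * c j + \<zeta> i * z * a j = 0"
      "\<eta> i * x * a j + \<xi> i * z * c j + \<zeta> i * y * b j = 0" if ij: "i < 2" "j < 2" for i j
    proof -
      have i01: "(0::nat) < 2" "(1::nat) < 2" by simp_all
      note eqs = X1[OF i01(1) ij(2)] X1[OF i01(2) ij(2)] Y1[OF i01(1) ij(2)] Y1[OF i01(2) ij(2)]
        Z1[OF i01(1) ij(2)] Z1[OF i01(2) ij(2)] \<xi>[OF ij(1)] \<eta>[OF ij(1)] \<zeta>[OF ij(1)]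
      show "\<xi> i * x * b j + \<eta> i * y * c j + \<zeta> i * z * a j = 0"
        using PD(4)[OF ij] unfolding mult2_def eqs x_def y_def z_def bracket_def by algebra
      show "\<eta> i * x * a j + \<xi> i * z * c j + \<zeta> i * y * b j = 0"
        using PD(5)[OF ij] unfolding mult2_def eqs x_def y_def z_def bracket_def by algebra
    qed
    \<comment> \<open>If \<xi>, \<eta>, \<zeta> were all parallel, one linear form would kill
      \<open>X2\<close>, \<open>Y2\<close> and \<open>Z2\<close>.\<close>
    have indep: "bracket \<xi> \<eta> \<noteq> 0 \<or> bracket \<eta> \<zeta> \<noteq> 0 \<or> bracket \<zeta> \<xi> \<noteq> 0"
    proof (rule ccontr)
      assume "\<not> ?thesis"
      then obtain f g where fg: "f \<noteq> 0 \<or> g \<noteq> 0" and k: "f * \<xi> 0 + g * \<xi> 1 = 0"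
        "f * \<eta> 0 + g * \<eta> 1 = 0" "f * \<zeta> 0 + g * \<zeta> 1 = 0"
        using common_kernel_pairing[of \<xi> \<eta> \<zeta>] by blast
      have "f * X2 0 j + g * X2 1 j = 0" "f * Y2 0 j + g * Y2 1 j = 0" "f * Z2 0 j + g * Z2 1 j = 0"
        if "j < 2" for j
      proof -
        have *: "f * (l 0 * t) + g * (l 1 * t) = 0" if "f * l 0 + g * l 1 = 0" for l t
          using that by algebra
        have i01: "(0::nat) < 2" "(1::nat) < 2" by simp_all
        have "j = 0 \<or> j = 1" using \<open>j < 2\<close> by linarith
        then show "f * X2 0 j + g * X2 1 j = 0" "f * Y2 0 j + g * Y2 1 j = 0" "f * Z2 0 j + g * Z2 1 j = 0"
          by (elim disjE; simp only: \<xi>[OF i01(1)] \<xi>[OF i01(2)] \<eta>[OF i01(1)] \<eta>[OF i01(2)]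
              \<zeta>[OF i01(1)] \<zeta>[OF i01(2)] minus_mult_commute *[OF k(1)] *[OF k(2)] *[OF k(3)])+
      qed
      with fg show False using jointly_ontoD[OF o2] by blast
    qed
    have indep': "bracket \<eta> \<zeta> \<noteq> 0 \<or> bracket \<zeta> \<xi> \<noteq> 0 \<or> bracket \<xi> \<eta> \<noteq> 0"
      "bracket \<zeta> \<xi> \<noteq> 0 \<or> bracket \<xi> \<eta> \<noteq> 0 \<or> bracket \<eta> \<zeta> \<noteq> 0"
      using indep by blast+
    have not0: "\<not> (x = 0 \<and> y = 0 \<and> z = 0)"
    proof
      assume "x = 0 \<and> y = 0 \<and> z = 0"
      then obtain f g where fg: "f \<noteq> 0 \<or> g \<noteq> 0" and k: "f * u 0 + g * u 1 = 0"
        "f * v 0 + g * v 1 = 0" "f * w 0 + g * w 1 = 0"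
        using common_kernel_pairing[of u v w] unfolding x_def y_def z_def by blast
      have *: "f * (l 0 * t) + g * (l 1 * t) = 0" if "f * l 0 + g * l 1 = 0" for l t
        using that by algebra
      have "f = 0 \<and> g = 0"
        by (intro jointly_ontoD[OF o1]) (simp_all add: X1 Y1 Z1 * k del: One_nat_def)
      with fg show False by blast
    qed
    \<comment> \<open>As u, v, w are nonzero, two vanishing brackets force the third to vanish; so
      at most one of x, y, z is zero.\<close>
    have two: "y = 0 \<longleftrightarrow> z = 0" if "x = 0"
      using that bracket_eq_0_trans[OF v, of u w] bracket_eq_0_trans[OF u, of w v]
      unfolding x_def y_def z_def by (metis bracket_commute_0)
    have two': "z = 0 \<longleftrightarrow> x = 0" if "y = 0"
      using that bracket_eq_0_trans[OF w, of v u] bracket_eq_0_trans[OF v, of u w]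
      unfolding x_def y_def z_def by (metis bracket_commute_0)
    have two'': "x = 0 \<longleftrightarrow> y = 0" if "z = 0"
      using that bracket_eq_0_trans[OF u, of w v] bracket_eq_0_trans[OF w, of v u]
      unfolding x_def y_def z_def by (metis bracket_commute_0)
    consider "x \<noteq> 0" "y \<noteq> 0" "z \<noteq> 0" | "x = 0" "y \<noteq> 0" "z \<noteq> 0" | "y = 0" "z \<noteq> 0" "x \<noteq> 0"
      | "z = 0" "x \<noteq> 0" "y \<noteq> 0"
      using not0 two two' two'' by blast
    then have "bracket a b = 0 \<and> bracket b c = 0 \<and> bracket c a = 0"
    proof cases
      case 1
      show ?thesis using parallel_if_dependency[OF R(1) 1 indep] by simp
    next
      case 2
      have r: "\<eta> i * y * c j + \<zeta> i * z * a j = 0" "\<xi> i * z * c j + \<zeta> i * y * b j = 0"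
        if "i < 2" "j < 2" for i j
        using R(1)[OF that] R(2)[OF that] unfolding 2(1)
        by (simp_all only: mult_zero_left mult_zero_right add_0_left add_0_right add.commute)
      show ?thesis using parallel_if_two_dependencies[OF r 2(2,3) 4(3) indep] by simp
    next
      case 3
      have r: "\<zeta> i * z * a j + \<xi> i * x * b j = 0" "\<eta> i * x * a j + \<xi> i * z * c j = 0"
        if "i < 2" "j < 2" for i j
        using R(1)[OF that] R(2)[OF that] unfolding 3(1)
        by (simp_all only: mult_zero_left mult_zero_right add_0_left add_0_right add.commute)
      show ?thesis using parallel_if_two_dependencies[OF r 3(2,3) 4(1) indep'(1)] by simp
    next
      case nz: 4
      have r: "\<xi> i * x * b j + \<eta> i * y * c j = 0" "\<zeta> i * y * b j + \<eta> i * x * a j = 0"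
        if "i < 2" "j < 2" for i j
        using R(1)[OF that] R(2)[OF that] unfolding nz(1)
        by (simp_all only: mult_zero_left mult_zero_right add_0_left add_0_right add.commute)
      show ?thesis using parallel_if_two_dependencies[OF r nz(2,3) 4(2) indep'(2)] by simp
    qed
    then show ?thesis
      by (intro common_kernel_rank_oneI[OF X1 Y1 Z1]) auto
  qed
qed

section \<open>Actions of the free algebra and of the Fomin--Kirillov algebra\<close>

definition word_act :: "('x \<Rightarrow> 'v \<Rightarrow> 'v) \<Rightarrow> 'x free_monoid \<Rightarrow> 'v \<Rightarrow> 'v" where
  "word_act T w = foldr T (letters w)"

lemma word_act_0 [simp]: "word_act T 0 v = v"
  by (simp add: word_act_def zero_free_monoid_def)

lemma word_act_plus: "word_act T (u + w) v = word_act T u (word_act T w v)"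
  by (simp add: word_act_def plus_free_monoid_def)

lemma word_act_letter: "word_act T (Word [x]) v = T x v"
  by (simp add: word_act_def)

definition free_act :: "('k::field \<Rightarrow> 'v::ab_group_add \<Rightarrow> 'v) \<Rightarrow> ('x \<Rightarrow> 'v \<Rightarrow> 'v) \<Rightarrow>
    ('x, 'k) free_algebra \<Rightarrow> 'v \<Rightarrow> 'v" where
  "free_act s T p v =
     (\<Sum>w\<in>Poly_Mapping.keys p. s (Poly_Mapping.lookup p w) (word_act T w v))"

locale free_algebra_action = vector_space s
  for s :: "'k::field \<Rightarrow> 'v::ab_group_add \<Rightarrow> 'v" +
  fixes T :: "'x \<Rightarrow> 'v \<Rightarrow> 'v"
  assumes T_add: "T x (u + v) = T x u + T x v" and T_scale: "T x (s k v) = s k (T x v)"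
begin

lemma word_act_add: "word_act T w (u + v) = word_act T w u + word_act T w v"
proof -
  have "foldr T xs (u + v) = foldr T xs u + foldr T xs v" for xs
    by (induction xs) (simp_all add: T_add)
  then show ?thesis by (simp add: word_act_def)
qed

lemma word_act_scale: "word_act T w (s k v) = s k (word_act T w v)"
proof -
  have "foldr T xs (s k v) = s k (foldr T xs v)" for xs
    by (induction xs) (simp_all add: T_scale)
  then show ?thesis by (simp add: word_act_def)
qed

lemma free_act_superset:
  assumes "finite S" "Poly_Mapping.keys p \<subseteq> S"
  shows "free_act s T p v = (\<Sum>w\<in>S. s (Poly_Mapping.lookup p w) (word_act T w v))"
  unfolding free_act_def
  by (rule sum.mono_neutral_left) (use assms in \<open>auto simp: in_keys_iff\<close>)

lemma free_act_zero [simp]: "free_act s T 0 v = 0"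
  by (simp add: free_act_def)

lemma free_act_plus: "free_act s T (p + q) v = free_act s T p v + free_act s T q v"
proof -
  let ?S = "Poly_Mapping.keys p \<union> Poly_Mapping.keys q"
  have "free_act s T (p + q) v =
      (\<Sum>w\<in>?S. s (Poly_Mapping.lookup (p + q) w) (word_act T w v))"
    by (rule free_act_superset) (use keys_add[of p q] in auto)
  also have "\<dots> = free_act s T p v + free_act s T q v"
    by (simp add: lookup_add scale_left_distrib sum.distrib
        free_act_superset[of ?S p] free_act_superset[of ?S q])
  finally show ?thesis .
qed

lemma free_act_single: "free_act s T (Poly_Mapping.single w k) v = s k (word_act T w v)"
  by (subst free_act_superset[of "{w}"]) auto

lemma free_act_letter: "free_act s T (letter x) v = T x v"
  by (simp add: letter_def free_act_single word_act_letter)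

lemma free_act_uminus: "free_act s T (- p) v = - free_act s T p v"
  by (rule minus_unique[symmetric]) (simp flip: free_act_plus)

lemma free_act_minus: "free_act s T (p - q) v = free_act s T p v - free_act s T q v"
  using free_act_plus[of p "- q" v] by (simp add: free_act_uminus)

lemma free_act_one: "free_act s T 1 v = v"
  using free_act_single[of 0 1 v] by (simp add: single_one)

lemma free_act_add: "free_act s T p (u + v) = free_act s T p u + free_act s T p v"
  by (simp add: free_act_def word_act_add scale_right_distrib sum.distrib)

lemma free_act_scale: "free_act s T p (s k v) = s k (free_act s T p v)"
  by (simp add: free_act_def word_act_scale scale_sum_right mult.commute)

lemma free_act_zero_right [simp]: "free_act s T p 0 = 0"
  using free_act_scale[of p 0 0] by simp

lemma free_act_times: "free_act s T (p * q) v = free_act s T p (free_act s T q v)"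
proof (induction p rule: free_algebra_induct)
  case (single w k)
  show ?case
    by (induction q rule: free_algebra_induct)
      (simp_all add: distrib_left free_act_plus free_act_add mult_single free_act_single
        word_act_plus word_act_scale)
qed (simp_all add: distrib_right free_act_plus)

lemma free_act_free_scale: "free_act s T (free_scale k p) v = s k (free_act s T p v)"
  by (simp add: free_scale_def free_act_times free_act_single)

text \<open>The elements that act as zero form a two-sided ideal, so it is enough to test the
  relations.\<close>

lemma free_act_hull_eq_0:
  assumes "\<And>r v. r \<in> R \<Longrightarrow> free_act s T r v = 0" "p \<in> two_sided_ideal hull R"
  shows "free_act s T p v = 0"
proof -
  have "two_sided_ideal hull R \<subseteq> {p. \<forall>v. free_act s T p v = 0}"
    by (rule hull_minimal)
      (use assms(1) in \<open>auto simp: two_sided_ideal_def free_act_plus free_act_times\<close>)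
  with assms(2) show ?thesis by blast
qed

lemma free_act_in_subspace:
  assumes "subspace U" "\<And>x u. u \<in> U \<Longrightarrow> T x u \<in> U" "u \<in> U"
  shows "free_act s T p u \<in> U"
proof -
  have "foldr T xs u \<in> U" for xs
    by (induction xs) (use assms in auto)
  then show ?thesis
    unfolding free_act_def word_act_def
    by (intro subspace_sum[OF assms(1)] subspace_scale[OF assms(1)]) auto
qed

lemma free_act_degree:
  assumes "\<And>n. subspace (U n)" "\<And>x n u. u \<in> U n \<Longrightarrow> T x u \<in> U (Suc n)" "p \<in> free_degree i" "u \<in> U j"
  shows "free_act s T p u \<in> U (i + j)"
proof -
  have "foldr T xs u \<in> U (length xs + j)" for xs
    by (induction xs) (use assms in auto)
  then have "word_act T w u \<in> U (i + j)" if "w \<in> Poly_Mapping.keys p" for w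
    using assms(3) that unfolding word_act_def free_degree_def word_length_def by auto
  then show ?thesis
    unfolding free_act_def by (intro subspace_sum subspace_scale assms(1))
qed

end

locale fk3_action = free_algebra_action s T
  for s :: "'k::field \<Rightarrow> 'v::ab_group_add \<Rightarrow> 'v" and T :: "fk_gen \<Rightarrow> 'v \<Rightarrow> 'v" +
  assumes square: "T g (T g v) = 0"
    and rel1: "T Gen_c (T Gen_a v) = T Gen_a (T Gen_b v) + T Gen_b (T Gen_c v)"
    and rel2: "T Gen_c (T Gen_b v) = T Gen_a (T Gen_c v) - T Gen_b (T Gen_a v)"
begin

definition fk3_act :: "'k fk3 \<Rightarrow> 'v \<Rightarrow> 'v" where
  "fk3_act x = free_act s T (rep_fk3 x)"

text \<open>\<open>rep_fk3\<close> picks an arbitrary representative; any two differ by an element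
  of the ideal, which acts as zero.\<close>

lemma fk3_act_abs: "fk3_act (abs_fk3 p) v = free_act s T p v"
proof -
  have "abs_fk3 (rep_fk3 (abs_fk3 p)) = abs_fk3 p"
    by (simp add: Quotient3_abs_rep[OF Quotient3_fk3])
  then have "rep_fk3 (abs_fk3 p) - p \<in> fk3_ideal"
    by (simp add: abs_fk3_eq_iff)
  then have "free_act s T (rep_fk3 (abs_fk3 p) - p) v = 0"
    unfolding fk3_ideal_def
    by (rule free_act_hull_eq_0[rotated])
      (auto simp: fk3_relations_def Let_def free_act_minus free_act_plus free_act_times
        free_act_letter square rel1 rel2)
  then show ?thesis by (simp add: free_act_minus fk3_act_def)
qed

lemma fk3_act_add: "fk3_act x (u + v) = fk3_act x u + fk3_act x v"
  by (simp add: fk3_act_def free_act_add)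

lemma fk3_act_plus: "fk3_act (x + y) u = fk3_act x u + fk3_act y u"
  by (induction x, induction y) (simp add: plus_fk3.abs_eq fk3_act_abs free_act_plus)

lemma fk3_act_times: "fk3_act (x * y) u = fk3_act x (fk3_act y u)"
  by (induction x, induction y) (simp add: times_fk3.abs_eq fk3_act_abs free_act_times)

lemma fk3_act_one: "fk3_act 1 u = u"
  by (simp add: one_fk3.abs_eq fk3_act_abs free_act_one)

lemma fk3_act_scale: "fk3_act (fk3_scale k x) u = s k (fk3_act x u)"
  by (induction x) (simp add: fk3_scale.abs_eq fk3_act_abs free_act_free_scale)

end

text \<open>Every element is a linear combination of words, so equivariance of a linear map reduces
  to the three generators. The axioms for \<alpha> are restricted to U because \<open>act\<close> is
  arbitrary outside a carrier.\<close>

lemma act_eq_free_act: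
  assumes T: "free_algebra_action s T"
    and add: "\<And>x y u. u \<in> U \<Longrightarrow> \<alpha> (x + y) u = \<alpha> x u + (\<alpha> y u :: 'w::ab_group_add)"
    and times: "\<And>x y u. u \<in> U \<Longrightarrow> \<alpha> (x * y) u = \<alpha> x (\<alpha> y u)"
    and one: "\<And>u. u \<in> U \<Longrightarrow> \<alpha> 1 u = u"
    and scale: "\<And>k x u. u \<in> U \<Longrightarrow> \<alpha> (fk3_scale k x) u = s' k (\<alpha> x u)"
    and f: "\<And>u. f u \<in> U" "\<And>u v. f (u + v) = f u + f v" "\<And>k u. f (s k u) = s' k (f u)"
    and eq: "\<And>g u. f (T g u) = \<alpha> (abs_fk3 (letter g)) (f u)"
  shows "f (free_act s T p u) = \<alpha> (abs_fk3 p) (f u)"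
proof -
  interpret free_algebra_action s T by fact
  have z: "\<alpha> 0 (f u) = 0" for u
    using add[OF f(1), of 0 0 u] by simp
  have f0: "f 0 = 0" using f(2)[of 0 0] by simp
  show ?thesis
  proof (induction p rule: free_algebra_induct)
    case zero
    then show ?case by (simp add: f0 z flip: zero_fk3.abs_eq)
  next
    case (add p q)
    then show ?case by (simp add: f free_act_plus assms(2) flip: plus_fk3.abs_eq)
  next
    case (single w k)
    have word: "f (foldr T xs u) = \<alpha> (abs_fk3 (Poly_Mapping.single (Word xs) 1)) (f u)" for xs
    proof (induction xs)
      case Nil
      show ?case
        using one[OF f(1)] by (simp add: single_one one_fk3.abs_eq[symmetric] flip: zero_free_monoid_def)
    next
      case (Cons x xs)
      have "Poly_Mapping.single (Word (x # xs)) (1::'a) = letter x * Poly_Mapping.single (Word xs) 1"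
        by (simp add: letter_def mult_single plus_free_monoid_def)
      then show ?case
        using Cons by (simp add: eq times[OF f(1)] flip: times_fk3.abs_eq)
    qed
    have "Poly_Mapping.single w k = free_scale k (Poly_Mapping.single w 1)"
      by (simp add: free_scale_def mult_single)
    then have "\<alpha> (abs_fk3 (Poly_Mapping.single w k)) (f u) = s' k (\<alpha> (abs_fk3 (Poly_Mapping.single w 1)) (f u))"
      using scale[OF f(1)] by (simp add: fk3_scale.abs_eq[symmetric])
    then show ?case
      using word[of "letters w"] by (simp add: free_act_single f word_act_def)
  qed
qed

section \<open>The model modules\<close>

text \<open>
  The types are named after the line of degree-one elements that annihilate degree zero; for
  \<open>Kill_abc t\<close> it is spanned by \<open>t a - t\<^sup>2 b + c\<close>, so that \<open>t = 0\<close> stands for the line of \<open>c\<close>.  In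
  the coordinates \<open>0, 1 | 2, 3 | 4, 5\<close> of the three layers, \<open>1\<close> is the killed vector.
\<close>

datatype 'k fk3_type = Kill_a | Kill_b | Kill_abc 'k

text \<open>Coordinates of g e0 in the basis e2, e3 of the middle layer; this basis consists of two
  of the vectors a e0, b e0, c e0.\<close>

fun low_coeff :: "'k::field fk3_type \<Rightarrow> fk_gen \<Rightarrow> nat \<Rightarrow> 'k" where
  "low_coeff Kill_a g i = (case g of Gen_a \<Rightarrow> 0 | Gen_b \<Rightarrow> if i = 0 then 1 else 0 | Gen_c \<Rightarrow> if i = 0 then 0 else 1)"
| "low_coeff Kill_b g i = (case g of Gen_a \<Rightarrow> if i = 0 then 1 else 0 | Gen_b \<Rightarrow> 0 | Gen_c \<Rightarrow> if i = 0 then 0 else 1)"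
| "low_coeff (Kill_abc t) g i = (case g of Gen_a \<Rightarrow> if i = 0 then 1 else 0 | Gen_b \<Rightarrow> if i = 0 then 0 else 1
    | Gen_c \<Rightarrow> if i = 0 then - t else t * t)"

text \<open>Entry i, j is the coefficient of e(4+i) in g e(2+j). With x = e0 the top basis is a b x,
  a c x for \<open>Kill_a\<close>, then b a x, c a x for \<open>Kill_b\<close>, and a b x, b a x for
  \<open>Kill_abc\<close>; the defining relations dictate all remaining products.\<close>

fun high_coeff :: "'k::field fk3_type \<Rightarrow> fk_gen \<Rightarrow> nat \<Rightarrow> nat \<Rightarrow> 'k" where
  "high_coeff Kill_a g i j = (case g of Gen_a \<Rightarrow> if i = j then 1 else 0
    | Gen_b \<Rightarrow> if i = 0 \<and> j = 1 then - 1 else 0 | Gen_c \<Rightarrow> if i = 1 \<and> j = 0 then 1 else 0)"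
| "high_coeff Kill_b g i j = (case g of Gen_a \<Rightarrow> if i = 0 \<and> j = 1 then 1 else 0
    | Gen_b \<Rightarrow> if i = j then 1 else 0 | Gen_c \<Rightarrow> if i = 1 \<and> j = 0 then 1 else 0)"
| "high_coeff (Kill_abc t) g i j = (case g of Gen_a \<Rightarrow> if i = 0 \<and> j = 1 then 1 else 0
    | Gen_b \<Rightarrow> if i = 1 \<and> j = 0 then 1 else 0
    | Gen_c \<Rightarrow> if j = 0 then (if i = 0 then 1 else - t) else (if i = 0 then t * t else - 1))"

text \<open>Applying c twice to e0 in the model gives (t^4 - t) e4, so this is the condition imposed
  by c^2 = 0.\<close>

fun fk3_types :: "'k::field fk3_type \<Rightarrow> bool" where
  "fk3_types (Kill_abc t) \<longleftrightarrow> t ^ 4 = t"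
| "fk3_types _ \<longleftrightarrow> True"

definition model_op :: "'k::field fk3_type \<Rightarrow> fk_gen \<Rightarrow> (nat \<Rightarrow> 'k) \<Rightarrow> nat \<Rightarrow> 'k" where
  "model_op \<tau> g v = (\<lambda>i.
     if i = 2 \<or> i = 3 then low_coeff \<tau> g (i - 2) * v 0
     else if i = 4 \<or> i = 5 then high_coeff \<tau> g (i - 4) 0 * v 2 + high_coeff \<tau> g (i - 4) 1 * v 3
     else 0)"

definition model :: "'k::field fk3_type \<Rightarrow> ('k fk3, nat \<Rightarrow> 'k) graded_module" where
  "model \<tau> = \<lparr>carrier = {v. \<forall>i. v i \<noteq> 0 \<longrightarrow> i < 6},
     act = fk3_action.fk3_act coord_scale (model_op \<tau>),
     component = (\<lambda>n. {v. \<forall>i. v i \<noteq> 0 \<longrightarrow> i < 6 \<and> i div 2 = n})\<rparr>"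

interpretation coord: vector_space coord_scale
  by (rule vector_space_coord_scale)

lemma free_algebra_action_model: "free_algebra_action coord_scale (model_op \<tau>)"
  by unfold_locales (auto simp: model_op_def coord_scale_def fun_eq_iff algebra_simps)

lemma fk3_action_model:
  fixes \<tau> :: "'k::field fk3_type"
  assumes "fk3_types \<tau>"
  shows "fk3_action coord_scale (model_op \<tau>)"
proof -
  interpret free_algebra_action coord_scale "model_op \<tau>" by (rule free_algebra_action_model)
  show ?thesis
  proof unfold_locales
    fix g and v :: "nat \<Rightarrow> 'k"
    show "model_op \<tau> g (model_op \<tau> g v) = 0"
      using assms by (cases \<tau>; cases g) (auto simp: model_op_def fun_eq_iff algebra_simps power4_eq_xxxx)
    show "model_op \<tau> Gen_c (model_op \<tau> Gen_a v) = model_op \<tau> Gen_a (model_op \<tau> Gen_b v) + model_op \<tau> Gen_b (model_op \<tau> Gen_c v)"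
      by (cases \<tau>) (auto simp: model_op_def fun_eq_iff)
    show "model_op \<tau> Gen_c (model_op \<tau> Gen_b v) = model_op \<tau> Gen_a (model_op \<tau> Gen_c v) - model_op \<tau> Gen_b (model_op \<tau> Gen_a v)"
      by (cases \<tau>) (auto simp: model_op_def fun_eq_iff)
  qed
qed

section \<open>Grading and generation of the models\<close>

definition unit_vec :: "nat \<Rightarrow> nat \<Rightarrow> 'k::field" where
  "unit_vec j = (\<lambda>i. if i = j then 1 else 0)"

lemma independent_unit_vec: "coord.independent (unit_vec ` J)"
  by (rule coord.independent_mono[OF independent_unit_vectors]) (auto simp: unit_vec_def)

lemma inj_unit_vec: "inj unit_vec"
  by (rule injI) (metis unit_vec_def zero_neq_one)

lemma span_unit_vec:
  assumes "finite J"
  shows "coord.span (unit_vec ` J) = {v :: nat \<Rightarrow> 'k::field. \<forall>i. v i \<noteq> 0 \<longrightarrow> i \<in> J}"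
proof (intro subset_antisym coord.span_minimal subsetI)
  show "coord.subspace {v :: nat \<Rightarrow> 'k. \<forall>i. v i \<noteq> 0 \<longrightarrow> i \<in> J}"
    by (auto simp: coord.subspace_def coord_scale_def) (metis add.left_neutral)
  fix v :: "nat \<Rightarrow> 'k" assume v: "v \<in> {v. \<forall>i. v i \<noteq> 0 \<longrightarrow> i \<in> J}"
  have "v = (\<Sum>j\<in>J. coord_scale (v j) (unit_vec j))"
  proof
    fix i
    have "(\<Sum>j\<in>J. coord_scale (v j) (unit_vec j)) i = (\<Sum>j\<in>J. coord_scale (v j) (unit_vec j) i)"
      by (induction J rule: infinite_finite_induct) auto
    also have "\<dots> = (\<Sum>j\<in>J. if i = j then v i else 0)"
      by (rule sum.cong) (auto simp: coord_scale_def unit_vec_def)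
    also have "\<dots> = v i" using assms v by (simp add: sum.delta') blast
    finally show "v i = (\<Sum>j\<in>J. coord_scale (v j) (unit_vec j)) i" ..
  qed
  also have "\<dots> \<in> coord.span (unit_vec ` J)"
    by (intro coord.span_sum coord.span_scale coord.span_base imageI)
  finally show "v \<in> coord.span (unit_vec ` J)" .
qed (auto simp: unit_vec_def split: if_splits)

lemma model_component: "component (model \<tau>) n = coord.span (unit_vec ` {i. i < 6 \<and> i div 2 = n})"
  by (simp add: model_def span_unit_vec)

lemma model_carrier: "carrier (model \<tau>) = coord.span (unit_vec ` {i. i < 6})"
  by (simp add: model_def span_unit_vec)

lemma has_dimension_model:
  "has_dimension coord_scale (component (model \<tau>) n) (if n \<le> 2 then 2 else 0)"
proof -
  have "{i. i < 6 \<and> i div 2 = n} = (if n \<le> 2 then {2 * n, 2 * n + 1} else {})"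
    by auto
  then have "card {i. i < 6 \<and> i div 2 = n} = (if n \<le> 2 then 2 else 0)"
    by simp
  then show ?thesis
    unfolding has_dimension_def model_component
    by (intro exI[of _ "unit_vec ` {i. i < 6 \<and> i div 2 = n}"] conjI independent_unit_vec coord.span_superset)
      (simp_all add: card_image[OF inj_on_subset[OF inj_unit_vec]])
qed

lemma internal_direct_sum_model:
  "internal_direct_sum coord_scale (carrier (model \<tau>)) (component (model \<tau>))"
  unfolding internal_direct_sum_def
proof (intro conjI allI impI ballI)
  show "coord.subspace (component (model \<tau>) n)" for n
    by (simp add: model_component)
  have "unit_vec ` {i. i < 6} \<subseteq> coord.span (\<Union>n. component (model \<tau>) n)"
    unfolding model_component by (blast intro: coord.span_base)
  moreover have "component (model \<tau>) n \<subseteq> carrier (model \<tau>)" for n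
    unfolding model_component model_carrier by (rule coord.span_mono) auto
  ultimately show "carrier (model \<tau>) = coord.span (\<Union>n. component (model \<tau>) n)"
    unfolding model_carrier
    by (intro subset_antisym coord.span_minimal coord.subspace_span UN_least)
  fix I f i
  assume A: "finite I \<and> (\<forall>i\<in>I. f i \<in> component (model \<tau>) i) \<and> sum f I = 0" and i: "i \<in> I"
  show "f i = 0"
  proof
    fix j
    have sum_app: "sum f J j = (\<Sum>k\<in>J. f k j)" for J
      by (induction J rule: infinite_finite_induct) auto
    \<comment> \<open>Coordinate j belongs to the component \<open>j div 2\<close> only, so
      evaluating the sum at j isolates one summand.\<close>
    have "f k j = 0" if "k \<in> I" "k \<noteq> j div 2" for k
      using A that by (auto simp: model_def)
    then have "(\<Sum>k\<in>I. f k j) = (if j div 2 \<in> I then f (j div 2) j else 0)"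
      using A by (simp add: sum.remove) (metis (no_types, lifting) sum.neutral)
    moreover have "(\<Sum>k\<in>I. f k j) = 0"
      using A by (simp flip: sum_app)
    ultimately show "f i j = (0 :: nat \<Rightarrow> 'a) j"
      using \<open>\<And>k. k \<in> I \<Longrightarrow> k \<noteq> j div 2 \<Longrightarrow> f k j = 0\<close>[OF i] i by (cases "i = j div 2") auto
  qed
qed

context
  fixes \<tau> :: "'k::field fk3_type"
  assumes \<tau>: "fk3_types \<tau>"
begin

interpretation fk3_action coord_scale "model_op \<tau>"
  by (rule fk3_action_model[OF \<tau>])

lemma act_model: "act (model \<tau>) = fk3_act"
  by (simp add: model_def)

lemma model_op_carrier: "model_op \<tau> g v \<in> carrier (model \<tau>)"
  by (auto simp: model_def model_op_def)

lemma model_op_component: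
  assumes "v \<in> component (model \<tau>) n"
  shows "model_op \<tau> g v \<in> component (model \<tau>) (Suc n)"
proof -
  have "v i = 0" if "n \<noteq> i div 2" for i
    using assms that by (auto simp: model_def)
  from this[of 0] this[of 2] this[of 3] show ?thesis
    by (cases "n = 0"; cases "n = 1") (auto simp: model_def model_op_def split: if_splits)
qed

lemma is_graded_module_model: "is_graded_module fk3_scale fk3_degree coord_scale (model \<tau>)"
  unfolding is_graded_module_def act_model
proof (intro conjI allI ballI)
  show "coord.subspace (carrier (model \<tau>))"
    by (simp add: model_carrier)
  show "fk3_act x u \<in> carrier (model \<tau>)" if "u \<in> carrier (model \<tau>)" for x u
    unfolding fk3_act_def
    by (rule free_act_in_subspace) (use that model_op_carrier in \<open>auto simp: model_carrier\<close>)
  show "fk3_act x u \<in> component (model \<tau>) (i + j)"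
    if "x \<in> fk3_degree i" "u \<in> component (model \<tau>) j" for i j x u
  proof -
    obtain p where p: "p \<in> free_degree i" "x = abs_fk3 p"
      using \<open>x \<in> fk3_degree i\<close> unfolding fk3_degree_def by blast
    show ?thesis
      unfolding p(2) fk3_act_abs
      by (rule free_act_degree) (use p that model_op_component in \<open>auto simp: model_component\<close>)
  qed
qed (simp_all add: fk3_act_add fk3_act_plus fk3_act_times fk3_act_one fk3_act_scale internal_direct_sum_model)

lemma generated_in_degree_zero_model: "generated_in_degree_zero coord_scale (model \<tau>)"
proof -
  define S where "S = {fk3_act x u |x u. u \<in> component (model \<tau>) 0}"
  let ?e = "unit_vec :: nat \<Rightarrow> nat \<Rightarrow> 'k"
  have in_S: "u \<in> S" if "u \<in> component (model \<tau>) 0" for u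
    unfolding S_def by (rule CollectI, rule exI[of _ 1], rule exI[of _ u]) (simp add: fk3_act_one that)
  have 0: "?e 0 \<in> S" and 1: "?e 1 \<in> S"
    by (auto intro!: in_S simp: model_def unit_vec_def split: if_splits)
  \<comment> \<open>S is not known to be a subspace, but it absorbs generators: the algebra element
    is multiplied by g on the left.\<close>
  have letter: "model_op \<tau> g w \<in> S" if "w \<in> S" for g w
  proof -
    from that obtain x u where "w = fk3_act x u" "u \<in> component (model \<tau>) 0"
      unfolding S_def by blast
    then have "model_op \<tau> g w = fk3_act (abs_fk3 (letter g) * x) u"
      by (simp add: fk3_act_times fk3_act_abs free_act_letter)
    with \<open>u \<in> component (model \<tau>) 0\<close> show ?thesis unfolding S_def by blast
  qed
  have "?e 2 \<in> S \<and> ?e 3 \<in> S \<and> ?e 4 \<in> S \<and> ?e 5 \<in> S"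
  proof (cases \<tau>)
    case Kill_a
    then have "?e 2 = model_op \<tau> Gen_b (?e 0)" "?e 3 = model_op \<tau> Gen_c (?e 0)"
      "?e 4 = model_op \<tau> Gen_a (?e 2)" "?e 5 = model_op \<tau> Gen_a (?e 3)"
      by (auto simp: model_op_def unit_vec_def fun_eq_iff)
    then show ?thesis using letter 0 by metis
  next
    case Kill_b
    then have "?e 2 = model_op \<tau> Gen_a (?e 0)" "?e 3 = model_op \<tau> Gen_c (?e 0)"
      "?e 4 = model_op \<tau> Gen_b (?e 2)" "?e 5 = model_op \<tau> Gen_b (?e 3)"
      by (auto simp: model_op_def unit_vec_def fun_eq_iff)
    then show ?thesis using letter 0 by metis
  next
    case (Kill_abc t)
    then have "?e 2 = model_op \<tau> Gen_a (?e 0)" "?e 3 = model_op \<tau> Gen_b (?e 0)"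
      "?e 4 = model_op \<tau> Gen_a (?e 3)" "?e 5 = model_op \<tau> Gen_b (?e 2)"
      by (auto simp: model_op_def unit_vec_def fun_eq_iff)
    then show ?thesis using letter 0 by metis
  qed
  moreover have "{i. i < 6} = {0, 1, 2, 3, 4, 5 :: nat}" by auto
  ultimately have "carrier (model \<tau>) \<subseteq> coord.span S"
    unfolding model_carrier using 0 1 by (intro coord.span_mono) auto
  moreover have "S \<subseteq> carrier (model \<tau>)"
    using is_graded_module_model component_subset_carrier[OF vector_space_coord_scale is_graded_module_model, of 0]
    unfolding is_graded_module_def act_model S_def by blast
  then have "coord.span S \<subseteq> carrier (model \<tau>)"
    unfolding model_carrier by (intro coord.span_minimal) auto
  ultimately show ?thesis
    unfolding generated_in_degree_zero_def act_model S_def by blast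
qed

lemma truncated_thick_point_module_model:
  "truncated_thick_point_module fk3_scale fk3_degree coord_scale 2 2 (model \<tau>)"
  unfolding truncated_thick_point_module_def
  using is_graded_module_model generated_in_degree_zero_model has_dimension_model by blast

end

section \<open>Two-dimensional spaces and graded layers\<close>

context vector_space
begin

text \<open>An ordered basis spelled out in scalars, so that coefficients can be compared directly
  and u = w is excluded by independence itself.\<close>

definition basis2 :: "'b set \<Rightarrow> 'b \<Rightarrow> 'b \<Rightarrow> bool" where
  "basis2 V u w \<longleftrightarrow> u \<in> V \<and> w \<in> V \<and>
     (\<forall>k l. scale k u + scale l w = 0 \<longrightarrow> k = 0 \<and> l = 0) \<and> V \<subseteq> span {u, w}"

lemma in_span2: "v \<in> span {u, w} \<longleftrightarrow> (\<exists>k l. v = scale k u + scale l w)"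
proof
  assume "v \<in> span {u, w}"
  then obtain k l where "v - scale k u - scale l w = 0"
    by (auto simp: span_breakdown_eq)
  then show "\<exists>k l. v = scale k u + scale l w" by (metis diff_diff_eq right_minus_eq)
qed (auto intro: span_add span_scale span_base)

lemma in_span1: "v \<in> span {u} \<longleftrightarrow> (\<exists>k. v = scale k u)"
  by (auto simp: span_breakdown_eq)

lemma basis2_if_has_dimension:
  assumes "has_dimension scale V 2"
  obtains u w where "basis2 V u w"
proof -
  obtain B where B: "B \<subseteq> V" "finite B" "independent B" "span B = V" "card B = 2"
    using assms unfolding has_dimension_def by blast
  obtain u w where uw: "B = {u, w}" "u \<noteq> w"
    using B(5) by (auto simp: card_2_iff)
  have "k = 0 \<and> l = 0" if "scale k u + scale l w = 0" for k l
  proof -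
    let ?c = "\<lambda>x. if x = u then k else l"
    have "(\<Sum>x\<in>B. scale (?c x) x) = 0" using uw that by simp
    note zero = independentD[OF B(3) B(2) subset_refl this]
    from zero[of u] zero[of w] show ?thesis using uw by simp
  qed
  then have "basis2 V u w" using B(4) uw unfolding basis2_def by (auto intro: span_base)
  then show thesis by (rule that)
qed

lemma basis2_zeroD: "basis2 V u w \<Longrightarrow> scale k u + scale l w = 0 \<Longrightarrow> k = 0 \<and> l = 0"
  unfolding basis2_def by blast

lemma basis2_coeffs: "basis2 V u w \<Longrightarrow> v \<in> V \<Longrightarrow> \<exists>k l. v = scale k u + scale l w"
  unfolding basis2_def using in_span2 by blast

lemma basis2_uniqueD:
  assumes "basis2 V u w" "scale k u + scale l w = scale k' u + scale l' w"
  shows "k = k' \<and> l = l'"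
proof -
  have "scale (k - k') u + scale (l - l') w = 0"
    using assms(2) by (simp add: scale_left_diff_distrib algebra_simps)
  from basis2_zeroD[OF assms(1) this] show ?thesis by simp
qed

text \<open>Multiples k p and l p satisfy l (k p) - k (l p) = 0, so independence forces k = l = 0,
  which is absurd. This excludes layers that collapse to a line.\<close>

lemma basis2_not_span1:
  assumes "basis2 V u w"
  shows "\<not> V \<subseteq> span {p}"
proof
  assume V: "V \<subseteq> span {p}"
  moreover have "u \<in> V" "w \<in> V" using assms by (auto simp: basis2_def)
  ultimately obtain k l where kl: "u = scale k p" "w = scale l p"
    using in_span1 by (metis subsetD)
  have "scale l u + scale (- k) w = 0" by (simp add: kl mult.commute)
  from basis2_zeroD[OF assms this] have "k = 0" "l = 0" by simp_all
  then have "scale 1 u + scale 0 w = 0" by (simp add: kl)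
  then show False using basis2_zeroD[OF assms] by (metis one_neq_zero)
qed

text \<open>A nontrivial dependency would let one of p, q be dropped, and V would lie in a
  line.\<close>

lemma basis2_if_span:
  assumes V: "basis2 V u w" and p: "p \<in> V" and q: "q \<in> V" and span: "V \<subseteq> span {p, q}"
  shows "basis2 V p q"
  unfolding basis2_def
proof (intro conjI allI impI p q span)
  fix k l assume kl: "scale k p + scale l q = 0"
  show "k = 0"
  proof (rule ccontr)
    assume k: "k \<noteq> 0"
    have "p = scale (- l / k) q"
    proof -
      have "scale (inverse k) (scale k p + scale l q) = 0" by (simp add: kl)
      then show ?thesis
        using k by (simp add: scale_right_distrib divide_inverse mult.commute eq_neg_iff_add_eq_0)
    qed
    then have "p \<in> span {q}" using in_span1 by blast
    then have "span {p, q} \<subseteq> span {q}"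
      by (intro span_minimal) (auto intro: span_base span_scale)
    with span basis2_not_span1[OF V] show False by blast
  qed
  show "l = 0"
  proof (rule ccontr)
    assume l: "l \<noteq> 0"
    have "q = scale (- k / l) p"
    proof -
      have "scale (inverse l) (scale l q + scale k p) = 0" by (simp add: kl add.commute)
      then show ?thesis
        using l by (simp add: scale_right_distrib divide_inverse mult.commute eq_neg_iff_add_eq_0)
    qed
    then have "q \<in> span {p}" using in_span1 by blast
    then have "span {p, q} \<subseteq> span {p}"
      by (intro span_minimal) (auto intro: span_base span_scale)
    with span basis2_not_span1[OF V] show False by blast
  qed
qed

text \<open>Steinitz exchange: y replaces one of u, w in which it has a nonzero coefficient, and the
  other one serves as x.\<close>

lemma basis2_extend:
  assumes V: "basis2 V u w" and y: "y \<in> V" "y \<noteq> 0"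
  obtains x where "basis2 V x y"
proof -
  obtain k l where kl: "y = scale k u + scale l w" using basis2_coeffs[OF V y(1)] by blast
  have uw: "u \<in> V" "w \<in> V" "V \<subseteq> span {u, w}" using V by (auto simp: basis2_def)
  show thesis
  proof (cases "k = 0")
    case False
    have "u = scale (- l / k) w + scale (1 / k) y"
      using False by (simp add: kl scale_right_distrib)
    then have "u \<in> span {w, y}" using in_span2 by blast
    then have "span {u, w} \<subseteq> span {w, y}"
      by (intro span_minimal) (auto intro: span_base)
    then show ?thesis using basis2_if_span[OF V uw(2) y(1)] uw(3) that by blast
  next
    case True
    with y kl have "l \<noteq> 0" by auto
    then have "w = scale 0 u + scale (1 / l) y"
      using True by (simp add: kl)
    then have "w \<in> span {u, y}" using in_span2 by blast
    then have "span {u, w} \<subseteq> span {u, y}"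
      by (intro span_minimal) (auto intro: span_base)
    then show ?thesis using basis2_if_span[OF V uw(1) y(1)] uw(3) that by blast
  qed
qed

text \<open>Two exchanges, first for q and then for p; independence keeps the coefficient at the
  exchanged vector nonzero.\<close>

lemma basis2_if_independent:
  assumes V: "basis2 V u w" and p: "p \<in> V" and q: "q \<in> V"
    and indep: "\<And>k l. scale k p + scale l q = 0 \<Longrightarrow> k = 0 \<and> l = 0"
  shows "basis2 V p q"
proof -
  have "q \<noteq> 0" using indep[of 0 1] by auto
  then obtain x where x: "basis2 V x q" using basis2_extend[OF V q] by blast
  obtain k l where kl: "p = scale k x + scale l q" using basis2_coeffs[OF x p] by blast
  have "k \<noteq> 0"
  proof
    assume "k = 0"
    then have "scale 1 p + scale (- l) q = 0" by (simp add: kl)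
    then show False using indep by (metis one_neq_zero)
  qed
  then have "x = scale (1 / k) p + scale (- l / k) q"
    by (simp add: kl scale_right_distrib)
  then have "x \<in> span {p, q}" using in_span2 by blast
  then have "span {x, q} \<subseteq> span {p, q}"
    by (intro span_minimal) (auto intro: span_base)
  moreover have "V \<subseteq> span {x, q}" using x by (simp add: basis2_def)
  ultimately show ?thesis by (intro basis2_if_span[OF x p q]) simp
qed

section \<open>Comparing layers of a direct sum\<close>

lemma span_UN_sum:
  fixes L :: "nat \<Rightarrow> 'b set"
  assumes L: "\<And>i. subspace (L i)" and v: "v \<in> span (\<Union>i. L i)"
  obtains n f where "\<And>i. f i \<in> L i" "v = (\<Sum>i<n. f i)"
proof -
  let ?S = "{v. \<exists>n f. (\<forall>i. f i \<in> L i) \<and> v = (\<Sum>i<(n::nat). f i)}"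
  have in_S: "v \<in> ?S" if "\<forall>i. f i \<in> L i" "v = (\<Sum>i<n. f i)" for v n f
    by (rule CollectI, rule exI[of _ n], rule exI[of _ f]) (use that in simp)
  have "span (\<Union>i. L i) \<subseteq> ?S"
  proof (rule span_minimal)
    show "(\<Union>i. L i) \<subseteq> ?S"
    proof
      fix v assume "v \<in> (\<Union>i. L i)"
      then obtain i where "v \<in> L i" by blast
      then show "v \<in> ?S"
        using subspace_0[OF L] by (intro in_S[of "\<lambda>j. if j = i then v else 0" _ "Suc i"]) auto
    qed
    show "subspace ?S"
      unfolding subspace_def
    proof (intro conjI ballI allI)
      show "0 \<in> ?S" using subspace_0[OF L] by (intro in_S[of "\<lambda>_. 0" _ 0]) auto
    next
      fix u v assume "u \<in> ?S" "v \<in> ?S"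
      then obtain n f m g where f: "\<forall>i. f i \<in> L i" "u = (\<Sum>i<(n::nat). f i)"
        and g: "\<forall>i. g i \<in> L i" "v = (\<Sum>i<(m::nat). g i)" by blast
      \<comment> \<open>Both sums are padded with zeros to the common length
        \<open>max n m\<close>.\<close>
      let ?h = "\<lambda>i. (if i < n then f i else 0) + (if i < m then g i else 0)"
      have "(\<Sum>i<max n m. if i < k then h i else 0) = (\<Sum>i<k. h i)" if "k \<le> max n m"
        for k and h :: "nat \<Rightarrow> 'b"
        using that by (intro sum.mono_neutral_cong_right) auto
      then have "u + v = (\<Sum>i<max n m. ?h i)"
        by (simp add: sum.distrib f(2) g(2))
      moreover have "\<forall>i. ?h i \<in> L i"
        using f(1) g(1) subspace_0[OF L] by (auto intro: subspace_add[OF L])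
      ultimately show "u + v \<in> ?S" by (intro in_S)
    next
      fix k u assume "u \<in> ?S"
      then obtain n f where f: "\<forall>i. f i \<in> L i" "u = (\<Sum>i<(n::nat). f i)" by blast
      then show "scale k u \<in> ?S"
        by (intro in_S[of "\<lambda>i. scale k (f i)" _ n]) (simp_all add: scale_sum_right subspace_scale[OF L])
    qed
  qed
  with v show thesis using that by blast
qed

lemma internal_direct_sumD:
  assumes "internal_direct_sum scale V W" "finite I" "\<And>i. i \<in> I \<Longrightarrow> f i \<in> W i" "sum f I = 0" "i \<in> I"
  shows "f i = 0"
proof -
  have "\<forall>I f. finite I \<and> (\<forall>i\<in>I. f i \<in> W i) \<and> sum f I = 0 \<longrightarrow> (\<forall>i\<in>I. f i = 0)"
    using assms(1) unfolding internal_direct_sum_def by (elim conjE)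
  from this[rule_format, of I f i] show ?thesis using assms(2-5) by simp
qed

text \<open>Write v as a sum of elements of the L i and compare it with v placed in degree j:
  uniqueness in the direct sum gives v = f j. Subspaces that already span V are thus the full
  layers.\<close>

lemma direct_sum_layer_subset:
  assumes ds: "internal_direct_sum scale V W"
    and L: "\<And>i. subspace (L i)" "\<And>i. L i \<subseteq> W i" and V: "V \<subseteq> span (\<Union>i. L i)"
  shows "W j \<subseteq> L j"
proof
  fix v assume v: "v \<in> W j"
  have W: "subspace (W i)" for i using ds by (simp add: internal_direct_sum_def)
  have "W j \<subseteq> V" using ds span_superset[of "\<Union>i. W i"] by (auto simp: internal_direct_sum_def)
  then have "v \<in> span (\<Union>i. L i)" using v V by blast
  then obtain n f where f: "\<And>i. f i \<in> L i" "v = (\<Sum>i<n. f i)"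
    using span_UN_sum[of L v] L(1) by blast
  \<comment> \<open>At least \<open>Suc j\<close> terms, so that degree j occurs even when the sum
    for v is shorter.\<close>
  let ?n = "max n (Suc j)"
  let ?f = "\<lambda>i. (if i < n then f i else 0) - (if i = j then v else 0)"
  have fL: "(if i < n then f i else 0) \<in> L i" for i
    using f(1) subspace_0[OF L(1)] by auto
  have "(\<Sum>i<?n. if i < n then f i else 0) = (\<Sum>i<n. f i)"
    by (intro sum.mono_neutral_cong_right) auto
  then have "(\<Sum>i<?n. ?f i) = 0"
    by (simp add: sum_subtractf f(2)[symmetric] less_max_iff_disj)
  moreover have "?f i \<in> W i" for i
    using fL[of i] L(2)[of i] v by (intro subspace_diff[OF W]) (auto intro: subspace_0[OF W])
  moreover have "finite {..<?n}" "j \<in> {..<?n}" by simp_all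
  ultimately have "?f j = 0"
    using internal_direct_sumD[OF ds, of "{..<?n}" ?f j] by blast
  then have "v = (if j < n then f j else 0)" by simp
  then show "v \<in> L j" using fL[of j] by simp
qed

section \<open>Matrices of maps between planes\<close>

definition matrix_of :: "('b \<Rightarrow> 'b) \<Rightarrow> (nat \<Rightarrow> 'b) \<Rightarrow> (nat \<Rightarrow> 'b) \<Rightarrow> (nat \<Rightarrow> nat \<Rightarrow> 'a) \<Rightarrow> bool" where
  "matrix_of X e f A \<longleftrightarrow> (\<forall>j<2. X (e j) = scale (A 0 j) (f 0) + scale (A 1 j) (f 1))"

text \<open>Linearity is asked on V only, because the action of a graded module is unconstrained
  outside its carrier.\<close>

definition linear_on :: "'b set \<Rightarrow> ('b \<Rightarrow> 'b) \<Rightarrow> bool" where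
  "linear_on V X \<longleftrightarrow> (\<forall>u\<in>V. \<forall>v\<in>V. \<forall>k l. X (scale k u + scale l v) = scale k (X u) + scale l (X v))"

lemma linear_onD: "linear_on V X \<Longrightarrow> u \<in> V \<Longrightarrow> v \<in> V \<Longrightarrow>
    X (scale k u + scale l v) = scale k (X u) + scale l (X v)"
  by (simp add: linear_on_def)

lemma matrix_of_exists:
  assumes e: "basis2 V (e 0) (e 1)" and f: "basis2 W (f 0) (f 1)" and X: "X ` V \<subseteq> W"
  obtains A where "matrix_of X e f A"
proof -
  have "\<exists>k l. j < 2 \<longrightarrow> X (e j) = scale k (f 0) + scale l (f 1)" for j :: nat
  proof (cases "j < 2")
    case True
    then have "e j \<in> V" using e by (auto simp: basis2_def less_2_cases_iff)
    then have "X (e j) \<in> W" using X by blast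
    from basis2_coeffs[OF f this] show ?thesis by blast
  qed simp
  then obtain K L where KL: "\<And>j. j < 2 \<Longrightarrow> X (e j) = scale (K j) (f 0) + scale (L j) (f 1)"
    by metis
  show thesis
    by (rule that[of "\<lambda>i j. if i = 0 then K j else L j"]) (simp add: matrix_of_def KL)
qed

lemma matrix_of_comp:
  assumes f: "basis2 W (f 0) (f 1)" and A: "matrix_of X e f A" and B: "matrix_of Y f h B"
    and lin: "linear_on W Y" and j: "j < 2"
  shows "Y (X (e j)) = scale (mult2 B A 0 j) (h 0) + scale (mult2 B A 1 j) (h 1)"
proof -
  have "f 0 \<in> W" "f 1 \<in> W" using f by (auto simp: basis2_def)
  then have "Y (X (e j)) = scale (A 0 j) (Y (f 0)) + scale (A 1 j) (Y (f 1))"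
    using A j linear_onD[OF lin] by (simp add: matrix_of_def)
  moreover have "Y (f 0) = scale (B 0 0) (h 0) + scale (B 1 0) (h 1)"
    "Y (f 1) = scale (B 0 1) (h 0) + scale (B 1 1) (h 1)"
    using B unfolding matrix_of_def by simp_all
  ultimately show ?thesis
    by (simp add: mult2_def scale_right_distrib scale_left_distrib mult.commute add.assoc add.left_commute)
qed

lemma jointly_onto_if_span:
  assumes e: "basis2 V (e 0) (e 1)" and f: "basis2 W (f 0) (f 1)"
    and m: "matrix_of X e f A" "matrix_of Y e f B" "matrix_of Z e f C"
    and lin: "linear_on V X" "linear_on V Y" "linear_on V Z"
    and span: "W \<subseteq> span (X ` V \<union> Y ` V \<union> Z ` V)"
  shows "jointly_onto A B C"
  unfolding jointly_onto_def
proof (intro allI impI)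
  fix a b assume ab: "\<forall>j<2. a * A 0 j + b * A 1 j = 0 \<and> a * B 0 j + b * B 1 j = 0 \<and> a * C 0 j + b * C 1 j = 0"
  \<comment> \<open>The kernel of the linear form (a, b); it contains the three images, hence W, and
    in particular f 0 and f 1.\<close>
  let ?K = "{scale k (f 0) + scale l (f 1) |k l. a * k + b * l = 0}"
  have in_K: "scale k (f 0) + scale l (f 1) \<in> ?K" if "a * k + b * l = 0" for k l
    using that by blast
  have K: "subspace ?K"
    unfolding subspace_def
  proof (intro conjI ballI allI)
    show "0 \<in> ?K" using in_K[of 0 0] by simp
  next
    fix u v assume "u \<in> ?K" "v \<in> ?K"
    then obtain k l k' l' where u: "u = scale k (f 0) + scale l (f 1)" and v: "v = scale k' (f 0) + scale l' (f 1)"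
      and kl: "a * k + b * l = 0" "a * k' + b * l' = 0" by blast
    have "a * (k + k') + b * (l + l') = 0" using kl by algebra
    moreover have "u + v = scale (k + k') (f 0) + scale (l + l') (f 1)"
      by (simp add: u v scale_left_distrib add.assoc add.left_commute)
    ultimately show "u + v \<in> ?K" using in_K by (simp only:)
  next
    fix c u assume "u \<in> ?K"
    then obtain k l where u: "u = scale k (f 0) + scale l (f 1)" and kl: "a * k + b * l = 0" by blast
    have "a * (c * k) + b * (c * l) = 0" using kl by algebra
    moreover have "scale c u = scale (c * k) (f 0) + scale (c * l) (f 1)"
      by (simp add: u scale_right_distrib)
    ultimately show "scale c u \<in> ?K" using in_K by (simp only:)
  qed
  have img: "T ` V \<subseteq> ?K" if "matrix_of T e f D" "linear_on V T" "\<forall>j<2. a * D 0 j + b * D 1 j = 0" for T D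
  proof
    fix w assume "w \<in> T ` V"
    then obtain v where v: "v \<in> V" "w = T v" by blast
    obtain k l where kl: "v = scale k (e 0) + scale l (e 1)" using basis2_coeffs[OF e v(1)] by blast
    have e01: "e 0 \<in> V" "e 1 \<in> V" using e by (auto simp: basis2_def)
    have "T (e j) \<in> ?K" if "j < 2" for j
      using \<open>matrix_of T e f D\<close> \<open>\<forall>j<2. a * D 0 j + b * D 1 j = 0\<close> that in_K
      by (simp add: matrix_of_def)
    then have "T (e 0) \<in> ?K" "T (e 1) \<in> ?K" by simp_all
    then show "w \<in> ?K"
      unfolding v(2) kl linear_onD[OF that(2) e01] by (intro subspace_add[OF K] subspace_scale[OF K])
  qed
  have "X ` V \<subseteq> ?K" "Y ` V \<subseteq> ?K" "Z ` V \<subseteq> ?K"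
    using ab by (intro img[OF m(1) lin(1)] img[OF m(2) lin(2)] img[OF m(3) lin(3)]; simp)+
  then have "span (X ` V \<union> Y ` V \<union> Z ` V) \<subseteq> ?K"
    by (intro span_minimal K Un_least)
  moreover have "f 0 \<in> W" "f 1 \<in> W" using f by (auto simp: basis2_def)
  ultimately have "f 0 \<in> ?K" "f 1 \<in> ?K" using span by blast+
  then obtain k l k' l' where kl: "f 0 = scale k (f 0) + scale l (f 1)" "a * k + b * l = 0"
    "f 1 = scale k' (f 0) + scale l' (f 1)" "a * k' + b * l' = 0" by blast
  have "1 = k \<and> 0 = l" "0 = k' \<and> 1 = l'"
    using kl(1,3) by (intro basis2_uniqueD[OF f]; simp)+
  with kl show "a = 0 \<and> b = 0" by auto
qed

text \<open>Coordinate-free form of \<open>fk3_pair_common_kernel\<close>: in the bases e, f, h the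
  maps become two matrix triples, and the kernel vector becomes a combination of e 0 and e
  1.\<close>

lemma common_kernel_vector:
  fixes X Y Z :: "'b \<Rightarrow> 'b" and e f h :: "nat \<Rightarrow> 'b"
  assumes U: "subspace U" and bases: "basis2 U (e 0) (e 1)" "basis2 V (f 0) (f 1)" "basis2 W (h 0) (h 1)"
    and into: "X ` U \<subseteq> V" "Y ` U \<subseteq> V" "Z ` U \<subseteq> V" "X ` V \<subseteq> W" "Y ` V \<subseteq> W" "Z ` V \<subseteq> W"
    and lin: "linear_on U X" "linear_on U Y" "linear_on U Z" "linear_on V X" "linear_on V Y" "linear_on V Z"
    and onto: "V \<subseteq> span (X ` U \<union> Y ` U \<union> Z ` U)" "W \<subseteq> span (X ` V \<union> Y ` V \<union> Z ` V)"
    and rel: "\<And>u. u \<in> U \<Longrightarrow> X (X u) = 0" "\<And>u. u \<in> U \<Longrightarrow> Y (Y u) = 0" "\<And>u. u \<in> U \<Longrightarrow> Z (Z u) = 0"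
      "\<And>u. u \<in> U \<Longrightarrow> X (Y u) + Y (Z u) + Z (X u) = 0"
      "\<And>u. u \<in> U \<Longrightarrow> Y (X u) + X (Z u) + Z (Y u) = 0"
  obtains y where "y \<in> U" "y \<noteq> 0" "X y = 0" "Y y = 0" "Z y = 0"
proof -
  obtain X1 where X1: "matrix_of X e f X1" using matrix_of_exists[OF bases(1,2) into(1)] .
  obtain Y1 where Y1: "matrix_of Y e f Y1" using matrix_of_exists[OF bases(1,2) into(2)] .
  obtain Z1 where Z1: "matrix_of Z e f Z1" using matrix_of_exists[OF bases(1,2) into(3)] .
  obtain X2 where X2: "matrix_of X f h X2" using matrix_of_exists[OF bases(2,3) into(4)] .
  obtain Y2 where Y2: "matrix_of Y f h Y2" using matrix_of_exists[OF bases(2,3) into(5)] .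
  obtain Z2 where Z2: "matrix_of Z f h Z2" using matrix_of_exists[OF bases(2,3) into(6)] .
  note comp = matrix_of_comp[where f = f and W = V, OF bases(2)]
  have e01: "e 0 \<in> U" "e 1 \<in> U" using bases(1) by (auto simp: basis2_def)
  have zero: "k = 0 \<and> l = 0" if "scale k (h 0) + scale l (h 1) = 0" for k l
    using basis2_zeroD[OF bases(3) that] .
  have "fk3_pair X1 Y1 Z1 X2 Y2 Z2"
  proof -
    have "mult2 X2 X1 0 j = 0 \<and> mult2 X2 X1 1 j = 0" "mult2 Y2 Y1 0 j = 0 \<and> mult2 Y2 Y1 1 j = 0"
      "mult2 Z2 Z1 0 j = 0 \<and> mult2 Z2 Z1 1 j = 0"
      "mult2 X2 Y1 0 j + mult2 Y2 Z1 0 j + mult2 Z2 X1 0 j = 0 \<and> mult2 X2 Y1 1 j + mult2 Y2 Z1 1 j + mult2 Z2 X1 1 j = 0"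
      "mult2 Y2 X1 0 j + mult2 X2 Z1 0 j + mult2 Z2 Y1 0 j = 0 \<and> mult2 Y2 X1 1 j + mult2 X2 Z1 1 j + mult2 Z2 Y1 1 j = 0"
      if j: "j < 2" for j
    proof -
      have ej: "e j \<in> U" using e01 j by (auto simp: less_2_cases_iff)
      note c = comp[OF X1 X2 lin(4) j] comp[OF Y1 Y2 lin(5) j] comp[OF Z1 Z2 lin(6) j]
        comp[OF Y1 X2 lin(4) j] comp[OF Z1 Y2 lin(5) j] comp[OF X1 Z2 lin(6) j]
        comp[OF X1 Y2 lin(5) j] comp[OF Z1 X2 lin(4) j] comp[OF Y1 Z2 lin(6) j]
      have sum3: "scale k (h 0) + scale l (h 1) + (scale k' (h 0) + scale l' (h 1)) + (scale k'' (h 0) + scale l'' (h 1))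
          = scale (k + k' + k'') (h 0) + scale (l + l' + l'') (h 1)" for k l k' l' k'' l''
        by (simp add: scale_left_distrib add.assoc add.left_commute)
      show "mult2 X2 X1 0 j = 0 \<and> mult2 X2 X1 1 j = 0" by (rule zero) (simp only: c[symmetric] rel ej)
      show "mult2 Y2 Y1 0 j = 0 \<and> mult2 Y2 Y1 1 j = 0" by (rule zero) (simp only: c[symmetric] rel ej)
      show "mult2 Z2 Z1 0 j = 0 \<and> mult2 Z2 Z1 1 j = 0" by (rule zero) (simp only: c[symmetric] rel ej)
      show "mult2 X2 Y1 0 j + mult2 Y2 Z1 0 j + mult2 Z2 X1 0 j = 0 \<and> mult2 X2 Y1 1 j + mult2 Y2 Z1 1 j + mult2 Z2 X1 1 j = 0"
        by (rule zero) (simp only: sum3[symmetric] c[symmetric] rel ej)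
      show "mult2 Y2 X1 0 j + mult2 X2 Z1 0 j + mult2 Z2 Y1 0 j = 0 \<and> mult2 Y2 X1 1 j + mult2 X2 Z1 1 j + mult2 Z2 Y1 1 j = 0"
        by (rule zero) (simp only: sum3[symmetric] c[symmetric] rel ej)
    qed
    then show ?thesis unfolding fk3_pair_def all_less_2 by simp
  qed
  then have "common_kernel X1 Y1 Z1"
    by (rule fk3_pair_common_kernel)
      (rule jointly_onto_if_span[OF bases(1,2) X1 Y1 Z1 lin(1-3) onto(1)]
        jointly_onto_if_span[OF bases(2,3) X2 Y2 Z2 lin(4-6) onto(2)])+
  then obtain v where v: "nonzero2 v" and ker: "\<forall>i<2. X1 i 0 * v 0 + X1 i 1 * v 1 = 0 \<and>
      Y1 i 0 * v 0 + Y1 i 1 * v 1 = 0 \<and> Z1 i 0 * v 0 + Z1 i 1 * v 1 = 0"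
    unfolding common_kernel_def by blast
  have kill: "T (scale (v 0) (e 0) + scale (v 1) (e 1)) = 0"
    if T: "linear_on U T" "matrix_of T e f D" "\<forall>i<2. D i 0 * v 0 + D i 1 * v 1 = 0" for T D
  proof -
    have t: "T (e 0) = scale (D 0 0) (f 0) + scale (D 1 0) (f 1)"
       "T (e 1) = scale (D 0 1) (f 0) + scale (D 1 1) (f 1)"
      using T(2) unfolding matrix_of_def by simp_all
    have "T (scale (v 0) (e 0) + scale (v 1) (e 1)) =
        scale (D 0 0 * v 0 + D 0 1 * v 1) (f 0) + scale (D 1 0 * v 0 + D 1 1 * v 1) (f 1)"
      unfolding linear_onD[OF T(1) e01] t
      by (simp add: scale_left_distrib scale_right_distrib add.assoc add.left_commute mult.commute)
    also have "\<dots> = 0" using T(3) unfolding all_less_2 by simp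
    finally show ?thesis .
  qed
  show thesis
  proof (rule that[of "scale (v 0) (e 0) + scale (v 1) (e 1)"])
    show "scale (v 0) (e 0) + scale (v 1) (e 1) \<noteq> 0"
      using basis2_zeroD[OF bases(1)] v unfolding nonzero2_def by blast
    show "scale (v 0) (e 0) + scale (v 1) (e 1) \<in> U"
      by (intro subspace_add[OF U] subspace_scale[OF U] e01)
  qed (rule kill[OF lin(1) X1] kill[OF lin(2) Y1] kill[OF lin(3) Z1], use ker in blast)+
qed

end

section \<open>Structure of truncated thick point modules\<close>

locale thick_fk3_module = vector_space s
  for s :: "'k::field \<Rightarrow> 'v::ab_group_add \<Rightarrow> 'v" +
  fixes M :: "('k fk3, 'v) graded_module" and d :: nat
  assumes thick: "truncated_thick_point_module fk3_scale fk3_degree s 2 d M"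
begin

abbreviation "layer \<equiv> component M"

definition op :: "fk_gen \<Rightarrow> 'v \<Rightarrow> 'v" where
  "op g = act M (abs_fk3 (letter g))"

lemma graded: "is_graded_module fk3_scale fk3_degree s M"
  and generated: "carrier M = span {act M x u |x u. u \<in> layer 0}"
  and dimension: "has_dimension s (layer i) (if i \<le> d then 2 else 0)"
  using thick unfolding truncated_thick_point_module_def generated_in_degree_zero_def by blast+

lemma subspace_carrier: "subspace (carrier M)"
  and act_closed: "u \<in> carrier M \<Longrightarrow> act M x u \<in> carrier M"
  and act_add: "u \<in> carrier M \<Longrightarrow> v \<in> carrier M \<Longrightarrow> act M x (u + v) = act M x u + act M x v"
  and act_plus: "u \<in> carrier M \<Longrightarrow> act M (x + y) u = act M x u + act M y u"
  and act_times: "u \<in> carrier M \<Longrightarrow> act M (x * y) u = act M x (act M y u)"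
  and act_one: "u \<in> carrier M \<Longrightarrow> act M 1 u = u"
  and act_fk3_scale: "u \<in> carrier M \<Longrightarrow> act M (fk3_scale k x) u = s k (act M x u)"
  and direct: "internal_direct_sum s (carrier M) layer"
  and act_layer: "x \<in> fk3_degree i \<Longrightarrow> u \<in> layer j \<Longrightarrow> act M x u \<in> layer (i + j)"
  using graded unfolding is_graded_module_def by blast+

lemma layer_carrier: "u \<in> layer i \<Longrightarrow> u \<in> carrier M"
  using component_subset_carrier[OF vector_space_axioms graded] by blast

lemma subspace_layer: "subspace (layer i)"
  using direct unfolding internal_direct_sum_def by blast

lemma act_scale:
  assumes "u \<in> carrier M"
  shows "act M x (s k u) = s k (act M x u)"
proof -
  have "s k u = act M (fk3_scale k 1) u" using assms by (simp add: act_fk3_scale act_one)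
  then have "act M x (s k u) = act M (x * fk3_scale k 1) u" using assms by (simp add: act_times)
  also have "x * fk3_scale k 1 = fk3_scale k x" by (simp flip: fk3_scale_mult(2))
  finally show ?thesis using assms by (simp add: act_fk3_scale)
qed

lemma op_add: "u \<in> carrier M \<Longrightarrow> v \<in> carrier M \<Longrightarrow> op g (u + v) = op g u + op g v"
  unfolding op_def by (rule act_add)

lemma op_scale: "u \<in> carrier M \<Longrightarrow> op g (s k u) = s k (op g u)"
  unfolding op_def by (rule act_scale)

lemma op_zero: "op g 0 = 0"
  using op_scale[OF subspace_0[OF subspace_carrier], of g 0] by simp

lemma op_layer: "u \<in> layer i \<Longrightarrow> op g u \<in> layer (Suc i)"
  using act_layer[of "abs_fk3 (letter g)" 1 u i] letter_homogeneous[of g]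
  unfolding op_def fk3_degree_def by auto

lemma op_carrier: "u \<in> carrier M \<Longrightarrow> op g u \<in> carrier M"
  unfolding op_def by (rule act_closed)

lemma op_comb:
  assumes "u \<in> carrier M" "v \<in> carrier M"
  shows "op g (s k u + s l v) = s k (op g u) + s l (op g v)"
  using assms by (simp add: op_add op_scale subspace_scale[OF subspace_carrier])

lemma relation_abs:
  assumes "r \<in> fk3_relations"
  shows "abs_fk3 r = 0"
  unfolding zero_fk3.abs_eq abs_fk3_eq_iff fk3_ideal_def using assms by (simp add: hull_inc)

lemma op_square: "u \<in> carrier M \<Longrightarrow> op g (op g u) = 0"
  and op_rel1: "u \<in> carrier M \<Longrightarrow> op Gen_c (op Gen_a u) = op Gen_a (op Gen_b u) + op Gen_b (op Gen_c u)"
  and op_rel2: "u \<in> carrier M \<Longrightarrow> op Gen_c (op Gen_b u) = op Gen_a (op Gen_c u) - op Gen_b (op Gen_a u)"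
proof -
  assume u: "u \<in> carrier M"
  define l :: "fk_gen \<Rightarrow> 'k fk3" where "l g = abs_fk3 (letter g)" for g
  have l: "act M (l g * l h) u = op g (op h u)" for g h
    using u by (simp add: act_times op_def l_def)
  have act0: "act M 0 u = 0" using act_plus[OF u, of 0 0] by simp
  have rel: "l g * l g = 0" "l Gen_c * l Gen_a = l Gen_a * l Gen_b + l Gen_b * l Gen_c"
    "l Gen_a * l Gen_c = l Gen_c * l Gen_b + l Gen_b * l Gen_a" for g
  proof -
    have "abs_fk3 (letter g * letter g) = (0 :: 'k fk3)"
      by (rule relation_abs) (cases g; simp add: fk3_relations_def Let_def)
    then show "l g * l g = 0" by (simp add: l_def times_fk3.abs_eq)
    have "abs_fk3 (letter Gen_c * letter Gen_a - letter Gen_a * letter Gen_b - letter Gen_b * letter Gen_c) = (0 :: 'k fk3)"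
      by (rule relation_abs) (simp add: fk3_relations_def Let_def)
    then have "l Gen_c * l Gen_a - l Gen_a * l Gen_b - l Gen_b * l Gen_c = 0"
      by (simp add: l_def times_fk3.abs_eq minus_fk3.abs_eq)
    then show "l Gen_c * l Gen_a = l Gen_a * l Gen_b + l Gen_b * l Gen_c"
      by (simp only: diff_eq_eq add_0_left add.commute)
    have "abs_fk3 (letter Gen_c * letter Gen_b - letter Gen_a * letter Gen_c + letter Gen_b * letter Gen_a) = (0 :: 'k fk3)"
      by (rule relation_abs) (simp add: fk3_relations_def Let_def)
    then have "l Gen_c * l Gen_b - l Gen_a * l Gen_c + l Gen_b * l Gen_a = 0"
      by (simp add: l_def times_fk3.abs_eq minus_fk3.abs_eq plus_fk3.abs_eq)
    moreover have "y = x + z" if "x - y + z = 0" for x y z :: "'k fk3"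
    proof -
      have "x + z = (x - y + z) + y" by simp
      with that show ?thesis by simp
    qed
    ultimately show "l Gen_a * l Gen_c = l Gen_c * l Gen_b + l Gen_b * l Gen_a"
      by blast
  qed
  have "op g (op g u) = act M (l g * l g) u" by (rule l[symmetric])
  then show "op g (op g u) = 0" unfolding rel(1) act0 .
  have "op Gen_c (op Gen_a u) = act M (l Gen_a * l Gen_b + l Gen_b * l Gen_c) u"
    unfolding rel(2)[symmetric] by (rule l[symmetric])
  then show "op Gen_c (op Gen_a u) = op Gen_a (op Gen_b u) + op Gen_b (op Gen_c u)"
    unfolding act_plus[OF u] l .
  have "op Gen_a (op Gen_c u) = act M (l Gen_c * l Gen_b + l Gen_b * l Gen_a) u"
    unfolding rel(3)[symmetric] by (rule l[symmetric])
  then show "op Gen_c (op Gen_b u) = op Gen_a (op Gen_c u) - op Gen_b (op Gen_a u)"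
    unfolding act_plus[OF u] l by simp
qed

text \<open>Generation in degree zero speaks of the whole carrier. Splitting off the first letter of
  each word shows that layer 0 and the spans of the images of all layers together span the carrier;
  each lies in its own layer, so directness makes it the full layer.\<close>

lemma layer_Suc_subset: "layer (Suc j) \<subseteq> span {op g u |g u. u \<in> layer j}"
proof -
  define L where "L i = (case i of 0 \<Rightarrow> layer 0 | Suc j \<Rightarrow> span {op g u |g u. u \<in> layer j})" for i
  have L: "subspace (L i)" for i
    by (cases i) (simp_all add: L_def subspace_layer)
  have LW: "L i \<subseteq> layer i" for i
  proof (cases i)
    case (Suc j)
    have "span {op g u |g u. u \<in> layer j} \<subseteq> layer (Suc j)"
      by (rule span_minimal) (auto intro: subspace_layer op_layer)
    with Suc show ?thesis by (simp add: L_def)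
  qed (simp add: L_def)
  have word: "act M (abs_fk3 (Poly_Mapping.single (Word xs) 1)) u \<in> L (length xs)" if u: "u \<in> layer 0" for xs u
  proof (induction xs)
    case Nil
    have "act M 1 u \<in> layer 0" using u act_one layer_carrier by simp
    then show ?case
      by (simp add: L_def single_one one_fk3.abs_eq flip: zero_free_monoid_def)
  next
    case (Cons x xs)
    have "Poly_Mapping.single (Word (x # xs)) (1::'k) = letter x * Poly_Mapping.single (Word xs) 1"
      by (simp add: letter_def mult_single plus_free_monoid_def)
    then have "act M (abs_fk3 (Poly_Mapping.single (Word (x # xs)) 1)) u =
        op x (act M (abs_fk3 (Poly_Mapping.single (Word xs) 1)) u)"
      using layer_carrier[OF u] by (simp add: op_def flip: act_times times_fk3.abs_eq)
    moreover have "act M (abs_fk3 (Poly_Mapping.single (Word xs) 1)) u \<in> layer (length xs)"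
      using Cons LW by blast
    ultimately show ?case by (auto simp: L_def intro!: span_base)
  qed
  have act: "act M (abs_fk3 p) u \<in> span (\<Union>i. L i)" if u: "u \<in> layer 0" for p u
  proof (induction p rule: free_algebra_induct)
    case zero
    have "act M 0 u = 0" using act_plus[OF layer_carrier[OF u], of 0 0] by simp
    then show ?case by (simp add: span_zero flip: zero_fk3.abs_eq)
  next
    case (add p q)
    then show ?case
      using layer_carrier[OF u] by (simp add: act_plus span_add flip: plus_fk3.abs_eq)
  next
    case (single w k)
    have "Poly_Mapping.single w k = free_scale k (Poly_Mapping.single (Word (letters w)) 1)"
      by (simp add: free_scale_def mult_single)
    then have "act M (abs_fk3 (Poly_Mapping.single w k)) u =
        s k (act M (abs_fk3 (Poly_Mapping.single (Word (letters w)) 1)) u)"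
      using layer_carrier[OF u] by (simp add: act_fk3_scale flip: fk3_scale.abs_eq)
    then show ?case using word[OF u, of "letters w"] by (auto intro!: span_scale intro: span_base)
  qed
  have "act M x u \<in> span (\<Union>i. L i)" if "u \<in> layer 0" for x u
    using act[OF that] by (induction x)
  then have "carrier M \<subseteq> span (\<Union>i. L i)"
    unfolding generated by (intro span_minimal) auto
  from direct_sum_layer_subset[OF direct L LW this, of "Suc j"] show ?thesis
    by (simp add: L_def)
qed

lemma layer_basis:
  assumes "i \<le> d"
  obtains u w where "basis2 (layer i) u w"
  using basis2_if_has_dimension[of "layer i"] dimension[of i] assms by auto

lemma linear_on_op: "linear_on (layer j) (op g)"
  unfolding linear_on_def by (auto intro: op_comb layer_carrier)

text \<open>The index j is arbitrary because the bound on d in \<open>degree_le_2\<close> comes from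
  the case j = 1, while the classification uses j = 0.\<close>

lemma killed_vector:
  assumes "Suc (Suc j) \<le> d"
  obtains y where "y \<in> layer j" "y \<noteq> 0" "\<And>g. op g y = 0"
proof -
  let ?Y = "\<lambda>u. - op Gen_b u" \<comment> \<open>the sign makes the relations cyclically symmetric\<close>
  obtain e0 e1 where "basis2 (layer j) e0 e1" using layer_basis[of j] assms by auto
  then have e: "basis2 (layer j) ((\<lambda>i::nat. if i = 0 then e0 else e1) 0) ((\<lambda>i::nat. if i = 0 then e0 else e1) 1)"
    by simp
  obtain f0 f1 where "basis2 (layer (Suc j)) f0 f1" using layer_basis[of "Suc j"] assms by auto
  then have f: "basis2 (layer (Suc j)) ((\<lambda>i::nat. if i = 0 then f0 else f1) 0) ((\<lambda>i::nat. if i = 0 then f0 else f1) 1)"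
    by simp
  obtain h0 h1 where "basis2 (layer (Suc (Suc j))) h0 h1" using layer_basis[of "Suc (Suc j)"] assms by auto
  then have h: "basis2 (layer (Suc (Suc j))) ((\<lambda>i::nat. if i = 0 then h0 else h1) 0) ((\<lambda>i::nat. if i = 0 then h0 else h1) 1)"
    by simp
  have into: "op g ` layer i \<subseteq> layer (Suc i)" for g i
    using op_layer by blast
  have intoY: "?Y ` layer i \<subseteq> layer (Suc i)" for i
    using op_layer subspace_neg[OF subspace_layer] by blast
  have linY: "linear_on (layer i) ?Y" for i
    unfolding linear_on_def using layer_carrier by (auto simp: op_comb)
  have onto: "layer (Suc i) \<subseteq> span (op Gen_a ` layer i \<union> ?Y ` layer i \<union> op Gen_c ` layer i)" (is "_ \<subseteq> span ?S") for i
  proof -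
    have "op g u \<in> span ?S" if u: "u \<in> layer i" for g u
    proof (cases g)
      case Gen_b
      have "- (- op Gen_b u) \<in> span ?S" using u by (intro span_neg span_base) blast
      with Gen_b show ?thesis by simp
    qed (use u in \<open>auto intro: span_base\<close>)
    then have "span {op g u |g u. u \<in> layer i} \<subseteq> span ?S"
      by (intro span_minimal) auto
    with layer_Suc_subset[of i] show ?thesis by blast
  qed
  have neg: "op g (- u) = - op g u" if "u \<in> carrier M" for g u
    using op_scale[OF that, of g "- 1"] by simp
  have rel: "op g (op g u) = 0" "?Y (?Y u) = 0"
    "op Gen_a (?Y u) + ?Y (op Gen_c u) + op Gen_c (op Gen_a u) = 0"
    "?Y (op Gen_a u) + op Gen_a (op Gen_c u) + op Gen_c (?Y u) = 0" if "u \<in> layer j" for g u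
  proof -
    have u: "u \<in> carrier M" using layer_carrier[OF that] .
    show "op g (op g u) = 0" by (rule op_square[OF u])
    show "?Y (?Y u) = 0" by (simp add: neg[OF op_carrier[OF u]] op_square[OF u])
    show "op Gen_a (?Y u) + ?Y (op Gen_c u) + op Gen_c (op Gen_a u) = 0"
      by (simp add: neg[OF op_carrier[OF u]] op_rel1[OF u])
    show "?Y (op Gen_a u) + op Gen_a (op Gen_c u) + op Gen_c (?Y u) = 0"
      by (simp add: neg[OF op_carrier[OF u]] op_rel2[OF u])
  qed
  obtain y where y: "y \<in> layer j" "y \<noteq> 0" "op Gen_a y = 0" "?Y y = 0" "op Gen_c y = 0"
    using common_kernel_vector[OF subspace_layer e f h into intoY into into intoY into
      linear_on_op linY linear_on_op linear_on_op linY linear_on_op onto onto rel(1) rel(2) rel(1) rel(3) rel(4)]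
    by blast
  have "op g y = 0" for g using y by (cases g) auto
  with y that show thesis by blast
qed

lemma layer_Suc_subset_subspace:
  assumes "basis2 (layer j) p q" "subspace S" "\<And>g. op g p \<in> S" "\<And>g. op g q \<in> S"
  shows "layer (Suc j) \<subseteq> S"
proof -
  have pq: "p \<in> carrier M" "q \<in> carrier M"
    using assms(1) layer_carrier by (auto simp: basis2_def)
  have "op g u \<in> S" if u: "u \<in> layer j" for g u
  proof -
    obtain k l where "u = s k p + s l q" using basis2_coeffs[OF assms(1) u] by blast
    then show ?thesis
      using op_comb[OF pq] assms(3,4) by (simp add: subspace_add[OF assms(2)] subspace_scale[OF assms(2)])
  qed
  then have "span {op g u |g u. u \<in> layer j} \<subseteq> S"
    by (intro span_minimal assms(2)) auto
  with layer_Suc_subset[of j] show ?thesis by blast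
qed

text \<open>The vectors b 0 to b 5 play the roles of the model coordinates, shifted to start in
  layer j; b 1 is the killed vector.\<close>

definition presents :: "'k fk3_type \<Rightarrow> nat \<Rightarrow> (nat \<Rightarrow> 'v) \<Rightarrow> bool" where
  "presents \<tau> j b \<longleftrightarrow>
     basis2 (layer j) (b 0) (b 1) \<and> basis2 (layer (Suc j)) (b 2) (b 3) \<and>
     basis2 (layer (Suc (Suc j))) (b 4) (b 5) \<and>
     (\<forall>g. op g (b 0) = s (low_coeff \<tau> g 0) (b 2) + s (low_coeff \<tau> g 1) (b 3) \<and> op g (b 1) = 0 \<and>
        op g (b 2) = s (high_coeff \<tau> g 0 0) (b 4) + s (high_coeff \<tau> g 1 0) (b 5) \<and>
        op g (b 3) = s (high_coeff \<tau> g 0 1) (b 4) + s (high_coeff \<tau> g 1 1) (b 5))"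

section \<open>Normal forms of three consecutive layers\<close>

lemma presents_Kill_a:
  assumes b: "basis2 (layer j) x y" "basis2 (layer (Suc j)) p q" "basis2 (layer (Suc (Suc j))) n m"
    and y: "\<And>g. op g y = 0" and x: "op Gen_a x = 0" "op Gen_b x = p" "op Gen_c x = q"
    and p: "op Gen_a p = n" "op Gen_b p = 0" "op Gen_c p = m"
    and q: "op Gen_a q = m" "op Gen_b q = - n" "op Gen_c q = 0"
  shows "presents Kill_a j (\<lambda>i. [x, y, p, q, n, m] ! i)"
proof -
  have all: "(\<forall>g. P g) \<longleftrightarrow> P Gen_a \<and> P Gen_b \<and> P Gen_c" for P by (metis fk_gen.exhaust)
  show ?thesis unfolding presents_def all by (simp add: assms)
qed

lemma presents_Kill_b:
  assumes b: "basis2 (layer j) x y" "basis2 (layer (Suc j)) p q" "basis2 (layer (Suc (Suc j))) n m"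
    and y: "\<And>g. op g y = 0" and x: "op Gen_a x = p" "op Gen_b x = 0" "op Gen_c x = q"
    and p: "op Gen_a p = 0" "op Gen_b p = n" "op Gen_c p = m"
    and q: "op Gen_a q = n" "op Gen_b q = m" "op Gen_c q = 0"
  shows "presents Kill_b j (\<lambda>i. [x, y, p, q, n, m] ! i)"
proof -
  have all: "(\<forall>g. P g) \<longleftrightarrow> P Gen_a \<and> P Gen_b \<and> P Gen_c" for P by (metis fk_gen.exhaust)
  show ?thesis unfolding presents_def all by (simp add: assms)
qed

lemma presents_Kill_abc:
  assumes b: "basis2 (layer j) x y" "basis2 (layer (Suc j)) p q" "basis2 (layer (Suc (Suc j))) n m"
    and y: "\<And>g. op g y = 0"
    and x: "op Gen_a x = p" "op Gen_b x = q" "op Gen_c x = s (- t) p + s (t * t) q"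
    and p: "op Gen_a p = 0" "op Gen_b p = m" "op Gen_c p = n - s t m"
    and q: "op Gen_a q = n" "op Gen_b q = 0" "op Gen_c q = s (t * t) n - m"
  shows "presents (Kill_abc t) j (\<lambda>i. [x, y, p, q, n, m] ! i)"
proof -
  have all: "(\<forall>g. P g) \<longleftrightarrow> P Gen_a \<and> P Gen_b \<and> P Gen_c" for P by (metis fk_gen.exhaust)
  show ?thesis unfolding presents_def all by (simp add: assms)
qed

text \<open>As y is killed, the images A, B, C of x under a, b, c span the next layer. Either A and
  B are independent, or B is a multiple of A, or A = 0. In each case the relations express all
  products in terms of two of them, n and m, which therefore form a basis of the third
  layer.\<close>

lemma presentation_exists:
  assumes j: "Suc (Suc j) \<le> d"
  obtains \<tau> b where "fk3_types \<tau>" "presents \<tau> j b"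
proof -
  obtain y where y: "y \<in> layer j" "y \<noteq> 0" "\<And>g. op g y = 0" using killed_vector[OF j] by blast
  obtain e0 e1 where "basis2 (layer j) e0 e1" using layer_basis[of j] j by auto
  then obtain x where xy: "basis2 (layer j) x y" using basis2_extend y(1,2) by blast
  obtain f0 f1 where f: "basis2 (layer (Suc j)) f0 f1" using layer_basis[of "Suc j"] j by auto
  obtain h0 h1 where h: "basis2 (layer (Suc (Suc j))) h0 h1" using layer_basis[of "Suc (Suc j)"] j by auto
  have x: "x \<in> layer j" "x \<in> carrier M" using xy layer_carrier by (auto simp: basis2_def)
  define A B C where "A = op Gen_a x" and "B = op Gen_b x" and "C = op Gen_c x"
  note ABC = A_def[symmetric] B_def[symmetric] C_def[symmetric]
  have in1: "A \<in> layer (Suc j)" "B \<in> layer (Suc j)" "C \<in> layer (Suc j)"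
    using x(1) op_layer by (simp_all add: A_def B_def C_def)
  have car: "A \<in> carrier M" "B \<in> carrier M" "C \<in> carrier M" using in1 layer_carrier by blast+
  have in2: "op g A \<in> layer (Suc (Suc j))" "op g B \<in> layer (Suc (Suc j))" "op g C \<in> layer (Suc (Suc j))" for g
    using in1 op_layer by blast+
  have rel: "op Gen_a A = 0" "op Gen_b B = 0" "op Gen_c C = 0"
    "op Gen_c A = op Gen_a B + op Gen_b C" "op Gen_c B = op Gen_a C - op Gen_b A"
    unfolding A_def B_def C_def by (rule op_square[OF x(2)] op_rel1[OF x(2)] op_rel2[OF x(2)])+
  have span1: "layer (Suc j) \<subseteq> S" if "subspace S" "A \<in> S" "B \<in> S" "C \<in> S" for S
  proof (rule layer_Suc_subset_subspace[OF xy that(1)])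
    show "op g x \<in> S" for g using that by (cases g) (simp_all add: ABC)
    show "op g y \<in> S" for g using subspace_0[OF that(1)] by (simp add: y)
  qed
  consider (AB) "basis2 (layer (Suc j)) A B"
    | (B) k l where "s k A + s l B = 0" "l \<noteq> 0" | (A) k where "s k A = 0" "k \<noteq> 0"
  proof (cases "\<forall>k l. s k A + s l B = 0 \<longrightarrow> k = 0 \<and> l = 0")
    case True
    then show thesis using basis2_if_independent[OF f in1(1,2)] that(1) by blast
  next
    case False
    then obtain k l where kl: "s k A + s l B = 0" "\<not> (k = 0 \<and> l = 0)" by blast
    show thesis
    proof (cases "l = 0")
      case True
      with kl show thesis by (intro that(3)[of k]) auto
    qed (use kl that(2) in blast)
  qed
  then show thesis
  proof cases
    case AB
    obtain t' r where C: "C = s t' A + s r B" using basis2_coeffs[OF AB in1(3)] by blast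
    define t where "t = - t'"
    have C: "C = s (- t) A + s r B" using C by (simp add: t_def)
    define n m where "n = op Gen_a B" and "m = op Gen_b A"
    have opC: "op g C = s (- t) (op g A) + s r (op g B)" for g
      unfolding C by (rule op_comb[OF car(1,2)])
    have cA: "op Gen_c A = n - s t m" unfolding rel(4) opC by (simp add: rel n_def m_def)
    have cB: "op Gen_c B = s r n - m" unfolding rel(5) opC by (simp add: rel n_def m_def)
    have "layer (Suc (Suc j)) \<subseteq> span {n, m}"
    proof (rule layer_Suc_subset_subspace[OF AB subspace_span])
      show "op g A \<in> span {n, m}" for g
        by (cases g) (auto simp: rel(1) cA m_def[symmetric] intro: span_base span_zero span_diff span_scale)
      show "op g B \<in> span {n, m}" for g
        by (cases g) (auto simp: rel(2) cB n_def[symmetric] intro: span_base span_zero span_diff span_scale)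
    qed
    then have nm: "basis2 (layer (Suc (Suc j))) n m"
      using basis2_if_span[OF h] in2 unfolding n_def m_def by blast
    \<comment> \<open>This is c^2 x = 0 in the basis n, m; the coefficients give t = r^2 and r =
      t^2, hence t^4 = t.\<close>
    have "0 = op Gen_c C" using rel(3) by simp
    also have "\<dots> = s (r * r - t) n + s (t * t - r) m"
      unfolding opC cA cB by (simp add: scale_right_diff_distrib scale_left_diff_distrib)
    finally have "r * r - t = 0 \<and> t * t - r = 0" using basis2_zeroD[OF nm] by metis
    then have t: "r = t * t" "t ^ 4 = t" by (auto simp: power4_eq_xxxx mult.assoc)
    have "presents (Kill_abc t) j (\<lambda>i. [x, y, A, B, n, m] ! i)"
      by (rule presents_Kill_abc[OF xy AB nm y(3)])
        (simp_all add: ABC C t(1) rel(1,2) cA cB flip: n_def m_def)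
    with t that[of "Kill_abc t"] show thesis by simp
  next
    case (B k l)
    define c where "c = - (k / l)"
    have B': "B = s c A"
    proof -
      have "s (inverse l) (s l B + s k A) = 0" using B(1) by (simp add: add.commute)
      then have "B + s (k / l) A = 0"
        using B(2) by (simp add: scale_right_distrib divide_inverse mult.commute)
      then show ?thesis by (simp add: c_def eq_neg_iff_add_eq_0)
    qed
    have "layer (Suc j) \<subseteq> span {A, C}"
      by (rule span1) (auto simp: B' intro: span_base span_scale)
    then have AC: "basis2 (layer (Suc j)) A C" using basis2_if_span[OF f in1(1,3)] by blast
    have opB: "op g B = s c (op g A)" for g unfolding B' by (rule op_scale[OF car(1)])
    have cA: "op Gen_c A = op Gen_b C" using rel(4) by (simp add: opB rel(1))
    have cA': "s c (op Gen_c A) = op Gen_a C - op Gen_b A" using rel(5) by (simp add: opB)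
    have bA: "s c (op Gen_b A) = 0" using rel(2) by (simp add: opB)
    \<comment> \<open>If the scalar c were nonzero, then \<open>op Gen_b A = 0\<close> and every
      product would be a multiple of \<open>op Gen_c A\<close>, so the third layer would lie in a
      line.\<close>
    have c: "c = 0"
    proof (rule ccontr)
      assume "c \<noteq> 0"
      then have bA: "op Gen_b A = 0" using bA by simp
      have "layer (Suc (Suc j)) \<subseteq> span {op Gen_c A}"
      proof (rule layer_Suc_subset_subspace[OF AC subspace_span])
        show "op g A \<in> span {op Gen_c A}" for g
          by (cases g) (auto simp: rel(1) bA intro: span_base span_zero)
        have "op Gen_a C = s c (op Gen_c A)" using cA' bA by simp
        then show "op g C \<in> span {op Gen_c A}" for g
          by (cases g) (auto simp: rel(3) cA[symmetric] intro: span_base span_zero span_scale)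
      qed
      with basis2_not_span1[OF h] show False by blast
    qed
    define n m where "n = op Gen_b A" and "m = op Gen_c A"
    have aC: "op Gen_a C = n" using cA' by (simp add: c n_def)
    have bC: "op Gen_b C = m" using cA by (simp add: m_def)
    have "layer (Suc (Suc j)) \<subseteq> span {n, m}"
    proof (rule layer_Suc_subset_subspace[OF AC subspace_span])
      show "op g A \<in> span {n, m}" for g
        by (cases g) (auto simp: rel(1) n_def[symmetric] m_def[symmetric] intro: span_base span_zero)
      show "op g C \<in> span {n, m}" for g
        by (cases g) (auto simp: rel(3) aC bC intro: span_base span_zero)
    qed
    then have nm: "basis2 (layer (Suc (Suc j))) n m"
      using basis2_if_span[OF h] in2 unfolding n_def m_def by blast
    have "presents Kill_b j (\<lambda>i. [x, y, A, C, n, m] ! i)"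
      by (rule presents_Kill_b[OF xy AC nm y(3)])
        (simp_all add: ABC B' c rel(1,3) aC bC flip: n_def m_def)
    with that[of Kill_b] show thesis by simp
  next
    case (A k)
    then have A: "A = 0" by simp
    have "layer (Suc j) \<subseteq> span {B, C}"
      by (rule span1) (auto simp: A intro: span_base span_zero)
    then have BC: "basis2 (layer (Suc j)) B C" using basis2_if_span[OF f in1(2,3)] by blast
    define n m where "n = op Gen_a B" and "m = op Gen_a C"
    have bC: "op Gen_b C = - n"
      using rel(4) by (simp add: A op_zero n_def eq_neg_iff_add_eq_0 add.commute)
    have cB: "op Gen_c B = m" using rel(5) by (simp add: A op_zero m_def)
    have "layer (Suc (Suc j)) \<subseteq> span {n, m}"
    proof (rule layer_Suc_subset_subspace[OF BC subspace_span])
      show "op g B \<in> span {n, m}" for g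
        by (cases g) (auto simp: rel(2) cB n_def[symmetric] intro: span_base span_zero)
      show "op g C \<in> span {n, m}" for g
        by (cases g) (auto simp: rel(3) bC m_def[symmetric] intro: span_base span_zero span_neg)
    qed
    then have nm: "basis2 (layer (Suc (Suc j))) n m"
      using basis2_if_span[OF h] in2 unfolding n_def m_def by blast
    have "presents Kill_a j (\<lambda>i. [x, y, B, C, n, m] ! i)"
      by (rule presents_Kill_a[OF xy BC nm y(3)])
        (simp_all add: ABC A rel(2,3) bC cB flip: n_def m_def)
    with that[of Kill_a] show thesis by simp
  qed
qed

text \<open>The upper matrices of a and b already have trivial common kernel: one of them is the
  identity for \<open>Kill_a\<close> and \<open>Kill_b\<close>, and for \<open>Kill_abc\<close> each
  reads off one coordinate.\<close>

lemma presents_not_killed: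
  assumes P: "presents \<tau> j b" and u: "u \<in> layer (Suc j)" and kill: "\<And>g. op g u = 0"
  shows "u = 0"
proof -
  have b: "basis2 (layer (Suc j)) (b 2) (b 3)" "basis2 (layer (Suc (Suc j))) (b 4) (b 5)"
    and ops: "op g (b 2) = s (high_coeff \<tau> g 0 0) (b 4) + s (high_coeff \<tau> g 1 0) (b 5)"
      "op g (b 3) = s (high_coeff \<tau> g 0 1) (b 4) + s (high_coeff \<tau> g 1 1) (b 5)" for g
    using P unfolding presents_def by blast+
  have car: "b 2 \<in> carrier M" "b 3 \<in> carrier M"
    using b(1) layer_carrier by (auto simp: basis2_def)
  obtain k l where kl: "u = s k (b 2) + s l (b 3)" using basis2_coeffs[OF b(1) u] by blast
  have zero: "k * high_coeff \<tau> g 0 0 + l * high_coeff \<tau> g 0 1 = 0 \<and>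
      k * high_coeff \<tau> g 1 0 + l * high_coeff \<tau> g 1 1 = 0" for g
  proof (rule basis2_zeroD[OF b(2)])
    have "s k (op g (b 2)) + s l (op g (b 3)) = 0"
      using kill[of g] op_comb[OF car] by (simp add: kl)
    then show "s (k * high_coeff \<tau> g 0 0 + l * high_coeff \<tau> g 0 1) (b 4) +
        s (k * high_coeff \<tau> g 1 0 + l * high_coeff \<tau> g 1 1) (b 5) = 0"
      unfolding ops by (simp add: scale_right_distrib scale_left_distrib add.assoc add.left_commute)
  qed
  have "k = 0 \<and> l = 0"
    using zero[of Gen_a] zero[of Gen_b] by (cases \<tau>) auto
  then show ?thesis by (simp add: kl)
qed

text \<open>Layers 1, 2, 3 would produce a killed vector in layer 1, while the presentation of
  layers 0, 1, 2 rules one out.\<close>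

lemma degree_le_2: "d \<le> 2"
proof (rule ccontr)
  assume "\<not> d \<le> 2"
  then have d: "Suc (Suc 0) \<le> d" "Suc (Suc (Suc 0)) \<le> d" by simp_all
  obtain y where y: "y \<in> layer (Suc 0)" "y \<noteq> 0" "\<And>g. op g y = 0"
    using killed_vector[OF d(2)] by blast
  obtain \<tau> b where "presents \<tau> 0 b" using presentation_exists[OF d(1)] by blast
  from presents_not_killed[OF this y(1,3)] y(2) show False by simp
qed

end

section \<open>Counting\<close>

context thick_fk3_module
begin

text \<open>The vectors b define a map by coordinates. It goes out of the model because there it is
  defined on the whole ambient space, so that linearity and equivariance hold without membership
  conditions.\<close>

lemma isomorphic_model:
  assumes d: "d = 2" and \<tau>: "fk3_types \<tau>" and P: "presents \<tau> 0 b"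
  shows "graded_isomorphic (model \<tau>) M"
proof -
  interpret act: fk3_action coord_scale "model_op \<tau>" by (rule fk3_action_model[OF \<tau>])
  have b: "basis2 (layer 0) (b 0) (b 1)" "basis2 (layer 1) (b 2) (b 3)" "basis2 (layer 2) (b 4) (b 5)"
    and ops: "op g (b 0) = s (low_coeff \<tau> g 0) (b 2) + s (low_coeff \<tau> g 1) (b 3)" "op g (b 1) = 0"
      "op g (b 2) = s (high_coeff \<tau> g 0 0) (b 4) + s (high_coeff \<tau> g 1 0) (b 5)"
      "op g (b 3) = s (high_coeff \<tau> g 0 1) (b 4) + s (high_coeff \<tau> g 1 1) (b 5)" for g
    using P unfolding presents_def by (simp_all add: numeral_2_eq_2)
  have layer_0: "layer i = {0}" if i: "i > 2" for i
  proof -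
    have "has_dimension s (layer i) 0" using dimension[of i] d i by simp
    then obtain B where "finite B" "span B = layer i" "card B = 0" unfolding has_dimension_def by blast
    then show ?thesis by simp
  qed
  have bl: "b 0 \<in> layer 0" "b 1 \<in> layer 0" "b 2 \<in> layer 1" "b 3 \<in> layer 1" "b 4 \<in> layer 2" "b 5 \<in> layer 2"
    using b by (auto simp: basis2_def)
  have bc: "b 0 \<in> carrier M" "b 1 \<in> carrier M" "b 2 \<in> carrier M" "b 3 \<in> carrier M"
      "b 4 \<in> carrier M" "b 5 \<in> carrier M"
    using bl layer_carrier by blast+
  \<comment> \<open>Layer 3 is zero as d = 2, so the generators kill the top layer, as they do in
    the model.\<close>
  have ops4: "op g (b 4) = 0" "op g (b 5) = 0" for g
    using op_layer[OF bl(5), of g] op_layer[OF bl(6), of g] layer_0[of "Suc 2"] by simp_all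
  define part where "part n v = s (v (2 * n)) (b (2 * n)) + s (v (Suc (2 * n))) (b (Suc (2 * n)))" for n v
  define f where "f v = part 0 v + part 1 v + part 2 v" for v
  have part_eq: "part 0 v = s (v 0) (b 0) + s (v 1) (b 1)" "part 1 v = s (v 2) (b 2) + s (v 3) (b 3)"
      "part 2 v = s (v 4) (b 4) + s (v 5) (b 5)" for v
    by (simp_all add: part_def eval_nat_numeral)
  have part_layer: "part 0 v \<in> layer 0" "part 1 v \<in> layer 1" "part 2 v \<in> layer 2" for v
    unfolding part_eq using bl by (simp_all add: subspace_add[OF subspace_layer] subspace_scale[OF subspace_layer])
  have f_carrier: "f v \<in> carrier M" for v
    unfolding f_def using part_layer layer_carrier by (intro subspace_add[OF subspace_carrier]) blast+
  have part_add: "part n (u + v) = part n u + part n v" for n u v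
    by (simp add: part_def scale_left_distrib add.assoc add.left_commute)
  have part_scale: "part n (coord_scale k v) = s k (part n v)" for n k v
    by (simp add: part_def coord_scale_def scale_right_distrib)
  have f_add: "f (u + v) = f u + f v" for u v
    by (simp add: f_def part_add add.assoc add.left_commute)
  have f_scale: "f (coord_scale k v) = s k (f v)" for k v
    by (simp add: f_def part_scale scale_right_distrib)
  have f_op: "f (model_op \<tau> g v) = op g (f v)" for g v
  proof -
    have p0: "op g (part 0 v) = part 1 (model_op \<tau> g v)"
      unfolding part_eq op_comb[OF bc(1,2)] ops
      by (simp add: model_op_def scale_right_distrib mult.commute)
    have p1: "op g (part 1 v) = part 2 (model_op \<tau> g v)"
      unfolding part_eq op_comb[OF bc(3,4)] ops
      by (simp add: model_op_def scale_right_distrib scale_left_distrib mult.commute add.assoc add.left_commute)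
    have p2: "op g (part 2 v) = 0"
      unfolding part_eq op_comb[OF bc(5,6)] ops4 by simp
    have p3: "part 0 (model_op \<tau> g v) = 0"
      unfolding part_eq by (simp add: model_op_def)
    have pc: "part 0 v \<in> carrier M" "part 1 v \<in> carrier M" "part 2 v \<in> carrier M"
      using part_layer layer_carrier by blast+
    show ?thesis
      unfolding f_def p3 by (simp add: op_add pc subspace_add[OF subspace_carrier] p0 p1 p2 del: One_nat_def)
  qed
  have f_act: "f (act (model \<tau>) x v) = act M x (f v)" for x v
  proof (induction x)
    fix p
    show "f (act (model \<tau>) (abs_fk3 p) v) = act M (abs_fk3 p) (f v)"
      unfolding act_model[OF \<tau>] act.fk3_act_abs
      by (rule act_eq_free_act[where U = "carrier M" and s' = s and \<alpha> = "act M" and f = f,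
            OF free_algebra_action_model act_plus act_times act_one act_fk3_scale f_carrier f_add f_scale])
        (simp_all add: f_op op_def)
  qed
  have f_comp: "f v = part n v" if "v \<in> component (model \<tau>) n" "n \<le> 2" for v n
  proof -
    have v: "v i = 0" if "i div 2 \<noteq> n" for i
      using \<open>v \<in> component (model \<tau>) n\<close> that by (auto simp: model_def)
    have "n \<noteq> 0 \<Longrightarrow> part 0 v = 0" "n \<noteq> 1 \<Longrightarrow> part 1 v = 0" "n \<noteq> 2 \<Longrightarrow> part 2 v = 0"
      using v[of 0] v[of 1] v[of 2] v[of 3] v[of 4] v[of 5] by (simp_all add: part_eq del: One_nat_def)
    moreover have "n = 0 \<or> n = 1 \<or> n = 2" using that(2) by auto
    ultimately show ?thesis by (auto simp: f_def simp del: One_nat_def)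
  qed
  have image_component: "f ` component (model \<tau>) n = component M n" for n
  proof (cases "n \<le> 2")
    case True
    then have n: "n = 0 \<or> n = 1 \<or> n = 2" by auto
    have basis: "basis2 (layer n) (b (2 * n)) (b (Suc (2 * n)))"
      using n b by (auto simp: eval_nat_numeral)
    show ?thesis
    proof (intro subset_antisym subsetI)
      fix w assume "w \<in> f ` component (model \<tau>) n"
      then show "w \<in> layer n" using n f_comp[of _ n] part_layer by auto
    next
      fix w assume "w \<in> layer n"
      then obtain k l where kl: "w = s k (b (2 * n)) + s l (b (Suc (2 * n)))"
        using basis2_coeffs[OF basis] by blast
      define v where "v = (\<lambda>i. if i = 2 * n then k else if i = Suc (2 * n) then l else 0)"
      have "v \<in> component (model \<tau>) n" using True by (auto simp: model_def v_def split: if_splits)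
      moreover have "w = f v" using f_comp[OF \<open>v \<in> component (model \<tau>) n\<close> True] by (simp add: kl part_def v_def)
      ultimately show "w \<in> f ` component (model \<tau>) n" by blast
    qed
  next
    case False
    then have empty: "{i. i < 6 \<and> i div 2 = n} = {}" by auto
    have "component (model \<tau>) n = {0}" unfolding model_component empty by simp
    moreover have "f 0 = 0" using f_add[of 0 0] by simp
    ultimately show ?thesis using layer_0[of n] False by simp
  qed
  interpret pair: vector_space_pair coord_scale s ..
  have lin: "Vector_Spaces.linear coord_scale s f"
    by unfold_locales (simp_all add: f_add f_scale)
  have image_carrier: "f ` carrier (model \<tau>) = carrier M"
  proof -
    have "carrier (model \<tau>) = coord.span (\<Union>n. component (model \<tau>) n)"
      using internal_direct_sum_model[of \<tau>] unfolding internal_direct_sum_def by blast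
    moreover have "carrier M = span (\<Union>n. layer n)"
      using direct unfolding internal_direct_sum_def by blast
    ultimately show ?thesis
      by (simp add: pair.linear_span_image[OF lin, symmetric] image_UN image_component)
  qed
  have inj: "v = 0" if v: "v \<in> carrier (model \<tau>)" "f v = 0" for v
  proof -
    let ?p = "\<lambda>i. part i v"
    \<comment> \<open>The homogeneous parts of f v vanish separately because the sum of the layers
      is direct.\<close>
    have "part i v = 0" if "i \<in> {0, 1, 2}" for i
    proof (rule internal_direct_sumD[OF direct, where I = "{0, 1, 2}" and f = ?p])
      show "?p i \<in> layer i" if "i \<in> {0, 1, 2}" for i using that part_layer by auto
      show "sum ?p {0, 1, 2} = 0" using v(2) by (simp add: f_def add.assoc)
    qed (use that in auto)
    then have "part 0 v = 0" "part 1 v = 0" "part 2 v = 0" by simp_all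
    then have "v 0 = 0 \<and> v 1 = 0" "v 2 = 0 \<and> v 3 = 0" "v 4 = 0 \<and> v 5 = 0"
      unfolding part_eq using basis2_zeroD[OF b(1)] basis2_zeroD[OF b(2)] basis2_zeroD[OF b(3)] by blast+
    then have "v i = 0" if "i < 6" for i
      using that by (auto simp: less_Suc_eq eval_nat_numeral)
    then show "v = 0" using v(1) by (auto simp: model_def fun_eq_iff)
  qed
  have "inj_on f (carrier (model \<tau>))"
  proof (rule inj_onI)
    fix u v assume uv: "u \<in> carrier (model \<tau>)" "v \<in> carrier (model \<tau>)" "f u = f v"
    have "u - v \<in> carrier (model \<tau>)"
      using uv(1,2) unfolding model_carrier by (rule coord.span_diff)
    moreover have "f (u - v) = 0" by (simp add: pair.linear_diff[OF lin] uv(3))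
    ultimately show "u = v" using inj[of "u - v"] by simp
  qed
  with image_carrier have "bij_betw f (carrier (model \<tau>)) (carrier M)" by (simp add: bij_betw_def)
  then show ?thesis
    unfolding graded_isomorphic_def
    by (intro exI[of _ f] conjI ballI allI f_add f_act image_component)
qed

end

text \<open>The degree-one elements that annihilate degree zero form a line; graded isomorphisms
  preserve it, and it determines the type.\<close>

lemma model_isomorphic_imp_eq:
  fixes \<tau> \<tau>' :: "'k::field fk3_type"
  assumes \<tau>: "fk3_types \<tau>" "fk3_types \<tau>'" and iso: "graded_isomorphic (model \<tau>) (model \<tau>')"
  shows "\<tau> = \<tau>'"
proof -
  interpret A: fk3_action coord_scale "model_op \<tau>" by (rule fk3_action_model[OF \<tau>(1)])
  interpret B: fk3_action coord_scale "model_op \<tau>'" by (rule fk3_action_model[OF \<tau>(2)])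
  obtain f where "\<forall>u\<in>carrier (model \<tau>). \<forall>v\<in>carrier (model \<tau>). f (u + v) = f u + f v"
    and "\<forall>x. \<forall>u\<in>carrier (model \<tau>). f (act (model \<tau>) x u) = act (model \<tau>') x (f u)"
    and "\<forall>i. f ` component (model \<tau>) i = component (model \<tau>') i"
    using iso unfolding graded_isomorphic_def by blast
  note f = this[rule_format]
  have "(unit_vec 0 :: nat \<Rightarrow> 'k) \<in> component (model \<tau>') 0"
    by (auto simp: model_def unit_vec_def)
  then have "unit_vec 0 \<in> f ` component (model \<tau>) 0" unfolding f(3) .
  then obtain v where v: "v \<in> component (model \<tau>) 0" "f v = unit_vec 0"
    by (metis imageE)
  have vc: "v \<in> carrier (model \<tau>)" and v0: "0 \<in> carrier (model \<tau>)"
    using v(1) by (auto simp: model_def)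
  have f0: "f 0 = 0" using f(1)[OF v0 v0] by simp
  \<comment> \<open>If k a + l b + m c annihilates degree zero of the first model, it kills the
    preimage v of \<open>unit_vec 0\<close> and hence \<open>unit_vec 0\<close> itself.\<close>
  have transfer: "k * low_coeff \<tau>' Gen_a i + l * low_coeff \<tau>' Gen_b i + m * low_coeff \<tau>' Gen_c i = 0"
    if klm: "\<And>i. i < 2 \<Longrightarrow> k * low_coeff \<tau> Gen_a i + l * low_coeff \<tau> Gen_b i + m * low_coeff \<tau> Gen_c i = 0"
      and i: "i < 2" for k l m i
  proof -
    let ?l = "\<lambda>g. abs_fk3 (letter g) :: 'k fk3"
    define x where "x = fk3_scale k (?l Gen_a) + fk3_scale l (?l Gen_b) + fk3_scale m (?l Gen_c)"
    have xA: "act (model \<tau>) x u = coord_scale k (model_op \<tau> Gen_a u) + coord_scale l (model_op \<tau> Gen_b u) +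
        coord_scale m (model_op \<tau> Gen_c u)" for u
      by (simp add: act_model[OF \<tau>(1)] x_def A.fk3_act_plus A.fk3_act_scale A.fk3_act_abs A.free_act_letter)
    have xB: "act (model \<tau>') x u = coord_scale k (model_op \<tau>' Gen_a u) + coord_scale l (model_op \<tau>' Gen_b u) +
        coord_scale m (model_op \<tau>' Gen_c u)" for u
      by (simp add: act_model[OF \<tau>(2)] x_def B.fk3_act_plus B.fk3_act_scale B.fk3_act_abs B.free_act_letter)
    have "act (model \<tau>) x v = 0"
    proof
      fix j
      have high: "v 2 = 0" "v 3 = 0" using v(1) by (auto simp: model_def)
      have "(k * low_coeff \<tau> Gen_a (j - 2) + l * low_coeff \<tau> Gen_b (j - 2) + m * low_coeff \<tau> Gen_c (j - 2)) * v 0 = 0"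
        if "j = 2 \<or> j = 3" using klm[of "j - 2"] that by auto
      then show "act (model \<tau>) x v j = (0 :: nat \<Rightarrow> 'k) j"
        unfolding xA by (auto simp: model_op_def coord_scale_def high algebra_simps)
    qed
    then have "act (model \<tau>') x (unit_vec 0) = 0"
      using f(2)[OF vc, of x] f0 v(2) by simp
    from fun_cong[OF this, of "i + 2"] i show ?thesis
      unfolding xB by (auto simp: model_op_def coord_scale_def unit_vec_def less_2_cases_iff)
  qed
  show ?thesis
  proof (cases \<tau>)
    case Kill_a
    then show ?thesis using transfer[of 1 0 0 0] transfer[of 1 0 0 1] by (cases \<tau>') auto
  next
    case Kill_b
    then show ?thesis using transfer[of 0 1 0 0] transfer[of 0 1 0 1] by (cases \<tau>') auto
  next
    case (Kill_abc t)
    then have "i < 2 \<Longrightarrow> t * low_coeff \<tau>' Gen_a i + - (t * t) * low_coeff \<tau>' Gen_b i + 1 * low_coeff \<tau>' Gen_c i = 0" for i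
      by (intro transfer) auto
    from this[of 0] this[of 1] Kill_abc show ?thesis by (cases \<tau>') (auto split: if_splits)
  qed
qed

text \<open>t^4 = t means t = 0 or t^3 = 1, so 0 is counted together with the cube roots of unity,
  of which there are one or three.\<close>

lemma card_fixed_fourth_power:
  "card {t::'k::field. t ^ 4 = t} =
    (if CHAR('k) = 3 \<or> (CHAR('k) \<noteq> 3 \<and> \<not> (\<exists>\<zeta>::'k. primitive_root 3 \<zeta>)) then 2 else 4)"
proof -
  have cubes: "{t::'k. t ^ 4 = t} = insert 0 {t. t ^ 3 = 1}"
  proof -
    have "t ^ 4 = t \<longleftrightarrow> t * (t ^ 3 - 1) = 0" for t :: 'k
      by (simp add: right_diff_distrib power4_eq_xxxx power3_eq_cube)
    then show ?thesis by (auto simp: power3_eq_cube)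
  qed
  \<comment> \<open>Already z^3 = z^2 = 1 gives z = 1, so only the exponent 1 has to be
    excluded.\<close>
  have prim: "primitive_root 3 z \<longleftrightarrow> z ^ 3 = 1 \<and> z \<noteq> 1" for z :: 'k
  proof -
    have "{0<..<3::nat} = {1, 2}" by auto
    moreover have "z = 1" if "z ^ 3 = 1" "z ^ 2 = 1"
      using that by (simp add: power3_eq_cube power2_eq_square)
    ultimately show ?thesis by (auto simp: primitive_root_def)
  qed
  show ?thesis
  proof (cases "CHAR('k) = 3 \<or> \<not> (\<exists>\<zeta>::'k. primitive_root 3 \<zeta>)")
    case True
    have "t = 1" if t: "t ^ 3 = 1" for t :: 'k
    proof (cases "CHAR('k) = 3")
      case c: True
      have "(3 :: 'k) = 0" using of_nat_CHAR[where 'a = 'k] c by simp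
      \<comment> \<open>In characteristic 3 cubing is additive, which makes 1 the only cube root of
        unity.\<close>
      moreover have "(t - 1) ^ 3 = t ^ 3 - 1 - 3 * (t * t - t)"
        unfolding power3_eq_cube by algebra
      ultimately have "(t - 1) ^ 3 = t ^ 3 - 1" by simp
      with t show ?thesis by simp
    qed (use True prim t in blast)
    then have "{t::'k. t ^ 3 = 1} = {1}" by auto
    with True cubes show ?thesis by auto
  next
    case False
    then obtain z :: 'k where z: "z ^ 3 = 1" "z \<noteq> 1" using prim by blast
    have z0: "z \<noteq> 0" using z(1) by auto
    have sq: "z * z + z + 1 = 0"
    proof -
      have "(z - 1) * (z * z + z + 1) = z ^ 3 - 1" by (simp add: algebra_simps power3_eq_cube)
      with z show ?thesis by simp
    qed
    \<comment> \<open>By z^2 + z + 1 = 0, the polynomial t^3 - 1 factors as (t - 1)(t - z)(t -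
      z^2).\<close>
    have "t ^ 3 = 1 \<longleftrightarrow> t \<in> {1, z, z * z}" for t
    proof -
      have "t ^ 3 - 1 = (t - 1) * ((t - z) * (t - z * z))"
        using sq unfolding power3_eq_cube by algebra
      then show ?thesis by (metis insert_iff mult_eq_0_iff right_minus_eq singletonD)
    qed
    then have "{t. t ^ 3 = 1} = {1, z, z * z}" by blast
    moreover have "z * z \<noteq> 1" "z * z \<noteq> z" using z z0 by (auto simp: power3_eq_cube)
    ultimately have "card (insert 0 {t::'k. t ^ 3 = 1}) = 4" using z z0 by auto
    with False cubes show ?thesis by simp
  qed
qed

lemma card_fk3_types:
  "card {\<tau>::'k::field fk3_type. fk3_types \<tau>} = 2 + card {t::'k. t ^ 4 = t}"
proof -
  have eq: "{\<tau>::'k fk3_type. fk3_types \<tau>} = {Kill_a, Kill_b} \<union> Kill_abc ` {t. t ^ 4 = t}"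
  proof (intro set_eqI)
    fix \<tau> :: "'k fk3_type"
    show "\<tau> \<in> {\<tau>. fk3_types \<tau>} \<longleftrightarrow> \<tau> \<in> {Kill_a, Kill_b} \<union> Kill_abc ` {t. t ^ 4 = t}"
      by (cases \<tau>) auto
  qed
  \<comment> \<open>\<open>card\<close> is 0 on infinite sets, so the computed value also yields
    finiteness.\<close>
  have "card {t::'k. t ^ 4 = t} \<noteq> 0"
    unfolding card_fixed_fourth_power by simp
  then have "finite {t::'k. t ^ 4 = t}" by (meson card.infinite)
  then show ?thesis
    unfolding eq by (subst card_Un_disjoint) (auto simp: card_image inj_on_def)
qed

theorem theorem1p6:
  "card (Gamma (fk3_scale :: 'k::field \<Rightarrow> 'k fk3 \<Rightarrow> 'k fk3) fk3_degree 2 2) =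
     (if CHAR('k) = 3 \<or> (CHAR('k) \<noteq> 3 \<and> \<not> (\<exists>\<zeta>::'k. primitive_root 3 \<zeta>)) then 4 else 6) \<and>
   (\<forall>d>2. Gamma (fk3_scale :: 'k \<Rightarrow> 'k fk3 \<Rightarrow> 'k fk3) fk3_degree 2 d = {})"
proof (intro conjI allI impI)
  have is_thick: "thick_fk3_module coord_scale M d"
    if "truncated_thick_point_module fk3_scale fk3_degree coord_scale 2 d M"
    for M :: "('k fk3, nat \<Rightarrow> 'k) graded_module" and d
    using that by unfold_locales
  {
    fix d :: nat assume d: "d > 2"
    have "\<not> truncated_thick_point_module fk3_scale fk3_degree coord_scale 2 d M"
      for M :: "('k fk3, nat \<Rightarrow> 'k) graded_module"
      using thick_fk3_module.degree_le_2[OF is_thick] d by fastforce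
    then show "Gamma (fk3_scale :: 'k \<Rightarrow> 'k fk3 \<Rightarrow> 'k fk3) fk3_degree 2 d = {}"
      unfolding Gamma_def by simp
  }
  let ?S = "{M :: ('k fk3, nat \<Rightarrow> 'k) graded_module.
    truncated_thick_point_module fk3_scale fk3_degree coord_scale 2 2 M}"
  let ?R = "{(M, N :: ('k fk3, nat \<Rightarrow> 'k) graded_module).
    truncated_thick_point_module fk3_scale fk3_degree coord_scale 2 2 M \<and>
    truncated_thick_point_module fk3_scale fk3_degree coord_scale 2 2 N \<and> graded_isomorphic M N}"
  let ?T = "{\<tau> :: 'k fk3_type. fk3_types \<tau>}"
  have equiv: "equiv ?S ?R" by (rule equiv_graded_isomorphic)
  have in_S: "model \<tau> \<in> ?S" if "\<tau> \<in> ?T" for \<tau>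
    using truncated_thick_point_module_model that by blast
  \<comment> \<open>Every class contains a model, and by \<open>model_isomorphic_imp_eq\<close> only
    one, so counting classes is counting types.\<close>
  have "?S // ?R = (\<lambda>\<tau>. ?R `` {model \<tau>}) ` ?T"
  proof (intro subset_antisym subsetI)
    fix X assume "X \<in> ?S // ?R"
    then obtain M where M: "M \<in> ?S" "X = ?R `` {M}" by (rule quotientE)
    interpret thick_fk3_module coord_scale M 2 by (rule is_thick) (use M(1) in blast)
    obtain \<tau> b where \<tau>: "fk3_types \<tau>" "presents \<tau> 0 b" using presentation_exists[of 0] by auto
    have "(model \<tau>, M) \<in> ?R"
      using isomorphic_model[OF refl \<tau>] in_S[of \<tau>] \<tau>(1) M(1) by simp
    then have "?R `` {model \<tau>} = X" unfolding M(2) by (rule equiv_class_eq[OF equiv])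
    with \<tau>(1) show "X \<in> (\<lambda>\<tau>. ?R `` {model \<tau>}) ` ?T" by blast
  next
    fix X assume "X \<in> (\<lambda>\<tau>. ?R `` {model \<tau>}) ` ?T"
    then obtain \<tau> where \<tau>: "\<tau> \<in> ?T" and X: "X = ?R `` {model \<tau>}" by (rule imageE)
    show "X \<in> ?S // ?R" unfolding X by (rule quotientI[OF in_S[OF \<tau>]])
  qed
  moreover have "inj_on (\<lambda>\<tau>. ?R `` {model \<tau>}) ?T"
  proof (rule inj_onI)
    fix \<tau> \<tau>' assume t: "\<tau> \<in> ?T" "\<tau>' \<in> ?T" "?R `` {model \<tau>} = ?R `` {model \<tau>'}"
    then have "(model \<tau>, model \<tau>') \<in> ?R" using eq_equiv_class[OF t(3) equiv in_S] by blast
    then show "\<tau> = \<tau>'" using model_isomorphic_imp_eq t(1,2) by blast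
  qed
  ultimately have "card (Gamma (fk3_scale :: 'k \<Rightarrow> 'k fk3 \<Rightarrow> 'k fk3) fk3_degree 2 2) = card ?T"
    unfolding Gamma_def by (simp add: card_image)
  then show "card (Gamma (fk3_scale :: 'k \<Rightarrow> 'k fk3 \<Rightarrow> 'k fk3) fk3_degree 2 2) =
     (if CHAR('k) = 3 \<or> (CHAR('k) \<noteq> 3 \<and> \<not> (\<exists>\<zeta>::'k. primitive_root 3 \<zeta>)) then 4 else 6)"
    by (simp add: card_fk3_types card_fixed_fourth_power)
qed

end
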